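(* Let $M\ge3$, let $\mathfrak{A}_M=\mathbb{C}\langle u_1,\dots,u_M\rangle$ with indices of the generators read modulo $M$, and let $\partial_{t_1}$ be the derivation of $\mathfrak{A}_M$ with $\partial_{t_1}(u_n)=u_{n+1}u_n-u_nu_{n-1}$ ($n\in\mathbb{Z}_M$). Let $\mathfrak{I}_M\subset\mathfrak{A}_M$ be a two-sided ideal generated by polynomials $$\mathfrak{f}_{i,j}=u_iu_j-\omega_{i,j}u_ju_i-\sum_{r=1}^M\sigma^r_{i,j}u_r-\eta_{i,j},\qquad 1\le i<j\le M,$$ with constants $\omega_{i,j}\in\mathbb{C}^*$, $\sigma_{i,j}^r,\eta_{i,j}\in\mathbb{C}$. Then $\mathfrak{I}_M$ is a quantisation ideal for $\partial_{t_1}$ if and only if the commutation relations $\mathfrak{f}_{i,j}=0$ ($1\le i<j\le M$) are (equivalent to) the following ones, for some constants $\alpha\in\mathbb{C}^*$ and $\beta,\gamma,\eta\in\mathbb{C}$ (which may be arbitrary): (M=3): $u_nu_{n+1}=\alpha u_{n+1}u_n+\beta(u_1+u_2+u_3)+\eta$ for $n\in\mathbb{Z}_3$; (M=4): $u_1u_2=\alpha u_2u_1+\beta u_2+\gamma u_1-\beta\gamma$, $u_1u_3=u_3u_1-\beta u_2+\beta u_4$, $u_4u_1=\alpha u_1u_4+\beta u_4+\gamma u_1-\beta\gamma$, $u_2u_3=\alpha u_3u_2+\beta u_2+\gamma u_3-\beta\gamma$, $u_2u_4=u_4u_2-\gamma u_3+\gamma u_1$, $u_3u_4=\alpha u_4u_3+\beta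 u_4+\gamma u_3-\beta\gamma$; ($M\ge5$): $u_nu_{n+1}=\alpha u_{n+1}u_n$ for $n\in\mathbb{Z}_M$, and $u_nu_m=u_mu_n$ for all $n,m\in\mathbb{Z}_M$ with $n-m\not\equiv 0,\pm1 \pmod M$.
   Context: The ideal $\mathfrak{I}_M$ is called a quantisation ideal for $\partial_{t_1}$ (and one says that the $M$-periodic nonabelian Volterra chain admits an $\mathfrak{I}_M$-quantisation) if (i) $\partial_{t_1}(\mathfrak{I}_M)\subset\mathfrak{I}_M$, and (ii) the quotient algebra $\mathfrak{A}_M/\mathfrak{I}_M$ has as a $\mathbb{C}$-linear basis the (images of the) normally ordered monomials $u_{i_1}u_{i_2}\cdots u_{i_s}$ with $M\ge i_1\ge i_2\ge\cdots\ge i_s\ge1$, $s\ge0$. Derivations are $\mathbb{C}$-linear and satisfy the Leibniz rule. *)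

theory Defs
  imports Complex_Main "HOL-Library.Poly_Mapping" "HOL-Algebra.QuotRing"
begin

text \<open>
  Words form a monoid under concatenation, so that the product of
  \<^typ>\<open>nat list \<Rightarrow>\<^sub>0 complex\<close> is the one of the free associative algebra
  on the letters \<^typ>\<open>nat\<close>.
\<close>

instantiation list :: (type) monoid_add
begin

definition zero_list :: "'a list" where "zero_list = []"

definition plus_list :: "'a list \<Rightarrow> 'a list \<Rightarrow> 'a list" where "plus_list = (@)"

instance by standard (simp_all add: zero_list_def plus_list_def)

end

type_synonym ncpoly = "nat list \<Rightarrow>\<^sub>0 complex"

definition mono_word :: "nat list \<Rightarrow> ncpoly" where
  "mono_word w = Poly_Mapping.single w 1"

definition cnst :: "complex \<Rightarrow> ncpoly" where
  "cnst c = Poly_Mapping.single [] c"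

definition free_alg :: "nat \<Rightarrow> ncpoly ring" where
  "free_alg M = \<lparr>carrier = {p. \<forall>w\<in>Poly_Mapping.keys p. set w \<subseteq> {1..M}},
                 monoid.mult = (*), one = 1, zero = 0, add = (+)\<rparr>"

text \<open>The generator \<open>u\<^sub>n\<close>; the index is reduced modulo \<open>M\<close> into \<open>{1..M}\<close>.\<close>

definition gen :: "nat \<Rightarrow> int \<Rightarrow> ncpoly" where
  "gen M n = mono_word [nat ((n - 1) mod int M) + 1]"

definition derivation :: "nat \<Rightarrow> (ncpoly \<Rightarrow> ncpoly) \<Rightarrow> bool" where
  "derivation M D \<longleftrightarrow>
     D \<in> carrier (free_alg M) \<rightarrow> carrier (free_alg M) \<and>
     (\<forall>a\<in>carrier (free_alg M). \<forall>b\<in>carrier (free_alg M). D (a + b) = D a + D b) \<and>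
     (\<forall>c. \<forall>a\<in>carrier (free_alg M). D (cnst c * a) = cnst c * D a) \<and>
     (\<forall>a\<in>carrier (free_alg M). \<forall>b\<in>carrier (free_alg M). D (a * b) = D a * b + a * D b)"

definition volterra_derivation :: "nat \<Rightarrow> (ncpoly \<Rightarrow> ncpoly) \<Rightarrow> bool" where
  "volterra_derivation M D \<longleftrightarrow>
     derivation M D \<and>
     (\<forall>n. D (gen M n) = gen M (n + 1) * gen M n - gen M n * gen M (n - 1))"

definition normal_words :: "nat \<Rightarrow> nat list set" where
  "normal_words M = {w. set w \<subseteq> {1..M} \<and> sorted_wrt (\<ge>) w}"

text \<open>
  A finite linear combination, formed in the quotient algebra, of the images of the
  monomials in \<open>S\<close>; a scalar acts as multiplication by the class of the constant.
\<close>

definition quot_lincomb :: "nat \<Rightarrow> ncpoly set \<Rightarrow> nat list set \<Rightarrow> (nat list \<Rightarrow> complex) \<Rightarrow> ncpoly set"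
  where "quot_lincomb M I S c =
    (\<Oplus>\<^bsub>free_alg M Quot I\<^esub> w\<in>S.
       (I +>\<^bsub>free_alg M\<^esub> cnst (c w)) \<otimes>\<^bsub>free_alg M Quot I\<^esub> (I +>\<^bsub>free_alg M\<^esub> mono_word w))"

definition normal_words_basis :: "nat \<Rightarrow> ncpoly set \<Rightarrow> bool" where
  "normal_words_basis M I \<longleftrightarrow>
     (\<forall>q\<in>carrier (free_alg M Quot I).
        \<exists>S c. finite S \<and> S \<subseteq> normal_words M \<and> q = quot_lincomb M I S c) \<and>
     (\<forall>S c. finite S \<longrightarrow> S \<subseteq> normal_words M \<longrightarrow>
        quot_lincomb M I S c = \<zero>\<^bsub>free_alg M Quot I\<^esub> \<longrightarrow> (\<forall>w\<in>S. c w = 0))"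

definition quantisation_ideal :: "nat \<Rightarrow> (ncpoly \<Rightarrow> ncpoly) \<Rightarrow> ncpoly set \<Rightarrow> bool" where
  "quantisation_ideal M D I \<longleftrightarrow>
     ideal I (free_alg M) \<and> D ` I \<subseteq> I \<and> normal_words_basis M I"

definition comm_poly ::
    "nat \<Rightarrow> (nat \<Rightarrow> nat \<Rightarrow> complex) \<Rightarrow> (nat \<Rightarrow> nat \<Rightarrow> nat \<Rightarrow> complex) \<Rightarrow> (nat \<Rightarrow> nat \<Rightarrow> complex) \<Rightarrow>
     nat \<Rightarrow> nat \<Rightarrow> ncpoly" where
  "comm_poly M \<omega> \<sigma> \<eta> i j =
     gen M (int i) * gen M (int j) - cnst (\<omega> i j) * (gen M (int j) * gen M (int i))
     - (\<Sum>r=1..M. cnst (\<sigma> r i j) * gen M (int r)) - cnst (\<eta> i j)"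

definition comm_polys ::
    "nat \<Rightarrow> (nat \<Rightarrow> nat \<Rightarrow> complex) \<Rightarrow> (nat \<Rightarrow> nat \<Rightarrow> nat \<Rightarrow> complex) \<Rightarrow> (nat \<Rightarrow> nat \<Rightarrow> complex) \<Rightarrow>
     ncpoly set" where
  "comm_polys M \<omega> \<sigma> \<eta> = {comm_poly M \<omega> \<sigma> \<eta> i j | i j. 1 \<le> i \<and> i < j \<and> j \<le> M}"

text \<open>In the following sets, a relation \<open>l = r\<close> is represented by the polynomial \<open>l - r\<close>.\<close>

definition relations3 :: "complex \<Rightarrow> complex \<Rightarrow> complex \<Rightarrow> ncpoly set" where
  "relations3 \<alpha> \<beta> \<eta> = (let u = gen 3 in
     {u n * u (n + 1) -
        (cnst \<alpha> * (u (n + 1) * u n) + cnst \<beta> * (u 1 + u 2 + u 3) + cnst \<eta>) | n. True})"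

definition relations4 :: "complex \<Rightarrow> complex \<Rightarrow> complex \<Rightarrow> ncpoly set" where
  "relations4 \<alpha> \<beta> \<gamma> = (let u = gen 4 in
     {u 1 * u 2 - (cnst \<alpha> * (u 2 * u 1) + cnst \<beta> * u 2 + cnst \<gamma> * u 1 - cnst (\<beta> * \<gamma>)),
      u 1 * u 3 - (u 3 * u 1 - cnst \<beta> * u 2 + cnst \<beta> * u 4),
      u 4 * u 1 - (cnst \<alpha> * (u 1 * u 4) + cnst \<beta> * u 4 + cnst \<gamma> * u 1 - cnst (\<beta> * \<gamma>)),
      u 2 * u 3 - (cnst \<alpha> * (u 3 * u 2) + cnst \<beta> * u 2 + cnst \<gamma> * u 3 - cnst (\<beta> * \<gamma>)),
      u 2 * u 4 - (u 4 * u 2 - cnst \<gamma> * u 3 + cnst \<gamma> * u 1),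
      u 3 * u 4 - (cnst \<alpha> * (u 4 * u 3) + cnst \<beta> * u 4 + cnst \<gamma> * u 3 - cnst (\<beta> * \<gamma>))})"

definition relations5 :: "nat \<Rightarrow> complex \<Rightarrow> ncpoly set" where
  "relations5 M \<alpha> = (let u = gen M in
     {u n * u (n + 1) - cnst \<alpha> * (u (n + 1) * u n) | n. True} \<union>
     {u n * u m - u m * u n | n m.
        (n - m) mod int M \<noteq> 0 \<and> (n - m - 1) mod int M \<noteq> 0 \<and> (n - m + 1) mod int M \<noteq> 0})"

definition volterra_relations ::
    "nat \<Rightarrow> complex \<Rightarrow> complex \<Rightarrow> complex \<Rightarrow> complex \<Rightarrow> ncpoly set" where
  "volterra_relations M \<alpha> \<beta> \<gamma> \<eta> =
     (if M = 3 then relations3 \<alpha> \<beta> \<eta>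
      else if M = 4 then relations4 \<alpha> \<beta> \<gamma>
      else relations5 M \<alpha>)"

text \<open>Two systems of relations are equivalent if they have the same consequences.\<close>

definition equivalent_relations :: "nat \<Rightarrow> ncpoly set \<Rightarrow> ncpoly set \<Rightarrow> bool" where
  "equivalent_relations M F G \<longleftrightarrow>
     genideal (free_alg M) F = genideal (free_alg M) G"

lemma ncpoly_induct [case_names single sum]:
  fixes p :: ncpoly
  assumes single: "\<And>w c. P (Poly_Mapping.single w c)"
    and sum: "\<And>p q. P p \<Longrightarrow> P q \<Longrightarrow> P (p + q)"
  shows "P p"
proof -
  have "P (\<Sum>w\<in>S. Poly_Mapping.single w (Poly_Mapping.lookup p w))" if "finite S" for S
    using that
  proof (induction S rule: finite_induct)
    case empty
    then show ?case using single[of "[]" 0] by simp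
  next
    case (insert x S)
    then show ?case by (simp add: single sum)
  qed
  moreover have "(\<Sum>w\<in>Poly_Mapping.keys p. Poly_Mapping.single w (Poly_Mapping.lookup p w)) = p"
    by (rule poly_mapping_eqI)
       (auto simp: lookup_sum lookup_single when_def in_keys_iff sum.delta)
  ultimately show ?thesis by (metis finite_keys)
qed

lemma cnst_comm: "cnst c * p = p * cnst c"
proof (induction p rule: ncpoly_induct)
  case (single k v)
  then show ?case by (simp add: cnst_def mult_single plus_list_def mult.commute)
next
  case (sum p q)
  then show ?case by (simp add: distrib_left distrib_right)
qed

lemma free_alg_simps [simp]:
  "monoid.mult (free_alg M) = (*)" "one (free_alg M) = 1"
  "zero (free_alg M) = 0" "add (free_alg M) = (+)"
  by (simp_all add: free_alg_def)

lemma carrier_free_alg: "p \<in> carrier (free_alg M) \<longleftrightarrow> (\<forall>w\<in>Poly_Mapping.keys p. set w \<subseteq> {1..M})"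
  by (simp add: free_alg_def)

lemma free_alg_closed:
  "0 \<in> carrier (free_alg M)"
  "1 \<in> carrier (free_alg M)"
  "p \<in> carrier (free_alg M) \<Longrightarrow> - p \<in> carrier (free_alg M)"
  "p \<in> carrier (free_alg M) \<Longrightarrow> q \<in> carrier (free_alg M) \<Longrightarrow> p + q \<in> carrier (free_alg M)"
  "p \<in> carrier (free_alg M) \<Longrightarrow> q \<in> carrier (free_alg M) \<Longrightarrow> p - q \<in> carrier (free_alg M)"
  "p \<in> carrier (free_alg M) \<Longrightarrow> q \<in> carrier (free_alg M) \<Longrightarrow> p * q \<in> carrier (free_alg M)"
  "cnst c \<in> carrier (free_alg M)"
  "set w \<subseteq> {1..M} \<Longrightarrow> mono_word w \<in> carrier (free_alg M)"
proof -
  show "0 \<in> carrier (free_alg M)" by (simp add: carrier_free_alg)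
  show "1 \<in> carrier (free_alg M)" by (simp add: carrier_free_alg zero_list_def)
  show "cnst c \<in> carrier (free_alg M)" by (simp add: carrier_free_alg cnst_def)
  show "mono_word w \<in> carrier (free_alg M)" if "set w \<subseteq> {1..M}"
    using that by (simp add: carrier_free_alg mono_word_def)
  assume p: "p \<in> carrier (free_alg M)"
  then show "- p \<in> carrier (free_alg M)" by (simp add: carrier_free_alg)
  assume q: "q \<in> carrier (free_alg M)"
  show "p + q \<in> carrier (free_alg M)"
    using p q Poly_Mapping.keys_add[of p q] by (auto simp: carrier_free_alg)
  show "p - q \<in> carrier (free_alg M)"
    using p q keys_diff[of p q] by (auto simp: carrier_free_alg)
  show "p * q \<in> carrier (free_alg M)"
    unfolding carrier_free_alg
  proof
    fix w assume "w \<in> Poly_Mapping.keys (p * q)"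
    then obtain a b where "w = a + b" "a \<in> Poly_Mapping.keys p" "b \<in> Poly_Mapping.keys q"
      using keys_mult[of p q] by auto
    then show "set w \<subseteq> {1..M}"
      using p q by (auto simp: carrier_free_alg plus_list_def)
  qed
qed

lemma ring_free_alg: "ring (free_alg M)"
proof (intro ringI abelian_groupI monoidI)
  fix x assume "x \<in> carrier (free_alg M)"
  then show "\<exists>y\<in>carrier (free_alg M). y \<oplus>\<^bsub>free_alg M\<^esub> x = \<zero>\<^bsub>free_alg M\<^esub>"
    by (intro bexI[of _ "- x"]) (simp_all add: free_alg_closed)
qed (simp_all add: free_alg_closed algebra_simps)

lemma gen_closed: "M > 0 \<Longrightarrow> gen M n \<in> carrier (free_alg M)"
  unfolding gen_def
  by (rule free_alg_closed) (use pos_mod_bound[of "int M" "n - 1"] in \<open>auto simp: le_nat_iff nat_less_iff Suc_le_eq\<close>)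

primrec volterra_word :: "nat \<Rightarrow> nat list \<Rightarrow> ncpoly" where
  "volterra_word M [] = 0"
| "volterra_word M (a # w) =
     (gen M (int a + 1) * gen M (int a) - gen M (int a) * gen M (int a - 1)) * mono_word w
     + mono_word [a] * volterra_word M w"

definition volterra_map :: "nat \<Rightarrow> ncpoly \<Rightarrow> ncpoly" where
  "volterra_map M p = (\<Sum>w\<in>Poly_Mapping.keys p. cnst (Poly_Mapping.lookup p w) * volterra_word M w)"

lemma volterra_map_superset:
  assumes "finite S" "Poly_Mapping.keys p \<subseteq> S"
  shows "volterra_map M p = (\<Sum>w\<in>S. cnst (Poly_Mapping.lookup p w) * volterra_word M w)"
  unfolding volterra_map_def using assms
  by (intro sum.mono_neutral_left) (auto simp: cnst_def in_keys_iff)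

lemma volterra_map_add: "volterra_map M (p + q) = volterra_map M p + volterra_map M q"
proof -
  let ?S = "Poly_Mapping.keys p \<union> Poly_Mapping.keys q"
  have "volterra_map M r = (\<Sum>w\<in>?S. cnst (Poly_Mapping.lookup r w) * volterra_word M w)"
    if "Poly_Mapping.keys r \<subseteq> ?S" for r
    using that by (intro volterra_map_superset) auto
  then show ?thesis
    using Poly_Mapping.keys_add[of p q]
    by (simp add: lookup_add cnst_def single_add distrib_right sum.distrib)
qed

lemma volterra_map_single: "volterra_map M (Poly_Mapping.single w c) = cnst c * volterra_word M w"
  by (subst volterra_map_superset[of "{w}"]) auto

lemma mono_word_Nil: "mono_word [] = 1"
  by (simp add: mono_word_def flip: zero_list_def)

lemma cnst_1: "cnst 1 = 1"
  by (simp add: cnst_def flip: zero_list_def)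

lemma mono_word_append: "mono_word (v @ w) = mono_word v * mono_word w"
  by (simp add: mono_word_def mult_single plus_list_def)

lemma volterra_word_append:
  "volterra_word M (v @ w) = volterra_word M v * mono_word w + mono_word v * volterra_word M w"
proof (induction v)
  case Nil
  then show ?case by (simp add: mono_word_Nil)
next
  case (Cons a v)
  have "mono_word (a # v) = mono_word [a] * mono_word v"
    using mono_word_append[of "[a]" v] by simp
  with Cons show ?case
    by (simp add: mono_word_append distrib_left distrib_right mult.assoc)
qed

lemma single_eq_cnst: "Poly_Mapping.single w c = cnst c * mono_word w"
  by (simp add: cnst_def mono_word_def mult_single plus_list_def)

lemma cnst_mult: "cnst (c * d) = cnst c * cnst d"
  by (simp add: cnst_def mult_single plus_list_def)

lemma volterra_map_mult: "volterra_map M (p * q) = volterra_map M p * q + p * volterra_map M q"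
proof (induction p rule: ncpoly_induct)
  case p: (single v c)
  show ?case
  proof (induction q rule: ncpoly_induct)
    case (single w d)
    have "cnst (c * d) * (x * y) = (cnst c * x) * (cnst d * y)" for x y
      by (metis cnst_mult cnst_comm mult.assoc)
    moreover have "volterra_map M (Poly_Mapping.single v c * Poly_Mapping.single w d)
        = cnst (c * d) * (volterra_word M v * mono_word w + mono_word v * volterra_word M w)"
      by (simp add: mult_single plus_list_def volterra_map_single volterra_word_append)
    ultimately show ?case
      by (simp only: single_eq_cnst volterra_map_single[unfolded single_eq_cnst] distrib_left)
  next
    case (sum q r)
    then show ?case by (simp add: distrib_left volterra_map_add algebra_simps)
  qed
next
  case (sum p r)
  then show ?case by (simp add: distrib_right volterra_map_add algebra_simps)
qed

lemma volterra_map_closed: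
  assumes M: "M > 0" and p: "p \<in> carrier (free_alg M)"
  shows "volterra_map M p \<in> carrier (free_alg M)"
proof -
  have word: "volterra_word M w \<in> carrier (free_alg M)" if "set w \<subseteq> {1..M}" for w
    using that by (induction w) (simp_all add: free_alg_closed gen_closed M)
  have "sum f S \<in> carrier (free_alg M)"
    if "finite S" "\<And>w. w \<in> S \<Longrightarrow> f w \<in> carrier (free_alg M)" for S and f :: "nat list \<Rightarrow> ncpoly"
    using that by (induction S rule: finite_induct) (simp_all add: free_alg_closed)
  then show ?thesis
    using p word unfolding volterra_map_def by (simp add: carrier_free_alg[of p] free_alg_closed)
qed

lemma volterra_derivation_exists:
  assumes M: "M > 0"
  shows "volterra_derivation M (volterra_map M)"
proof -
  have const: "volterra_map M (cnst c) = 0" for c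
    by (simp add: volterra_map_single cnst_def)
  have idx: "gen M (int (nat ((n - 1) mod int M) + 1) + k) = gen M (n + k)" for n k
  proof -
    have "(int (nat ((n - 1) mod int M) + 1) + k - 1) mod int M = ((n - 1) mod int M + k) mod int M"
      using M by simp
    also have "\<dots> = (n + k - 1) mod int M"
      by (simp add: mod_simps algebra_simps)
    finally show ?thesis by (simp only: gen_def)
  qed
  have "volterra_map M (gen M n) = gen M (n + 1) * gen M n - gen M n * gen M (n - 1)" for n
  proof -
    let ?k = "nat ((n - 1) mod int M) + 1"
    have "volterra_map M (gen M n) = volterra_word M [?k]"
      unfolding gen_def mono_word_def volterra_map_single by (simp add: cnst_1)
    also have "\<dots> = gen M (int ?k + 1) * gen M (int ?k) - gen M (int ?k) * gen M (int ?k - 1)"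
      by (simp add: mono_word_Nil)
    finally show ?thesis
      using idx[of n 1] idx[of n 0] idx[of n "-1"] by simp
  qed
  then show ?thesis
    using M by (simp add: volterra_derivation_def derivation_def volterra_map_closed
        volterra_map_add volterra_map_mult const)
qed

end

theory Submission
  imports Defs "HOL-Library.Multiset"
begin

text \<open>
  Necessity. If the normal monomials form a basis of the quotient, every normal word has a dual
  functional that vanishes on the ideal. Applying to \<open>\<partial>(f\<^sub>i\<^sub>j)\<close> the functionals dual to words of
  length 3, 2 and 1 determines, in this order, the \<open>\<omega>\<close>, the \<open>\<sigma>\<close> (on which the conditions are
  linear once \<open>\<omega>\<close> is known) and the \<open>\<eta>\<close>. No Jacobi-type conditions are needed. All
  coefficients are extended to indices modulo \<open>M\<close>, which makes the conditions cyclically symmetric.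

  Sufficiency. The basis property follows from the diamond lemma: one relation is selected for each
  non-normal word, and if the overlaps \<open>u\<^sub>i u\<^sub>j u\<^sub>k\<close> with \<open>i < j < k\<close> resolve, then the selected
  relations, which have distinct leading words, already span the ideal. Invariance is checked on the
  generators, where \<open>\<partial>(f\<^sub>i\<^sub>j)\<close> is a combination of relations plus an expression that is at most quadratic.
\<close>

section \<open>Functionals on the free algebra and normal words\<close>

text \<open>A functional of low degree cannot be evaluated directly on the cubic words of a
  derivative, because its values there depend on all lower-order coefficients. Once the
  \<open>\<omega>\<close> are known, the identities \<open>D_F_adjacent\<close> to
  \<open>D_F_distance_two_four\<close> therefore subtract explicit multiples of relations, so that
  only products of generators with inhomogeneous parts and derivatives of inhomogeneous parts
  remain. The same identities serve both directions: for a quantisation ideal the remainder must lie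
  in the ideal, and for the listed relations it is shown to do so. For small \<open>M\<close>
  neighbours of the two indices coincide (\<open>i - 1\<close> with \<open>i + 2\<close> for
  \<open>M = 3\<close>, with \<open>i + 3\<close> for \<open>M = 4\<close>), which destroys some
  cancellations, creates others and leaves room for linear terms. A relation may be read for either
  order of its two indices, the readings differing by a nonzero factor; so the pair of the last and
  the first generator is treated like any other adjacent pair.\<close>

lemma cnst_hom:
  "cnst 0 = 0" "cnst (c + d) = cnst c + cnst d" "cnst (- c) = - cnst c" "cnst (c - d) = cnst c - cnst d"
  by (simp_all add: cnst_def single_add single_uminus single_diff)

lemma cnst_merge: "cnst c * (cnst d * p) = cnst (c * d) * p"
  by (simp add: cnst_mult mult.assoc)

lemma mult_cnst: "p * (cnst c * r) = cnst c * (p * r)"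
  by (metis cnst_comm mult.assoc)

lemma lookup_cnst_mult: "Poly_Mapping.lookup (cnst c * p) w = c * Poly_Mapping.lookup p w"
proof (induction p rule: ncpoly_induct)
  case (single v d)
  then show ?case by (simp add: cnst_def mult_single plus_list_def lookup_single when_def)
next
  case (sum p r)
  then show ?case by (simp add: lookup_add algebra_simps)
qed

lemma lookup_mono_word: "Poly_Mapping.lookup (mono_word v) w = (if v = w then 1 else 0)"
  by (simp add: mono_word_def lookup_single when_def)

lemma lookup_lincomb:
  assumes "finite S"
  shows "Poly_Mapping.lookup (\<Sum>w\<in>S. cnst (c w) * mono_word w) v = (if v \<in> S then c v else 0)"
  using assms
  by (induction S rule: finite_induct) (auto simp: lookup_add lookup_cnst_mult lookup_mono_word)

lemma ncpoly_expand:
  "p = (\<Sum>w\<in>Poly_Mapping.keys p. cnst (Poly_Mapping.lookup p w) * mono_word w)"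
  by (rule poly_mapping_eqI) (simp add: lookup_lincomb in_keys_iff)

lemma sum_closed:
  "(\<And>x. x \<in> S \<Longrightarrow> f x \<in> carrier (free_alg M)) \<Longrightarrow> sum f S \<in> carrier (free_alg M)"
  by (induction S rule: infinite_finite_induct) (simp_all add: free_alg_closed)

lemma mono_word_Cons: "mono_word (a # w) = mono_word [a] * mono_word w"
  using mono_word_append[of "[a]" w] by simp

text \<open>Linearity is required on the whole type rather than on the carrier, which spares
  membership conditions when a functional is evaluated.\<close>

definition linear_fn :: "(ncpoly \<Rightarrow> complex) \<Rightarrow> bool" where
  "linear_fn f \<longleftrightarrow> (\<forall>p r. f (p + r) = f p + f r) \<and> (\<forall>c p. f (cnst c * p) = c * f p)"

lemma linear_fn_simps:
  assumes "linear_fn f"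
  shows "f (p + r) = f p + f r" "f (cnst c * p) = c * f p" "f 0 = 0" "f (- p) = - f p"
    "f (p - r) = f p - f r" "f (sum g S) = (\<Sum>x\<in>S. f (g x))"
proof -
  show add: "f (p + r) = f p + f r" for p r using assms by (simp add: linear_fn_def)
  show sc: "f (cnst c * p) = c * f p" for p c using assms by (simp add: linear_fn_def)
  show z: "f 0 = 0" using sc[of 0 0] by simp
  have neg: "f (- p) = - f p" for p
    using sc[of "-1" p] by (simp add: cnst_hom cnst_1)
  then show "f (- p) = - f p" .
  show "f (p - r) = f p - f r" using add[of p "- r"] neg by simp
  show "f (sum g S) = (\<Sum>x\<in>S. f (g x))"
    by (induction S rule: infinite_finite_induct) (simp_all add: z add)
qed

definition extend_linear :: "(nat list \<Rightarrow> complex) \<Rightarrow> ncpoly \<Rightarrow> complex" where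
  "extend_linear h p = (\<Sum>w\<in>Poly_Mapping.keys p. Poly_Mapping.lookup p w * h w)"

text \<open>Cancellation can make the keys of a sum a proper subset of the union of the keys, so
  additivity has to be checked over a common index set.\<close>

lemma extend_linear_superset:
  assumes "finite S" "Poly_Mapping.keys p \<subseteq> S"
  shows "extend_linear h p = (\<Sum>w\<in>S. Poly_Mapping.lookup p w * h w)"
  unfolding extend_linear_def using assms
  by (intro sum.mono_neutral_left) (auto simp: in_keys_iff)

lemma linear_fn_extend_linear: "linear_fn (extend_linear h)"
proof -
  have "extend_linear h (p + r) = extend_linear h p + extend_linear h r" for p r
  proof -
    let ?S = "Poly_Mapping.keys p \<union> Poly_Mapping.keys r"
    have "extend_linear h t = (\<Sum>w\<in>?S. Poly_Mapping.lookup t w * h w)"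
      if "Poly_Mapping.keys t \<subseteq> ?S" for t
      using that by (intro extend_linear_superset) auto
    then show ?thesis
      using Poly_Mapping.keys_add[of p r] by (simp add: lookup_add distrib_right sum.distrib)
  qed
  moreover have "extend_linear h (cnst c * p) = c * extend_linear h p" for c p
  proof -
    have "extend_linear h (cnst c * p)
        = (\<Sum>w\<in>Poly_Mapping.keys p. Poly_Mapping.lookup (cnst c * p) w * h w)"
      by (rule extend_linear_superset) (auto simp: in_keys_iff lookup_cnst_mult)
    then show ?thesis
      by (simp add: lookup_cnst_mult extend_linear_def sum_distrib_left mult.assoc)
  qed
  ultimately show ?thesis by (simp add: linear_fn_def)
qed

lemma extend_linear_mono_word: "extend_linear h (mono_word w) = h w"
  by (simp add: extend_linear_def mono_word_def)

section \<open>Two-sided ideals and the basis property in terms of representatives\<close>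

locale nc_ideal =
  fixes M :: nat and I :: "ncpoly set"
  assumes ideal: "ideal I (free_alg M)"
begin

lemma I_closed: "p \<in> I \<Longrightarrow> p \<in> carrier (free_alg M)"
  by (rule ideal.Icarr[OF ideal])

lemma I_0: "0 \<in> I"
  using additive_subgroup.zero_closed[OF ideal.axioms(1)[OF ideal]] by simp

lemma I_add: "p \<in> I \<Longrightarrow> r \<in> I \<Longrightarrow> p + r \<in> I"
  using additive_subgroup.a_closed[OF ideal.axioms(1)[OF ideal]] by simp

lemma I_lmult: "p \<in> I \<Longrightarrow> r \<in> carrier (free_alg M) \<Longrightarrow> r * p \<in> I"
  using ideal.I_l_closed[OF ideal] by simp

lemma I_rmult: "p \<in> I \<Longrightarrow> r \<in> carrier (free_alg M) \<Longrightarrow> p * r \<in> I"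
  using ideal.I_r_closed[OF ideal] by simp

lemma I_cnst: "p \<in> I \<Longrightarrow> cnst c * p \<in> I"
  by (intro I_lmult) (auto simp: free_alg_closed)

lemma I_uminus: "p \<in> I \<Longrightarrow> - p \<in> I"
  using I_cnst[of p "-1"] by (simp add: cnst_hom cnst_1)

lemma I_diff: "p \<in> I \<Longrightarrow> r \<in> I \<Longrightarrow> p - r \<in> I"
  using I_add[of p "- r"] I_uminus[of r] by simp

lemma I_sum: "(\<And>x. x \<in> S \<Longrightarrow> f x \<in> I) \<Longrightarrow> sum f S \<in> I"
  by (induction S rule: infinite_finite_induct) (auto simp: I_0 I_add)

lemma coset_eq_iff:
  assumes "p \<in> carrier (free_alg M)" "r \<in> carrier (free_alg M)"
  shows "I +>\<^bsub>free_alg M\<^esub> p = I +>\<^bsub>free_alg M\<^esub> r \<longleftrightarrow> p - r \<in> I"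
proof -
  have "r \<ominus>\<^bsub>free_alg M\<^esub> p = r - p" if "p \<in> carrier (free_alg M)" "r \<in> carrier (free_alg M)" for p r
  proof -
    interpret ring "free_alg M" by (rule ring_free_alg)
    have "\<ominus>\<^bsub>free_alg M\<^esub> p = - p"
      by (rule minus_equality) (use that in \<open>auto simp: free_alg_closed\<close>)
    then show ?thesis by (simp add: a_minus_def)
  qed
  then show ?thesis
    using ring.quotient_eq_iff_same_a_r_cos[OF ring_free_alg ideal, of p r] assms by auto
qed

lemma quot_zero: "\<zero>\<^bsub>free_alg M Quot I\<^esub> = I +>\<^bsub>free_alg M\<^esub> 0"
proof -
  interpret ring "free_alg M" by (rule ring_free_alg)
  have "I +>\<^bsub>free_alg M\<^esub> \<zero>\<^bsub>free_alg M\<^esub> = I"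
    by (rule a_coset_add_zero) (use I_closed in blast)
  then show ?thesis by (simp add: FactRing_def)
qed

text \<open>The class map is a ring homomorphism, so a combination formed in the quotient is the
  class of the one formed in the free algebra.\<close>

lemma quot_lincomb_eq:
  assumes "finite S" "S \<subseteq> normal_words M"
  shows "quot_lincomb M I S c = I +>\<^bsub>free_alg M\<^esub> (\<Sum>w\<in>S. cnst (c w) * mono_word w)"
proof -
  interpret Q: ring "free_alg M Quot I" by (rule ideal.quotient_is_ring[OF ideal])
  have hom: "(+>\<^bsub>free_alg M\<^esub>) I \<in> ring_hom (free_alg M) (free_alg M Quot I)"
    by (rule ideal.rcos_ring_hom[OF ideal])
  have car: "I +>\<^bsub>free_alg M\<^esub> p \<in> carrier (free_alg M Quot I)" if "p \<in> carrier (free_alg M)" for p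
    by (rule ring_hom_closed[OF hom that])
  have mw: "mono_word w \<in> carrier (free_alg M)" if "w \<in> normal_words M" for w
    using that by (auto simp: normal_words_def free_alg_closed)
  show ?thesis
    using assms
  proof (induction S rule: finite_induct)
    case empty
    then show ?case by (simp add: quot_lincomb_def quot_zero)
  next
    case (insert x S)
    have S: "\<And>w. w \<in> insert x S \<Longrightarrow> cnst (c w) \<in> carrier (free_alg M) \<and> mono_word w \<in> carrier (free_alg M)"
      using insert.prems mw by (auto simp: free_alg_closed)
    have c1: "cnst (c x) * mono_word x \<in> carrier (free_alg M)" using S by (simp add: free_alg_closed)
    have c2: "(\<Sum>w\<in>S. cnst (c w) * mono_word w) \<in> carrier (free_alg M)"
      using S by (intro sum_closed) (simp add: free_alg_closed)
    have "quot_lincomb M I (insert x S) c =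
       (I +>\<^bsub>free_alg M\<^esub> cnst (c x)) \<otimes>\<^bsub>free_alg M Quot I\<^esub> (I +>\<^bsub>free_alg M\<^esub> mono_word x)
        \<oplus>\<^bsub>free_alg M Quot I\<^esub> quot_lincomb M I S c"
      unfolding quot_lincomb_def
      by (rule Q.finsum_insert) (use insert S car in auto)
    also have "(I +>\<^bsub>free_alg M\<^esub> cnst (c x)) \<otimes>\<^bsub>free_alg M Quot I\<^esub> (I +>\<^bsub>free_alg M\<^esub> mono_word x)
        = I +>\<^bsub>free_alg M\<^esub> (cnst (c x) * mono_word x)"
      using ring_hom_mult[OF hom, of "cnst (c x)" "mono_word x"] S by simp
    also have "quot_lincomb M I S c = I +>\<^bsub>free_alg M\<^esub> (\<Sum>w\<in>S. cnst (c w) * mono_word w)"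
      using insert by simp
    finally show ?case
      using ring_hom_add[OF hom c1 c2] insert by simp
  qed
qed

text \<open>A polynomial \<open>r\<close> with normal keys encodes a pair of an index set and a
  coefficient function, namely its keys and its \<open>lookup\<close>. Equality of classes means
  that the difference lies in \<open>I\<close>, so both halves of the basis property become
  statements about such polynomials.\<close>

lemma normal_words_basis_iff:
  "normal_words_basis M I \<longleftrightarrow>
    (\<forall>p\<in>carrier (free_alg M). \<exists>r. Poly_Mapping.keys r \<subseteq> normal_words M \<and> p - r \<in> I) \<and>
    (\<forall>r\<in>I. Poly_Mapping.keys r \<subseteq> normal_words M \<longrightarrow> r = 0)"
proof -
  have nc: "r \<in> carrier (free_alg M)" if "Poly_Mapping.keys r \<subseteq> normal_words M" for r
    using that unfolding carrier_free_alg normal_words_def by blast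
  have sc: "(\<Sum>w\<in>S. cnst (c w) * mono_word w) \<in> carrier (free_alg M)" (is ?c)
    and sk: "Poly_Mapping.keys (\<Sum>w\<in>S. cnst (c w) * mono_word w) \<subseteq> normal_words M" (is ?k)
    and sl: "w \<in> S \<Longrightarrow> Poly_Mapping.lookup (\<Sum>w\<in>S. cnst (c w) * mono_word w) w = c w" (is "_ \<Longrightarrow> ?l w")
    if "finite S" "S \<subseteq> normal_words M" for S c w
  proof -
    have l: "Poly_Mapping.lookup (\<Sum>w\<in>S. cnst (c w) * mono_word w) v = (if v \<in> S then c v else 0)" for v
      using that(1) by (rule lookup_lincomb)
    then show ?k using that(2) by (auto simp: in_keys_iff split: if_splits)
    then show ?c by (rule nc)
    show "w \<in> S \<Longrightarrow> ?l w" using l by simp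
  qed
  have "(\<forall>q\<in>carrier (free_alg M Quot I). \<exists>S c. finite S \<and> S \<subseteq> normal_words M \<and> q = quot_lincomb M I S c)
     \<longleftrightarrow> (\<forall>p\<in>carrier (free_alg M). \<exists>r. Poly_Mapping.keys r \<subseteq> normal_words M \<and> p - r \<in> I)"
    (is "?A \<longleftrightarrow> ?B")
  proof
    assume A: ?A
    show ?B
    proof
      fix p assume p: "p \<in> carrier (free_alg M)"
      then have pc: "I +>\<^bsub>free_alg M\<^esub> p \<in> carrier (free_alg M Quot I)"
        by (rule ring_hom_closed[OF ideal.rcos_ring_hom[OF ideal]])
      from A[rule_format, OF pc] obtain S c
        where S: "finite S" "S \<subseteq> normal_words M" "I +>\<^bsub>free_alg M\<^esub> p = quot_lincomb M I S c"
        by (elim exE conjE)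
      have "p - (\<Sum>w\<in>S. cnst (c w) * mono_word w) \<in> I"
        using coset_eq_iff[OF p sc[OF S(1,2)]] S(3) quot_lincomb_eq[OF S(1,2)] by metis
      then show "\<exists>r. Poly_Mapping.keys r \<subseteq> normal_words M \<and> p - r \<in> I"
        using sk[OF S(1,2)] by (intro exI conjI)
    qed
  next
    assume B: ?B
    show ?A
    proof
      fix q assume "q \<in> carrier (free_alg M Quot I)"
      then obtain p where p: "p \<in> carrier (free_alg M)" "q = I +>\<^bsub>free_alg M\<^esub> p"
        by (auto simp: FactRing_def A_RCOSETS_def' )
      then obtain r where r: "Poly_Mapping.keys r \<subseteq> normal_words M" "p - r \<in> I" using B by blast
      have "q = I +>\<^bsub>free_alg M\<^esub> r" using p coset_eq_iff[OF p(1) nc[OF r(1)]] r by simp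
      then show "\<exists>S c. finite S \<and> S \<subseteq> normal_words M \<and> q = quot_lincomb M I S c"
        using r(1) by (intro exI[of _ "Poly_Mapping.keys r"] exI[of _ "Poly_Mapping.lookup r"])
          (simp add: quot_lincomb_eq ncpoly_expand[of r, symmetric])
    qed
  qed
  moreover have "(\<forall>S c. finite S \<longrightarrow> S \<subseteq> normal_words M \<longrightarrow>
        quot_lincomb M I S c = \<zero>\<^bsub>free_alg M Quot I\<^esub> \<longrightarrow> (\<forall>w\<in>S. c w = 0))
     \<longleftrightarrow> (\<forall>r\<in>I. Poly_Mapping.keys r \<subseteq> normal_words M \<longrightarrow> r = 0)" (is "?A \<longleftrightarrow> ?B")
  proof
    assume A: ?A
    show ?B
    proof (intro ballI impI)
      fix r assume r: "r \<in> I" "Poly_Mapping.keys r \<subseteq> normal_words M"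
      have "quot_lincomb M I (Poly_Mapping.keys r) (Poly_Mapping.lookup r) = I +>\<^bsub>free_alg M\<^esub> r"
        using r by (simp add: quot_lincomb_eq ncpoly_expand[of r, symmetric])
      also have "\<dots> = \<zero>\<^bsub>free_alg M Quot I\<^esub>"
        using coset_eq_iff[OF nc[OF r(2)], of 0] r by (simp add: quot_zero free_alg_closed)
      finally have "\<forall>w\<in>Poly_Mapping.keys r. Poly_Mapping.lookup r w = 0"
        using A r(2) finite_keys by blast
      then show "r = 0" by (intro poly_mapping_eqI) (auto simp: in_keys_iff)
    qed
  next
    assume B: ?B
    show ?A
    proof (intro allI impI)
      fix S c assume S: "finite S" "S \<subseteq> normal_words M" and z: "quot_lincomb M I S c = \<zero>\<^bsub>free_alg M Quot I\<^esub>"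
      have "(\<Sum>w\<in>S. cnst (c w) * mono_word w) \<in> I"
        using coset_eq_iff[OF sc[OF S], of 0 c] z by (simp add: quot_zero free_alg_closed quot_lincomb_eq S)
      then have "(\<Sum>w\<in>S. cnst (c w) * mono_word w) = 0" using B sk[OF S] by blast
      then show "\<forall>w\<in>S. c w = 0" using sl[OF S] by (metis lookup_zero)
    qed
  qed
  ultimately show ?thesis unfolding normal_words_basis_def by (simp only:)
qed

text \<open>The functional reads off the coefficient of \<open>w\<close> in a chosen normal form.
  Independence makes it well behaved: a normal polynomial in \<open>I\<close> is zero, so the
  functional kills \<open>I\<close>, and a normal word is its own normal form.\<close>

lemma dual_functional:
  assumes b: "normal_words_basis M I" and w: "w \<in> normal_words M"
  obtains f where "linear_fn f" "\<And>p. p \<in> I \<Longrightarrow> f p = 0"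
    "\<And>v. v \<in> normal_words M \<Longrightarrow> f (mono_word v) = (if v = w then 1 else 0)"
proof -
  note basis = b[unfolded normal_words_basis_iff]
  note ex = conjunct1[OF basis] and uniq = conjunct2[OF basis, rule_format]
  obtain nf where nf: "\<And>p. p \<in> carrier (free_alg M) \<Longrightarrow> Poly_Mapping.keys (nf p) \<subseteq> normal_words M"
     "\<And>p. p \<in> carrier (free_alg M) \<Longrightarrow> p - nf p \<in> I"
    using bchoice[OF ex] by auto
  define h where "h v = Poly_Mapping.lookup (nf (mono_word v)) w" for v
  have nw: "mono_word v \<in> carrier (free_alg M)" if "v \<in> normal_words M" for v
    using that by (auto simp: normal_words_def free_alg_closed)
  have "extend_linear h p = 0" if p: "p \<in> I" for p
  proof -
    \<comment> \<open>The choice \<open>nf\<close> is not known to be linear, so a normal form of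
      \<open>p\<close> is assembled from those of its words.\<close>
    let ?r = "\<Sum>v\<in>Poly_Mapping.keys p. cnst (Poly_Mapping.lookup p v) * nf (mono_word v)"
    have kp: "mono_word v \<in> carrier (free_alg M)" if "v \<in> Poly_Mapping.keys p" for v
      using I_closed[OF p] that by (intro free_alg_closed) (simp add: carrier_free_alg)
    have "(\<Sum>v\<in>Poly_Mapping.keys p. cnst (Poly_Mapping.lookup p v) * (mono_word v - nf (mono_word v))) \<in> I"
      using kp nf by (intro I_sum I_cnst) auto
    then have "p - ?r \<in> I"
      by (simp add: right_diff_distrib sum_subtractf ncpoly_expand[of p, symmetric])
    then have "?r \<in> I" using I_diff[OF p, of "p - ?r"] by simp
    moreover have "Poly_Mapping.keys ?r \<subseteq> normal_words M"
    proof
      fix v assume "v \<in> Poly_Mapping.keys ?r"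
      then have "(\<Sum>x\<in>Poly_Mapping.keys p. Poly_Mapping.lookup p x * Poly_Mapping.lookup (nf (mono_word x)) v) \<noteq> 0"
        by (simp add: in_keys_iff lookup_sum lookup_cnst_mult)
      then obtain x where "x \<in> Poly_Mapping.keys p" "Poly_Mapping.lookup (nf (mono_word x)) v \<noteq> 0"
        by (metis (no_types, lifting) mult_zero_right sum.neutral)
      then show "v \<in> normal_words M"
        using nf(1)[OF kp, of x] by (meson in_keys_iff subsetD)
    qed
    ultimately have "?r = 0" by (rule uniq)
    then have "Poly_Mapping.lookup ?r w = 0" by simp
    then show ?thesis by (simp add: extend_linear_def h_def lookup_sum lookup_cnst_mult)
  qed
  moreover have "extend_linear h (mono_word v) = (if v = w then 1 else 0)" if v: "v \<in> normal_words M" for v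
  proof -
    have "mono_word v - nf (mono_word v) = 0"
    proof (rule uniq)
      show "mono_word v - nf (mono_word v) \<in> I" using nf nw[OF v] by blast
      have "Poly_Mapping.keys (mono_word v) \<subseteq> normal_words M" using v by (simp add: mono_word_def)
      then show "Poly_Mapping.keys (mono_word v - nf (mono_word v)) \<subseteq> normal_words M"
        by (intro order_trans[OF keys_diff] Un_least nf(1) nw v)
    qed
    then have "nf (mono_word v) = mono_word v" by simp
    then show ?thesis by (simp add: extend_linear_mono_word h_def lookup_mono_word)
  qed
  ultimately show ?thesis by (rule that[OF linear_fn_extend_linear])
qed

end

section \<open>Relations with cyclic indices\<close>

definition ix :: "nat \<Rightarrow> int \<Rightarrow> nat" where
  "ix M n = nat ((n - 1) mod int M) + 1"

lemma gen_ix: "gen M n = mono_word [ix M n]"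
  by (simp add: gen_def ix_def)

lemma ix_eq_iff: "M > 0 \<Longrightarrow> ix M n = ix M m \<longleftrightarrow> int M dvd n - m"
  using mod_eq_dvd_iff[of "n - 1" "int M" "m - 1"]
  by (simp add: ix_def) (metis nat_eq_iff2 of_nat_0_less_iff pos_mod_sign)

lemma ix_range: "M > 0 \<Longrightarrow> 1 \<le> ix M n \<and> ix M n \<le> M"
  using pos_mod_bound[of "int M" "n - 1"] by (auto simp: ix_def nat_less_iff Suc_le_eq)

lemma ix_of_nat: "1 \<le> k \<Longrightarrow> k \<le> M \<Longrightarrow> ix M (int k) = k"
  by (simp add: ix_def of_nat_diff mod_pos_pos_trivial)

lemma dvd_ix: "M > 0 \<Longrightarrow> int M dvd int (ix M n) - n"
  using ix_eq_iff[of M "int (ix M n)" n] ix_of_nat[of "ix M n" M] ix_range[of M n] by simp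

lemma gen_eq: "M > 0 \<Longrightarrow> int M dvd n - m \<Longrightarrow> gen M n = gen M m"
  using ix_eq_iff[of M n m] by (simp add: gen_ix)

text \<open>Exactly one representative in \<open>{1..M}\<close> lies in the residue class of
  \<open>a\<close>, and \<open>f\<close> does not distinguish congruent indices.\<close>

lemma sum_residue:
  fixes f :: "int \<Rightarrow> 'a::comm_monoid_add"
  assumes M: "M > 0" and f: "\<And>r r'. int M dvd r - r' \<Longrightarrow> f r = f r'"
  shows "(\<Sum>r = 1..M. if int M dvd int r - a then f (int r) else 0) = f a"
proof -
  have "(\<Sum>r = 1..M. if int M dvd int r - a then f (int r) else 0)
     = (\<Sum>r = 1..M. if r = ix M a then f (int r) else 0)"
  proof (rule sum.cong)
    fix r assume "r \<in> {1..M}"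
    then have "int M dvd int r - a \<longleftrightarrow> r = ix M a"
      using ix_eq_iff[OF M, of "int r" a] by (simp add: ix_of_nat)
    then show "(if int M dvd int r - a then f (int r) else 0) = (if r = ix M a then f (int r) else 0)"
      by simp
  qed simp
  also have "\<dots> = f (int (ix M a))"
    using ix_range[OF M, of a] by simp
  also have "\<dots> = f a" by (rule f) (rule dvd_ix[OF M])
  finally show ?thesis .
qed

lemma int_dvd_small:
  "numeral k < int M \<Longrightarrow> \<not> int M dvd numeral k"
  "1 < int M \<Longrightarrow> \<not> int M dvd 1"
  by (auto dest: zdvd_imp_le)

locale comm_relations =
  fixes M :: nat
    and \<omega> :: "nat \<Rightarrow> nat \<Rightarrow> complex"
    and \<sigma> :: "nat \<Rightarrow> nat \<Rightarrow> nat \<Rightarrow> complex"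
    and \<eta> :: "nat \<Rightarrow> nat \<Rightarrow> complex"
  assumes M3: "M \<ge> 3"
    and \<omega>_nz: "\<And>i j. 1 \<le> i \<Longrightarrow> i < j \<Longrightarrow> j \<le> M \<Longrightarrow> \<omega> i j \<noteq> 0"
begin

definition I :: "ncpoly set" where
  "I = genideal (free_alg M) (comm_polys M \<omega> \<sigma> \<eta>)"

abbreviation u :: "int \<Rightarrow> ncpoly" where "u \<equiv> gen M"

abbreviation eqv :: "int \<Rightarrow> int \<Rightarrow> bool" (infix "\<approx>" 50) where "x \<approx> y \<equiv> int M dvd x - y"

text \<open>Coefficients of the relation that exchanges two distinct generators with cyclic indices;
  for representatives in descending order it is the given relation solved for the other product.\<close>

definition q :: "int \<Rightarrow> int \<Rightarrow> complex" where
  "q i j = (if ix M i < ix M j then \<omega> (ix M i) (ix M j) else inverse (\<omega> (ix M j) (ix M i)))"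

definition s :: "int \<Rightarrow> int \<Rightarrow> int \<Rightarrow> complex" where
  "s i j r = (if ix M i < ix M j then \<sigma> (ix M r) (ix M i) (ix M j)
     else - (inverse (\<omega> (ix M j) (ix M i)) * \<sigma> (ix M r) (ix M j) (ix M i)))"

definition e :: "int \<Rightarrow> int \<Rightarrow> complex" where
  "e i j = (if ix M i < ix M j then \<eta> (ix M i) (ix M j)
     else - (inverse (\<omega> (ix M j) (ix M i)) * \<eta> (ix M j) (ix M i)))"

definition lin :: "int \<Rightarrow> int \<Rightarrow> ncpoly" where
  "lin i j = (\<Sum>r = 1..M. cnst (s i j (int r)) * u (int r)) + cnst (e i j)"

definition F :: "int \<Rightarrow> int \<Rightarrow> ncpoly" where
  "F i j = u i * u j - cnst (q i j) * (u j * u i) - lin i j"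

lemma M0: "M > 0" using M3 by simp

lemmas eqv_ix = ix_eq_iff[OF M0, symmetric]

lemma eqv_sym: "x \<approx> y \<Longrightarrow> y \<approx> x"
  by (simp add: eqv_ix)

lemma periodic:
  assumes "i \<approx> i'" "j \<approx> j'" "r \<approx> r'"
  shows "q i j = q i' j'" "s i j r = s i' j' r'" "e i j = e i' j'" "lin i j = lin i' j'" "F i j = F i' j'"
    "u i = u i'"
  using assms by (simp_all add: eqv_ix q_def s_def e_def lin_def F_def gen_ix cong: if_cong)

lemma \<omega>_ix_nz: "ix M i < ix M j \<Longrightarrow> \<omega> (ix M i) (ix M j) \<noteq> 0"
  using \<omega>_nz[of "ix M i" "ix M j"] ix_range[OF M0] by blast

lemma neq_cases: "\<not> i \<approx> j \<Longrightarrow> ix M i < ix M j \<or> ix M j < ix M i"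
  using linorder_neq_iff[of "ix M i" "ix M j"] by (simp add: eqv_ix)

lemma q_nz: "\<not> i \<approx> j \<Longrightarrow> q i j \<noteq> 0"
  using neq_cases[of i j] \<omega>_ix_nz[of i j] \<omega>_ix_nz[of j i] by (auto simp: q_def)

lemma q_swap: "\<not> i \<approx> j \<Longrightarrow> q j i = inverse (q i j)"
  using neq_cases[of i j] by (auto simp: q_def)

lemma q_mult_swap: "\<not> i \<approx> j \<Longrightarrow> q j i * q i j = 1"
  using q_swap q_nz by simp

lemma s_swap: "\<not> i \<approx> j \<Longrightarrow> s j i r = - (q j i * s i j r)"
  using neq_cases[of i j] \<omega>_ix_nz[of i j] \<omega>_ix_nz[of j i] by (auto simp: q_def s_def)

lemma e_swap: "\<not> i \<approx> j \<Longrightarrow> e j i = - (q j i * e i j)"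
  using neq_cases[of i j] \<omega>_ix_nz[of i j] \<omega>_ix_nz[of j i] by (auto simp: q_def e_def)

lemma lin_swap: "\<not> i \<approx> j \<Longrightarrow> lin j i = - (cnst (q j i) * lin i j)"
  by (simp add: lin_def s_swap[of i j] e_swap[of i j] cnst_hom distrib_left sum_distrib_left
      cnst_merge sum_negf cnst_mult[symmetric])

text \<open>Solving a relation for the opposite product divides it by \<open>- q i j\<close>. Hence
  a membership proved for one order of the indices holds for the other.\<close>

lemma F_swap: "\<not> i \<approx> j \<Longrightarrow> F j i = - (cnst (q j i) * F i j)"
  using q_mult_swap[of i j] q_mult_swap[of j i]
  by (simp add: F_def lin_swap[of i j] right_diff_distrib cnst_merge cnst_1)

lemma comm_poly_eq:
  assumes "1 \<le> i" "i < j" "j \<le> M"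
  shows "comm_poly M \<omega> \<sigma> \<eta> i j = F (int i) (int j)"
proof -
  have "ix M (int i) = i" "ix M (int j) = j" using assms by (simp_all add: ix_of_nat)
  moreover have "(\<Sum>r = 1..M. cnst (\<sigma> (ix M (int r)) i j) * u (int r)) = (\<Sum>r = 1..M. cnst (\<sigma> r i j) * u (int r))"
    by (intro sum.cong) (simp_all add: ix_of_nat)
  ultimately show ?thesis
    using assms(2) by (simp add: comm_poly_def F_def lin_def q_def s_def e_def)
qed

lemma lin_closed: "lin i j \<in> carrier (free_alg M)"
  unfolding lin_def by (intro free_alg_closed sum_closed gen_closed M0)

lemma F_closed: "F i j \<in> carrier (free_alg M)"
  unfolding F_def by (intro free_alg_closed lin_closed gen_closed M0)

lemma comm_polys_closed: "comm_polys M \<omega> \<sigma> \<eta> \<subseteq> carrier (free_alg M)"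
  by (auto simp: comm_polys_def comm_poly_eq F_closed)

sublocale nc_ideal M I
  unfolding nc_ideal_def I_def
  by (rule ring.genideal_ideal[OF ring_free_alg comm_polys_closed])

lemma F_in_I:
  assumes "\<not> i \<approx> j"
  shows "F i j \<in> I"
proof -
  have up: "F i j \<in> I" if "ix M i < ix M j" for i j
  proof -
    have "F i j = F (int (ix M i)) (int (ix M j))"
      by (rule periodic(5)[OF eqv_sym[OF dvd_ix[OF M0]] eqv_sym[OF dvd_ix[OF M0]] dvd_ix[OF M0]])
    also have "\<dots> = comm_poly M \<omega> \<sigma> \<eta> (ix M i) (ix M j)"
      using comm_poly_eq that ix_range[OF M0] by simp
    also have "\<dots> \<in> comm_polys M \<omega> \<sigma> \<eta>"
      unfolding comm_polys_def using that ix_range[OF M0] by blast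
    finally show ?thesis
      unfolding I_def using ring.genideal_self[OF ring_free_alg comm_polys_closed] by blast
  qed
  show ?thesis
    using neq_cases[OF assms]
  proof
    assume "ix M j < ix M i"
    then have "F j i \<in> I" by (rule up)
    moreover have "\<not> j \<approx> i" using assms eqv_sym by blast
    ultimately show ?thesis using F_swap[of j i] by (simp add: I_uminus I_cnst)
  qed (rule up)
qed

text \<open>A presentation may list a pair of generators in either order, or with wrapped indices,
  as long as every pair occurs; \<open>F_swap\<close> supplies the missing order.\<close>

lemma genideal_eq_I:
  assumes sub: "\<And>g. g \<in> G \<Longrightarrow> \<exists>i j. \<not> i \<approx> j \<and> g = F i j"
    and sup: "\<And>i j. 1 \<le> i \<Longrightarrow> i < j \<Longrightarrow> j \<le> M \<Longrightarrow> F (int i) (int j) \<in> G \<or> F (int j) (int i) \<in> G"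
  shows "genideal (free_alg M) G = I"
proof
  have GI: "G \<subseteq> I" using sub F_in_I by fastforce
  then have G: "G \<subseteq> carrier (free_alg M)" using I_closed by (meson subset_eq)
  show "genideal (free_alg M) G \<subseteq> I"
    by (rule ring.genideal_minimal[OF ring_free_alg ideal GI])
  interpret G: nc_ideal M "genideal (free_alg M) G"
    by (rule nc_ideal.intro) (rule ring.genideal_ideal[OF ring_free_alg G])
  have "comm_polys M \<omega> \<sigma> \<eta> \<subseteq> genideal (free_alg M) G"
  proof
    fix p assume "p \<in> comm_polys M \<omega> \<sigma> \<eta>"
    then obtain i j where ij: "1 \<le> i" "i < j" "j \<le> M" and p: "p = F (int i) (int j)"
      by (auto simp: comm_polys_def comm_poly_eq)
    have "\<not> int j \<approx> int i"
      using ij by (simp add: eqv_ix ix_of_nat)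
    then have "F (int i) (int j) = - (cnst (q (int i) (int j)) * F (int j) (int i))" by (rule F_swap)
    moreover have "g \<in> genideal (free_alg M) G" if "g \<in> G" for g
      using ring.genideal_self[OF ring_free_alg G] that by (meson subset_eq)
    ultimately show "p \<in> genideal (free_alg M) G"
      using sup[OF ij] p by (metis G.I_cnst G.I_uminus)
  qed
  then show "I \<subseteq> genideal (free_alg M) G"
    unfolding I_def by (rule ring.genideal_minimal[OF ring_free_alg G.ideal])
qed

end

text \<open>This serves the converse direction, where the coefficients are given by cyclic formulas.
  The locale sees these only for \<open>1 \<le> i < j \<le> M\<close>; compatibility with exchanging
  the indices makes them agree with \<open>q\<close>, \<open>s\<close> and \<open>e\<close>
  everywhere off the diagonal.\<close>

lemma (in comm_relations) cyclic_coefficients: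
  assumes \<omega>: "\<And>i j. 1 \<le> i \<Longrightarrow> i < j \<Longrightarrow> j \<le> M \<Longrightarrow> \<omega> i j = qc (int i) (int j)"
    and \<sigma>: "\<And>i j r. 1 \<le> i \<Longrightarrow> i < j \<Longrightarrow> j \<le> M \<Longrightarrow> \<sigma> r i j = sc (int i) (int j) (int r)"
    and \<eta>: "\<And>i j. 1 \<le> i \<Longrightarrow> i < j \<Longrightarrow> j \<le> M \<Longrightarrow> \<eta> i j = ec (int i) (int j)"
    and per: "\<And>i i' j j' r r'. i \<approx> i' \<Longrightarrow> j \<approx> j' \<Longrightarrow> r \<approx> r' \<Longrightarrow>
        qc i j = qc i' j' \<and> sc i j r = sc i' j' r' \<and> ec i j = ec i' j'"
    and swap: "\<And>i j r. \<not> i \<approx> j \<Longrightarrow>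
        qc j i = inverse (qc i j) \<and> sc j i r = - (qc j i * sc i j r) \<and> ec j i = - (qc j i * ec i j)"
    and ij: "\<not> i \<approx> j"
  shows "q i j = qc i j" "s i j r = sc i j r" "e i j = ec i j"
proof -
  let ?i = "int (ix M i)" and ?j = "int (ix M j)" and ?r = "int (ix M r)"
  have p: "qc ?i ?j = qc i j \<and> sc ?i ?j ?r = sc i j r \<and> ec ?i ?j = ec i j"
    by (intro per dvd_ix M0)
  have p': "qc ?j ?i = qc j i \<and> sc ?j ?i ?r = sc j i r \<and> ec ?j ?i = ec j i"
    by (intro per dvd_ix M0)
  have ji: "\<not> j \<approx> i" using ij eqv_sym by blast
  note sw = swap[OF ji, of r]
  consider "ix M i < ix M j" | "ix M j < ix M i" using neq_cases[OF ij] by blast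
  then have "q i j = qc i j \<and> s i j r = sc i j r \<and> e i j = ec i j"
  proof cases
    case 1
    then show ?thesis using p ix_range[OF M0] by (simp add: q_def s_def e_def \<omega> \<sigma> \<eta>)
  next
    case 2
    then show ?thesis using p' sw ix_range[OF M0] by (simp add: q_def s_def e_def \<omega> \<sigma> \<eta>)
  qed
  then show "q i j = qc i j" "s i j r = sc i j r" "e i j = ec i j" by auto
qed

section \<open>The derivation and invariance of generated ideals\<close>

lemma volterra_derivationD:
  assumes "volterra_derivation M D"
  shows "a \<in> carrier (free_alg M) \<Longrightarrow> D a \<in> carrier (free_alg M)"
    "a \<in> carrier (free_alg M) \<Longrightarrow> b \<in> carrier (free_alg M) \<Longrightarrow> D (a + b) = D a + D b"
    "a \<in> carrier (free_alg M) \<Longrightarrow> D (cnst c * a) = cnst c * D a"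
    "a \<in> carrier (free_alg M) \<Longrightarrow> b \<in> carrier (free_alg M) \<Longrightarrow> D (a * b) = D a * b + a * D b"
    "D (gen M n) = gen M (n + 1) * gen M n - gen M n * gen M (n - 1)"
  using assms by (auto simp: volterra_derivation_def derivation_def)

locale derivation_relations = comm_relations +
  fixes D :: "ncpoly \<Rightarrow> ncpoly"
  assumes D: "volterra_derivation M D"
begin

lemmas D_rules = volterra_derivationD[OF D]

lemma D_uminus: "a \<in> carrier (free_alg M) \<Longrightarrow> D (- a) = - D a"
  using D_rules(3)[of a "-1"] by (simp add: cnst_hom cnst_1)

lemma D_diff:
  "a \<in> carrier (free_alg M) \<Longrightarrow> b \<in> carrier (free_alg M) \<Longrightarrow> D (a - b) = D a - D b"
  using D_rules(2)[of a "- b"] by (simp add: D_uminus free_alg_closed)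

lemma D_cnst: "D (cnst c) = 0"
proof -
  have "D 1 = 0" using D_rules(4)[of 1 1] by (simp add: free_alg_closed)
  then show ?thesis using D_rules(3)[of 1 c] by (simp add: free_alg_closed)
qed

lemma D_0: "D 0 = 0"
  using D_cnst[of 0] by (simp add: cnst_hom)

lemma D_sum: "(\<And>x. x \<in> S \<Longrightarrow> f x \<in> carrier (free_alg M)) \<Longrightarrow> D (sum f S) = (\<Sum>x\<in>S. D (f x))"
  by (induction S rule: infinite_finite_induct) (auto simp: D_0 D_rules(2) sum_closed)

lemma D_lin:
  "D (lin i j) = (\<Sum>r = 1..M. cnst (s i j (int r)) * (u (int r + 1) * u (int r) - u (int r) * u (int r - 1)))"
  unfolding lin_def
  by (simp add: D_rules(2,3,5) D_sum D_cnst free_alg_closed gen_closed M0 sum_closed)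

lemma D_F:
  "D (F i j) = (u (i + 1) * u i - u i * u (i - 1)) * u j + u i * (u (j + 1) * u j - u j * u (j - 1))
     - cnst (q i j) * ((u (j + 1) * u j - u j * u (j - 1)) * u i + u j * (u (i + 1) * u i - u i * u (i - 1)))
     - D (lin i j)"
  unfolding F_def
  by (simp add: D_diff D_rules(3,4,5) D_cnst free_alg_closed gen_closed M0 lin_closed)

text \<open>By the Leibniz rule the elements of the ideal whose derivative stays in the ideal form
  an ideal themselves. It contains the generators, hence everything.\<close>

lemma genideal_invariant:
  assumes G: "G \<subseteq> carrier (free_alg M)"
    and D_G: "\<And>g. g \<in> G \<Longrightarrow> D g \<in> genideal (free_alg M) G"
  shows "D ` genideal (free_alg M) G \<subseteq> genideal (free_alg M) G"
proof -
  let ?J = "genideal (free_alg M) G"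
  interpret J: nc_ideal M ?J
    by (rule nc_ideal.intro) (rule ring.genideal_ideal[OF ring_free_alg G])
  have GJ: "G \<subseteq> ?J" by (rule ring.genideal_self[OF ring_free_alg G])
  have "ideal {p \<in> ?J. D p \<in> ?J} (free_alg M)"
  proof (rule idealI[OF ring_free_alg])
    show "subgroup {p \<in> ?J. D p \<in> ?J} (add_monoid (free_alg M))"
    proof (rule group.subgroupI)
      show "Group.group (add_monoid (free_alg M))"
        using abelian_group.a_group[OF ring.is_abelian_group[OF ring_free_alg]] .
    next
      show "{p \<in> ?J. D p \<in> ?J} \<subseteq> carrier (add_monoid (free_alg M))" using J.I_closed by auto
    next
      show "{p \<in> ?J. D p \<in> ?J} \<noteq> {}" using J.I_0 D_0 by auto
    next
      fix a assume a: "a \<in> {p \<in> ?J. D p \<in> ?J}"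
      have "inv\<^bsub>add_monoid (free_alg M)\<^esub> a = - a"
      proof -
        interpret R: ring "free_alg M" by (rule ring_free_alg)
        have "\<ominus>\<^bsub>free_alg M\<^esub> a = - a"
          by (rule R.minus_equality) (use a J.I_closed[of a] in \<open>auto simp: free_alg_closed\<close>)
        then show ?thesis by (simp add: a_inv_def)
      qed
      then show "inv\<^bsub>add_monoid (free_alg M)\<^esub> a \<in> {p \<in> ?J. D p \<in> ?J}"
        using a J.I_closed[of a] by (simp add: J.I_uminus D_uminus)
    next
      fix a b assume "a \<in> {p \<in> ?J. D p \<in> ?J}" "b \<in> {p \<in> ?J. D p \<in> ?J}"
      then show "a \<otimes>\<^bsub>add_monoid (free_alg M)\<^esub> b \<in> {p \<in> ?J. D p \<in> ?J}"
        using J.I_closed[of a] J.I_closed[of b] by (simp add: J.I_add D_rules(2))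
    qed
  next
    fix a x assume "a \<in> {p \<in> ?J. D p \<in> ?J}" "x \<in> carrier (free_alg M)"
    then show "x \<otimes>\<^bsub>free_alg M\<^esub> a \<in> {p \<in> ?J. D p \<in> ?J}" "a \<otimes>\<^bsub>free_alg M\<^esub> x \<in> {p \<in> ?J. D p \<in> ?J}"
      using J.I_closed[of a] by (simp_all add: J.I_add J.I_lmult J.I_rmult D_rules)
  qed
  moreover have "G \<subseteq> {p \<in> ?J. D p \<in> ?J}" using GJ D_G by (auto simp: subset_eq)
  ultimately have "?J \<subseteq> {p \<in> ?J. D p \<in> ?J}" by (rule ring.genideal_minimal[OF ring_free_alg])
  then show ?thesis by auto
qed

lemma genideal_self_invariant:
  assumes "\<And>g. g \<in> comm_polys M \<omega> \<sigma> \<eta> \<Longrightarrow> D g \<in> I"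
  shows "D ` I \<subseteq> I"
  using genideal_invariant[OF comm_polys_closed] assms unfolding I_def by blast

end

section \<open>The derivation of a relation\<close>

lemma gen_cnst:
  "gen M n * (cnst c * p) = cnst c * (gen M n * p)"
  "gen M n * cnst c = cnst c * gen M n"
  by (rule mult_cnst) (rule cnst_comm[symmetric])

lemmas nc_simps = distrib_left distrib_right left_diff_distrib right_diff_distrib mult.assoc gen_cnst

context comm_relations
begin

lemma lin_two_terms:
  assumes "\<And>r. s i j r = (if r \<approx> x then c else 0) + (if r \<approx> y then d else 0)"
  shows "lin i j = cnst c * u x + cnst d * u y + cnst (e i j)"
proof -
  have "(\<Sum>r = 1..M. cnst (s i j (int r)) * u (int r))
     = (\<Sum>r = 1..M. if int r \<approx> x then cnst c * u (int r) else 0)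
       + (\<Sum>r = 1..M. if int r \<approx> y then cnst d * u (int r) else 0)"
    unfolding sum.distrib[symmetric] by (intro sum.cong) (simp_all add: assms cnst_hom distrib_right)
  also have "\<dots> = cnst c * u x + cnst d * u y"
    by (intro arg_cong2[where f = "(+)"] sum_residue M0) (simp_all add: gen_eq[OF M0])
  finally show ?thesis by (simp add: lin_def)
qed

text \<open>Cyclic distance at least three. Moving one index by one step then still leaves a
  nonadjacent pair, as \<open>D_F_distant\<close> requires.\<close>

definition far :: "int \<Rightarrow> int \<Rightarrow> bool" where
  "far i j \<longleftrightarrow> \<not> i \<approx> j \<and> \<not> i + 1 \<approx> j \<and> \<not> i - 1 \<approx> j \<and> \<not> i + 2 \<approx> j \<and> \<not> i - 2 \<approx> j"

lemma eqv_minus: "x - y = z - t \<or> x - y = t - z \<Longrightarrow> x \<approx> y \<longleftrightarrow> z \<approx> t"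
  by (metis dvd_diff_commute)

lemma far_sym:
  assumes "far i j"
  shows "far j i"
proof -
  have "j \<approx> i \<longleftrightarrow> i \<approx> j" "j + 1 \<approx> i \<longleftrightarrow> i - 1 \<approx> j" "j - 1 \<approx> i \<longleftrightarrow> i + 1 \<approx> j"
    "j + 2 \<approx> i \<longleftrightarrow> i - 2 \<approx> j" "j - 2 \<approx> i \<longleftrightarrow> i + 2 \<approx> j"
    by (rule eqv_minus; simp)+
  then show ?thesis using assms by (simp only: far_def simp_thms)
qed

lemma far_neq:
  assumes "far i j"
  shows "\<not> i \<approx> j" "\<not> j \<approx> i" "\<not> i + 1 \<approx> j" "\<not> j \<approx> i + 1" "\<not> i \<approx> j + 1" "\<not> j + 1 \<approx> i"
    "\<not> i + 1 \<approx> j + 1 + 1" "\<not> i - 1 \<approx> j" "\<not> j \<approx> i - 1"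
    "\<not> j - 1 \<approx> i + 1" "\<not> j + 1 \<approx> i + 1" "\<not> j + 1 \<approx> i - 1" "\<not> j - 1 \<approx> i - 1"
    "\<not> i - 1 \<approx> j + 1" "\<not> i + 1 \<approx> j + 1" "\<not> j - 1 \<approx> i" "\<not> i \<approx> j - 1" "\<not> i - 1 \<approx> j - 1"
    "\<not> i + 1 \<approx> j - 1"
  using assms far_sym[OF assms] unfolding far_def by (simp_all add: algebra_simps)

lemma F_mult_in_I: "\<not> i \<approx> j \<Longrightarrow> u x * F i j \<in> I" "\<not> i \<approx> j \<Longrightarrow> F i j * u x \<in> I"
  by (simp_all add: I_lmult I_rmult F_in_I gen_closed M0)

end

context derivation_relations
begin

text \<open>The first bracket consists of multiples of relations and the second has degree at most
  two; the hypotheses on \<open>q\<close> are what makes the cubic words cancel. The identities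
  below have the same structure.\<close>

lemma D_F_adjacent:
  assumes "q (i - 1) (i + 1) = 1" "q i (i + 2) = 1"
  shows "D (F i (i + 1)) =
      (u (i + 1) * F i (i + 1) - F i (i + 1) * u i - u i * F (i - 1) (i + 1) - F i (i + 1) * u (i - 1)
        + F i (i + 2) * u (i + 1) + u (i + 2) * F i (i + 1))
    + (u (i + 1) * lin i (i + 1) - lin i (i + 1) * u i - u i * lin (i - 1) (i + 1)
        - lin i (i + 1) * u (i - 1) + lin i (i + 2) * u (i + 1) + u (i + 2) * lin i (i + 1)
        - D (lin i (i + 1)))"
  unfolding D_F by (simp add: F_def assms cnst_1 nc_simps add.commute[of _ i])

lemma D_F_distance_two:
  assumes "q i (i + 2) = 1" "q (i - 1) (i + 2) = 1" "q i (i + 3) = 1" "q (i + 1) (i + 2) = q i (i + 1)"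
  shows "D (F i (i + 2)) =
      (u (i + 1) * F i (i + 2) - F i (i + 2) * u (i + 1) + F (i + 1) (i + 2) * u i - u (i + 2) * F i (i + 1)
        - u i * F (i - 1) (i + 2) - F i (i + 2) * u (i - 1) + F i (i + 3) * u (i + 2) + u (i + 3) * F i (i + 2))
    + (u (i + 1) * lin i (i + 2) - lin i (i + 2) * u (i + 1) + lin (i + 1) (i + 2) * u i
        - u (i + 2) * lin i (i + 1) - u i * lin (i - 1) (i + 2) - lin i (i + 2) * u (i - 1)
        + lin i (i + 3) * u (i + 2) + u (i + 3) * lin i (i + 2) - D (lin i (i + 2)))"
  unfolding D_F by (simp add: F_def assms cnst_1 nc_simps add.commute[of _ i])

lemma D_F_distant:
  assumes "q i j = 1" "q (i + 1) j = 1" "q (i - 1) j = 1" "q i (j + 1) = 1" "q i (j - 1) = 1"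
  shows "D (F i j) =
      (u (i + 1) * F i j + F (i + 1) j * u i - u i * F (i - 1) j - F i j * u (i - 1)
        + F i (j + 1) * u j + u (j + 1) * F i j - F i j * u (j - 1) - u j * F i (j - 1))
    + (u (i + 1) * lin i j + lin (i + 1) j * u i - u i * lin (i - 1) j - lin i j * u (i - 1)
        + lin i (j + 1) * u j + u (j + 1) * lin i j - lin i j * u (j - 1) - u j * lin i (j - 1)
        - D (lin i j))"
  unfolding D_F by (simp add: F_def assms cnst_1 nc_simps add.commute[of _ i])

text \<open>The outer neighbours of an adjacent pair coincide here, so
  \<open>u i * u (i - 1) * u (i + 1)\<close> cancels against
  \<open>u i * u (i + 2) * u (i + 1)\<close> and no relation at distance two enters.\<close>

lemma D_F_three:
  assumes "M = 3" "q (i + 1) (i + 2) = q i (i + 1)" "q (i + 2) i = q i (i + 1)"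
  shows "D (F i (i + 1)) =
      (u (i + 1) * F i (i + 1) - F i (i + 1) * u i + F (i + 1) (i + 2) * u i - u (i + 1) * F (i + 2) i)
    + (u (i + 1) * lin i (i + 1) - lin i (i + 1) * u i + lin (i + 1) (i + 2) * u i
        - u (i + 1) * lin (i + 2) i - D (lin i (i + 1)))"
proof -
  have "u (i - 1) = u (i + 2)" by (rule gen_eq[OF M0]) (simp add: assms(1))
  then show ?thesis
    unfolding D_F by (simp add: F_def assms(2,3) cnst_1 nc_simps add.commute[of _ i])
qed

lemma D_F_distance_two_four:
  assumes "M = 4" "q i (i + 2) = 1" "q (i + 1) (i + 2) = q i (i + 1)" "q (i + 2) (i + 3) = q (i + 3) i"
  shows "D (F i (i + 2)) =
      (u (i + 1) * F i (i + 2) - F i (i + 2) * u (i + 1) + F (i + 1) (i + 2) * u i - u (i + 2) * F i (i + 1)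
        + u (i + 3) * F i (i + 2) - F (i + 3) i * u (i + 2) + u i * F (i + 2) (i + 3) - F i (i + 2) * u (i + 3))
    + (u (i + 1) * lin i (i + 2) - lin i (i + 2) * u (i + 1) + lin (i + 1) (i + 2) * u i
        - u (i + 2) * lin i (i + 1) + u (i + 3) * lin i (i + 2) - lin (i + 3) i * u (i + 2)
        + u i * lin (i + 2) (i + 3) - lin i (i + 2) * u (i + 3) - D (lin i (i + 2)))"
proof -
  have "u (i - 1) = u (i + 3)" by (rule gen_eq[OF M0]) (simp add: assms(1))
  then show ?thesis
    unfolding D_F by (simp add: F_def assms(2-4) cnst_1 nc_simps add.commute[of _ i])
qed

end

section \<open>Functionals dual to normal words of length one, two and three\<close>

locale volterra_quantisation = derivation_relations +
  assumes basis: "normal_words_basis M I" and invariant: "D ` I \<subseteq> I"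
begin

lemma D_F_in_I: "\<not> i \<approx> j \<Longrightarrow> D (F i j) \<in> I"
  using invariant F_in_I by blast

lemma normal_wordsI:
  "[] \<in> normal_words M" "[ix M x] \<in> normal_words M"
  "ix M y \<le> ix M x \<Longrightarrow> [ix M x, ix M y] \<in> normal_words M"
  "ix M y \<le> ix M x \<Longrightarrow> ix M z \<le> ix M y \<Longrightarrow> [ix M x, ix M y, ix M z] \<in> normal_words M"
  using ix_range[OF M0] by (auto simp: normal_words_def)

lemma mono_word_gens:
  "mono_word [ix M x] = u x" "mono_word [ix M x, ix M y] = u x * u y"
  "mono_word [ix M x, ix M y, ix M z] = u x * (u y * u z)"
  by (simp_all add: gen_ix mono_word_Cons[of _ "[_]"] mono_word_Cons[of _ "[_, _]"])

lemma functional_swap: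
  assumes f: "linear_fn f" "\<And>p. p \<in> I \<Longrightarrow> f p = 0" and ij: "\<not> i \<approx> j"
    and p: "p \<in> carrier (free_alg M)"
  shows "f (u i * u j) = q i j * f (u j * u i) + f (lin i j)"
    "f (u i * (u j * p)) = q i j * f (u j * (u i * p)) + f (lin i j * p)"
    "f (u k * (u i * u j)) = q i j * f (u k * (u j * u i)) + f (u k * lin i j)"
proof -
  note lf = linear_fn_simps[OF f(1)]
  have "f (F i j) = 0" using f(2) F_in_I[OF ij] by simp
  then show "f (u i * u j) = q i j * f (u j * u i) + f (lin i j)"
    by (simp add: F_def lf diff_eq_eq)
  have "f (F i j * p) = 0" using f(2) I_rmult F_in_I[OF ij] p by simp
  then show "f (u i * (u j * p)) = q i j * f (u j * (u i * p)) + f (lin i j * p)"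
    by (simp add: F_def lf nc_simps diff_eq_eq)
  have "f (u k * F i j) = 0" using f(2) I_lmult F_in_I[OF ij] gen_closed[OF M0] by simp
  then show "f (u k * (u i * u j)) = q i j * f (u k * (u j * u i)) + f (u k * lin i j)"
    by (simp add: F_def lf nc_simps diff_eq_eq)
qed

lemma functional_lin:
  assumes f: "linear_fn f"
  shows "f (lin i j) = (\<Sum>r = 1..M. s i j (int r) * f (u (int r))) + e i j * f 1"
    "f (u x * lin i j) = (\<Sum>r = 1..M. s i j (int r) * f (u x * u (int r))) + e i j * f (u x)"
    "f (lin i j * u x) = (\<Sum>r = 1..M. s i j (int r) * f (u (int r) * u x)) + e i j * f (u x)"
    "f (D (lin i j)) =
       (\<Sum>r = 1..M. s i j (int r) * (f (u (int r + 1) * u (int r)) - f (u (int r) * u (int r - 1))))"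
proof -
  note lf = linear_fn_simps[OF f]
  have "f (cnst (e i j)) = e i j * f 1" using lf(2)[of "e i j" 1] by simp
  then show "f (lin i j) = (\<Sum>r = 1..M. s i j (int r) * f (u (int r))) + e i j * f 1"
    by (simp add: lin_def lf)
  show "f (u x * lin i j) = (\<Sum>r = 1..M. s i j (int r) * f (u x * u (int r))) + e i j * f (u x)"
    by (simp add: lin_def lf distrib_left sum_distrib_left gen_cnst)
  show "f (lin i j * u x) = (\<Sum>r = 1..M. s i j (int r) * f (u (int r) * u x)) + e i j * f (u x)"
    by (simp add: lin_def lf distrib_right sum_distrib_right mult.assoc)
  show "f (D (lin i j)) =
       (\<Sum>r = 1..M. s i j (int r) * (f (u (int r + 1) * u (int r)) - f (u (int r) * u (int r - 1))))"
    by (simp add: D_lin lf)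
qed

lemma linear_functional:
  obtains f where "linear_fn f" "\<And>p. p \<in> I \<Longrightarrow> f p = 0" "f 1 = 0"
    "\<And>x. f (u x) = (if x \<approx> a then 1 else 0)"
proof -
  obtain f where f: "linear_fn f" "\<And>p. p \<in> I \<Longrightarrow> f p = 0"
    "\<And>v. v \<in> normal_words M \<Longrightarrow> f (mono_word v) = (if v = [ix M a] then 1 else 0)"
    using dual_functional[OF basis normal_wordsI(2)[of a]] by blast
  show thesis
  proof (rule that[OF f(1,2)])
    show "f 1 = 0" using f(3)[OF normal_wordsI(1)] by (simp add: mono_word_Nil)
    show "f (u x) = (if x \<approx> a then 1 else 0)" for x
      using f(3)[OF normal_wordsI(2)[of x]] by (simp add: mono_word_gens eqv_ix)
  qed
qed

text \<open>Exchanging two letters costs only a factor \<open>q\<close>, since the inhomogeneous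
  parts have degree at most one and are killed. The formula makes no reference to which
  representative is larger, so it can be used with cyclic indices.\<close>

lemma quadratic_functional:
  obtains f where "linear_fn f" "\<And>p. p \<in> I \<Longrightarrow> f p = 0" "\<And>x. f (u x) = 0"
    "\<And>x y. f (u x * u y) =
       (if x \<approx> b \<and> y \<approx> a then 1 else if x \<approx> a \<and> y \<approx> b then q a b else 0)"
proof -
  define w where "w = (if ix M a \<le> ix M b then [ix M b, ix M a] else [ix M a, ix M b])"
  have w: "w \<in> normal_words M" by (simp add: w_def normal_wordsI)
  obtain f where f: "linear_fn f" "\<And>p. p \<in> I \<Longrightarrow> f p = 0"
    "\<And>v. v \<in> normal_words M \<Longrightarrow> f (mono_word v) = (if v = w then 1 else 0)"
    using dual_functional[OF basis w] by blast
  note lf = linear_fn_simps[OF f(1)]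
  have f1: "f (u x) = 0" for x
    using f(3)[OF normal_wordsI(2)[of x]] by (simp add: mono_word_gens w_def)
  have f0: "f 1 = 0"
    using f(3)[OF normal_wordsI(1)] by (simp add: mono_word_Nil w_def)
  have flin: "f (lin i j) = 0" for i j
    by (simp add: functional_lin[OF f(1)] f0 f1)
  have down: "f (u x * u y) = (if w = [ix M x, ix M y] then 1 else 0)" if "ix M y \<le> ix M x" for x y
    using f(3)[OF normal_wordsI(3)[OF that]] by (auto simp: mono_word_gens)
  have swap: "f (u x * u y) = q x y * f (u y * u x)" if "\<not> x \<approx> y" for x y
    using functional_swap(1)[OF f(1,2) that free_alg_closed(1)] flin by simp
  have nz: "f (u b * u a) \<noteq> 0"
  proof (cases "ix M a \<le> ix M b")
    case True
    then show ?thesis by (simp add: down w_def)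
  next
    case False
    then have "\<not> b \<approx> a" by (auto simp: eqv_ix)
    then show ?thesis using swap[of b a] q_nz down[of b a] False by (simp add: w_def)
  qed
  have z: "f (u x * u y) = 0" if "\<not> (x \<approx> b \<and> y \<approx> a)" "\<not> (x \<approx> a \<and> y \<approx> b)" for x y
  proof -
    have ne: "w \<noteq> [ix M x, ix M y]" "w \<noteq> [ix M y, ix M x]" using that by (auto simp: w_def eqv_ix)
    show ?thesis
    proof (cases "ix M y \<le> ix M x")
      case True
      then show ?thesis using ne by (simp add: down)
    next
      case False
      then have "\<not> x \<approx> y" by (auto simp: eqv_ix)
      then show ?thesis using swap[of x y] down[of x y] ne False by simp
    qed
  qed
  \<comment> \<open>Rescaling gives the value 1 on \<open>u b * u a\<close> also when this product
    is not in normal order; otherwise the factor is 1 already.\<close>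
  define g where "g p = f p / f (u b * u a)" for p
  show thesis
  proof
    show "linear_fn g" using lf by (simp add: linear_fn_def g_def add_divide_distrib)
    show "g p = 0" if "p \<in> I" for p using f(2)[OF that] by (simp add: g_def)
    show "g (u x) = 0" for x by (simp add: g_def f1)
    show "g (u x * u y) = (if x \<approx> b \<and> y \<approx> a then 1 else if x \<approx> a \<and> y \<approx> b then q a b else 0)" for x y
    proof -
      have "g (u x * u y) = 1" if "x \<approx> b" "y \<approx> a"
        using nz gen_eq[OF M0 that(1)] gen_eq[OF M0 that(2)] by (simp add: g_def)
      moreover have "g (u x * u y) = q a b" if "x \<approx> a" "y \<approx> b" "\<not> (x \<approx> b \<and> y \<approx> a)"
      proof -
        have "\<not> a \<approx> b" using that by (auto simp: eqv_ix)
        then show ?thesis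
          using nz swap[of a b] gen_eq[OF M0 that(1)] gen_eq[OF M0 that(2)] by (simp add: g_def)
      qed
      ultimately show ?thesis using z[of x y] by (auto simp: g_def)
    qed
  qed
qed

text \<open>All terms of degree at most two are killed, so exchanging adjacent letters multiplies
  the value by a nonzero factor. Whether it vanishes therefore depends only on the multiset of
  letters; actual values are compared later through \<open>functional_swap\<close>.\<close>

lemma cubic_functional:
  obtains f where "linear_fn f" "\<And>p. p \<in> I \<Longrightarrow> f p = 0"
    "\<And>i j x. f (lin i j * u x) = 0" "\<And>i j x. f (u x * lin i j) = 0" "\<And>i j. f (D (lin i j)) = 0"
    "\<And>x y z. f (u x * (u y * u z)) \<noteq> 0 \<longleftrightarrow> {#ix M x, ix M y, ix M z#} = {#ix M a, ix M b, ix M c#}"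
proof -
  define w where "w = rev (sort [ix M a, ix M b, ix M c])"
  have mw: "mset w = {#ix M a, ix M b, ix M c#}" by (simp add: w_def)
  have lw: "length w = 3" by (simp add: w_def)
  have "sorted_wrt (\<ge>) w" unfolding w_def sorted_wrt_rev by simp
  moreover have "set w = {ix M a, ix M b, ix M c}" by (simp only: w_def set_rev set_sort) simp
  ultimately have w: "w \<in> normal_words M"
    using ix_range[OF M0] by (auto simp: normal_words_def)
  obtain f where f: "linear_fn f" "\<And>p. p \<in> I \<Longrightarrow> f p = 0"
    "\<And>v. v \<in> normal_words M \<Longrightarrow> f (mono_word v) = (if v = w then 1 else 0)"
    using dual_functional[OF basis w] by blast
  have f0: "f 1 = 0"
    using f(3)[OF normal_wordsI(1)] lw by (auto simp: mono_word_Nil)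
  have f1: "f (u x) = 0" for x
    using f(3)[OF normal_wordsI(2)[of x]] lw by (auto simp: mono_word_gens)
  have down: "f (u x * u y) = 0" if "ix M y \<le> ix M x" for x y
    using f(3)[OF normal_wordsI(3)[OF that]] lw by (auto simp: mono_word_gens)
  have f2: "f (u x * u y) = 0" for x y
  proof (cases "ix M y \<le> ix M x")
    case False
    then have "\<not> x \<approx> y" by (auto simp: eqv_ix)
    then show ?thesis
      using functional_swap(1)[OF f(1,2) _ free_alg_closed(1)] down[of x y] False
      by (simp add: functional_lin[OF f(1)] f0 f1)
  qed (rule down)
  have fl: "f (lin i j * u x) = 0" "f (u x * lin i j) = 0" "f (D (lin i j)) = 0" for i j x
    by (simp_all add: functional_lin[OF f(1)] f1 f2)
  \<comment> \<open>\<open>P\<close> holds for descending triples and survives both adjacent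
    transpositions, and these sort any three letters.\<close>
  define P where "P x y z \<longleftrightarrow> (f (u x * (u y * u z)) \<noteq> 0 \<longleftrightarrow>
      {#ix M x, ix M y, ix M z#} = {#ix M a, ix M b, ix M c#})" for x y z
  have sorted: "P x y z" if "ix M y \<le> ix M x" "ix M z \<le> ix M y" for x y z
  proof -
    have "[ix M x, ix M y, ix M z] = w \<longleftrightarrow> {#ix M x, ix M y, ix M z#} = {#ix M a, ix M b, ix M c#}"
    proof
      assume eq: "{#ix M x, ix M y, ix M z#} = {#ix M a, ix M b, ix M c#}"
      have "sort [ix M a, ix M b, ix M c] = rev [ix M x, ix M y, ix M z]"
        by (rule properties_for_sort) (use that eq in \<open>simp_all add: add_mset_commute\<close>)
      then show "[ix M x, ix M y, ix M z] = w" by (simp add: w_def)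
    next
      assume "[ix M x, ix M y, ix M z] = w"
      then have "mset [ix M x, ix M y, ix M z] = mset w" by simp
      then show "{#ix M x, ix M y, ix M z#} = {#ix M a, ix M b, ix M c#}" by (simp add: mw)
    qed
    then show ?thesis
      using f(3)[OF normal_wordsI(4)[OF that]] by (simp add: mono_word_gens P_def)
  qed
  have swap1: "P y x z \<Longrightarrow> P x y z" for x y z
  proof (cases "x \<approx> y")
    case True
    then show "P y x z \<Longrightarrow> P x y z" by (simp add: P_def eqv_ix gen_ix)
  next
    case False
    have "{#ix M y, ix M x, ix M z#} = {#ix M x, ix M y, ix M z#}" by (simp add: add_mset_commute)
    moreover have "f (u x * (u y * u z)) = q x y * f (u y * (u x * u z))"
      using functional_swap(2)[OF f(1,2) False gen_closed[OF M0, of z]] fl by simp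
    ultimately show "P y x z \<Longrightarrow> P x y z" using q_nz[OF False] by (simp add: P_def)
  qed
  have swap2: "P x z y \<Longrightarrow> P x y z" for x y z
  proof (cases "y \<approx> z")
    case True
    then show "P x z y \<Longrightarrow> P x y z" by (simp add: P_def eqv_ix gen_ix)
  next
    case False
    have "{#ix M x, ix M z, ix M y#} = {#ix M x, ix M y, ix M z#}" by (simp add: add_mset_commute)
    moreover have "f (u x * (u y * u z)) = q y z * f (u x * (u z * u y))"
      using functional_swap(3)[OF f(1,2) False free_alg_closed(1)] fl by simp
    ultimately show "P x z y \<Longrightarrow> P x y z" using q_nz[OF False] by (simp add: P_def)
  qed
  have "P x y z" for x y z
    using sorted swap1 swap2 by (metis nat_le_linear)
  then show thesis using that[OF f(1,2) fl] by (simp add: P_def)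
qed

end

section \<open>Necessity\<close>

context volterra_quantisation
begin

text \<open>With \<open>x = i + 1\<close>, only the words \<open>u x * u i * u j\<close> and
  \<open>u j * u x * u i\<close> of \<open>D (F i j)\<close> contain the letter \<open>u x\<close>
  at all. Bringing both to the order \<open>x\<close>, \<open>j\<close>, \<open>i\<close> costs
  \<open>q i j\<close> and \<open>q j x\<close>, and the second word already carries the factor
  \<open>q i j\<close>, so \<open>q j x\<close> is 1.\<close>

lemma q_nonadjacent:
  assumes M4: "M \<ge> 4" and x: "\<not> x \<approx> j" "\<not> x \<approx> j + 1" "\<not> x \<approx> j - 1"
  shows "q j x = 1"
proof -
  define i where "i = x - 1"
  obtain f where f: "linear_fn f" "\<And>p. p \<in> I \<Longrightarrow> f p = 0"
    "\<And>i j x. f (lin i j * u x) = 0" "\<And>i j x. f (u x * lin i j) = 0" "\<And>i j. f (D (lin i j)) = 0"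
    "\<And>y z t. f (u y * (u z * u t)) \<noteq> 0 \<longleftrightarrow> {#ix M y, ix M z, ix M t#} = {#ix M x, ix M i, ix M j#}"
    using cubic_functional[of x i j] by blast
  note lf = linear_fn_simps[OF f(1)]
  have ij: "\<not> i \<approx> j" using x(2) by (simp add: i_def algebra_simps)
  have jx: "\<not> j \<approx> x" using x(1) eqv_sym by blast
  have "\<not> x \<approx> i - 1" using M4 by (simp add: i_def int_dvd_small)
  then have ne: "ix M x \<noteq> ix M (i - 1)" "ix M x \<noteq> ix M (j + 1)" "ix M x \<noteq> ix M (j - 1)"
    using x by (simp_all add: eqv_ix)
  have "f (D (F i j)) = 0" using f(2) D_F_in_I[OF ij] by blast
  moreover have "f (u i * (u (i - 1) * u j)) = 0" "f (u i * (u (j + 1) * u j)) = 0"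
     "f (u i * (u j * u (j - 1))) = 0" "f (u (j + 1) * (u j * u i)) = 0" "f (u j * (u (j - 1) * u i)) = 0"
     "f (u j * (u i * u (i - 1))) = 0"
    using ne by (simp_all only: f(6)[THEN arg_cong[of _ _ Not], simplified])
       (auto simp: add_eq_conv_ex)
  ultimately have "f (u x * (u i * u j)) = q i j * f (u j * (u x * u i))"
    by (simp add: D_F lf nc_simps f(5)) (simp add: i_def)
  also have "f (u j * (u x * u i)) = q j x * f (u x * (u j * u i))"
    using functional_swap(2)[OF f(1,2) jx gen_closed[OF M0]] f(3) by simp
  finally have "f (u x * (u i * u j)) = q j x * f (u x * (u i * u j))"
    using functional_swap(3)[OF f(1,2) ij free_alg_closed(1), of x] f(4) by simp
  moreover have "f (u x * (u i * u j)) \<noteq> 0" using f(6) by blast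
  ultimately show ?thesis by simp
qed

text \<open>Among the words of \<open>D (F i (i + 2))\<close> that contain the middle letter
  \<open>u (i + 1)\<close>, those with the factor \<open>q i (i + 2)\<close> cancel. The other two
  say that \<open>u (i + 1)\<close> may be moved across \<open>u i * u (i + 2)\<close> at no cost,
  so the two exchange factors are inverse to each other.\<close>

lemma q_adjacent_Suc:
  assumes M4: "M \<ge> 4"
  shows "q (i + 1) (i + 2) = q i (i + 1)"
proof -
  obtain f where f: "linear_fn f" "\<And>p. p \<in> I \<Longrightarrow> f p = 0"
    "\<And>i j x. f (lin i j * u x) = 0" "\<And>i j x. f (u x * lin i j) = 0" "\<And>i j. f (D (lin i j)) = 0"
    "\<And>y z t. f (u y * (u z * u t)) \<noteq> 0 \<longleftrightarrow>
       {#ix M y, ix M z, ix M t#} = {#ix M i, ix M (i + 1), ix M (i + 2)#}"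
    using cubic_functional[of i "i + 1" "i + 2"] by blast
  note lf = linear_fn_simps[OF f(1)]
  have ij: "\<not> i \<approx> i + 2" "\<not> i + 1 \<approx> i" "\<not> i + 1 \<approx> i + 2" using M3 by (simp_all add: int_dvd_small)
  have ne: "ix M (i - 1) \<noteq> ix M (i + 1)" "ix M (i + 3) \<noteq> ix M (i + 1)"
    using M4 by (simp_all add: ix_eq_iff[OF M0] int_dvd_small)
  have "f (D (F i (i + 2))) = 0" using f(2) D_F_in_I[OF ij(1)] by blast
  moreover have "f (u i * (u (i - 1) * u (i + 2))) = 0" "f (u i * (u (i + 3) * u (i + 2))) = 0"
     "f (u (i + 3) * (u (i + 2) * u i)) = 0" "f (u (i + 2) * (u i * u (i - 1))) = 0"
    using ne by (simp_all only: f(6)[THEN arg_cong[of _ _ Not], simplified])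
       (auto simp: add_eq_conv_ex)
  ultimately have "f (u (i + 1) * (u i * u (i + 2))) = f (u i * (u (i + 2) * u (i + 1)))"
    by (simp add: D_F lf nc_simps f(5) add.commute[of _ i])
  also have "f (u (i + 1) * (u i * u (i + 2))) = q (i + 1) i * f (u i * (u (i + 1) * u (i + 2)))"
    using functional_swap(2)[OF f(1,2) ij(2) gen_closed[OF M0]] f(3) by simp
  also have "f (u i * (u (i + 1) * u (i + 2))) = q (i + 1) (i + 2) * f (u i * (u (i + 2) * u (i + 1)))"
    using functional_swap(3)[OF f(1,2) ij(3) free_alg_closed(1)] f(4) by simp
  finally have "q (i + 1) i * q (i + 1) (i + 2) * f (u i * (u (i + 2) * u (i + 1))) = f (u i * (u (i + 2) * u (i + 1)))"
    by simp
  moreover have "f (u i * (u (i + 2) * u (i + 1))) \<noteq> 0" using f(6) by (auto simp: add_mset_commute)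
  ultimately have "q (i + 1) i * q (i + 1) (i + 2) = 1" by simp
  then show ?thesis
    using q_mult_swap[OF ij(2)] q_nz[OF ij(2)] by (metis mult.commute mult_left_cancel)
qed

text \<open>In \<open>D (F i (i + 1))\<close> the words with three different letters and without the
  factor \<open>q i (i + 1)\<close> cancel. The others let \<open>u (i + 2)\<close> move across
  \<open>u (i + 1) * u i\<close> at no cost.\<close>

lemma q_adjacent_three:
  assumes M: "M = 3"
  shows "q (i + 1) (i + 2) = q (i + 2) i"
proof -
  obtain f where f: "linear_fn f" "\<And>p. p \<in> I \<Longrightarrow> f p = 0"
    "\<And>i j x. f (lin i j * u x) = 0" "\<And>i j x. f (u x * lin i j) = 0" "\<And>i j. f (D (lin i j)) = 0"
    "\<And>y z t. f (u y * (u z * u t)) \<noteq> 0 \<longleftrightarrow>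
       {#ix M y, ix M z, ix M t#} = {#ix M i, ix M (i + 1), ix M (i + 2)#}"
    using cubic_functional[of i "i + 1" "i + 2"] by blast
  note lf = linear_fn_simps[OF f(1)]
  have ij: "\<not> i \<approx> i + 1" "\<not> i \<approx> i + 2" "\<not> i + 1 \<approx> i + 2" using M3 by (simp_all add: int_dvd_small)
  have ne: "ix M (i + 2) \<noteq> ix M i" "ix M (i + 2) \<noteq> ix M (i + 1)"
    using M3 by (simp_all add: ix_eq_iff[OF M0] int_dvd_small)
  have um: "u (i - 1) = u (i + 2)" by (rule gen_eq[OF M0]) (simp add: M)
  have "f (D (F i (i + 1))) = 0" using f(2) D_F_in_I[OF ij(1)] by blast
  moreover have "f (u (i + 1) * (u i * u (i + 1))) = 0" "f (u i * (u (i + 1) * u i)) = 0"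
      "f (u (i + 1) * (u i * u i)) = 0" "f (u (i + 1) * (u (i + 1) * u i)) = 0"
    using ne by (simp_all only: f(6)[THEN arg_cong[of _ _ Not], simplified])
       (auto simp: add_eq_conv_ex)
  ultimately have "q i (i + 1) * f (u (i + 1) * (u i * u (i + 2))) = q i (i + 1) * f (u (i + 2) * (u (i + 1) * u i))"
    by (simp add: D_F lf nc_simps f(5) add.commute[of _ i] um)
  then have "f (u (i + 1) * (u i * u (i + 2))) = f (u (i + 2) * (u (i + 1) * u i))"
    using q_nz[OF ij(1)] by simp
  also have "f (u (i + 1) * (u i * u (i + 2))) = q i (i + 2) * f (u (i + 1) * (u (i + 2) * u i))"
    using functional_swap(3)[OF f(1,2) ij(2) free_alg_closed(1)] f(4) by simp
  also have "f (u (i + 1) * (u (i + 2) * u i)) = q (i + 1) (i + 2) * f (u (i + 2) * (u (i + 1) * u i))"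
    using functional_swap(2)[OF f(1,2) ij(3) gen_closed[OF M0]] f(3) by simp
  finally have "q i (i + 2) * q (i + 1) (i + 2) * f (u (i + 2) * (u (i + 1) * u i)) = f (u (i + 2) * (u (i + 1) * u i))"
    by simp
  moreover have "f (u (i + 2) * (u (i + 1) * u i)) \<noteq> 0" using f(6) by (auto simp: add_mset_commute)
  ultimately have "q i (i + 2) * q (i + 1) (i + 2) = 1" by simp
  then show ?thesis
    using q_swap[OF ij(2)] by (metis inverse_unique)
qed

section \<open>Linear coefficients from words of length two\<close>

text \<open>The values of \<open>u\<^sub>x L\<close>, \<open>L u\<^sub>x\<close> and \<open>\<partial>(L)\<close> under the functional dual to \<open>u\<^sub>b u\<^sub>a\<close>, where \<open>L\<close>
  is the inhomogeneous part of the relation between \<open>u\<^sub>i\<close> and \<open>u\<^sub>j\<close>.\<close>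

definition left_value :: "int \<Rightarrow> int \<Rightarrow> int \<Rightarrow> int \<Rightarrow> int \<Rightarrow> complex" where
  "left_value a b x i j = (if x \<approx> b then s i j a else if x \<approx> a then q a b * s i j b else 0)"

definition right_value :: "int \<Rightarrow> int \<Rightarrow> int \<Rightarrow> int \<Rightarrow> int \<Rightarrow> complex" where
  "right_value a b x i j = (if x \<approx> a then s i j b else if x \<approx> b then q a b * s i j a else 0)"

definition derivation_value :: "int \<Rightarrow> int \<Rightarrow> int \<Rightarrow> int \<Rightarrow> complex" where
  "derivation_value a b i j = (if b \<approx> a + 1 then s i j a - s i j b else 0)"

lemma eqv_trans: "x \<approx> y \<Longrightarrow> y \<approx> z \<Longrightarrow> x \<approx> z"
  by (simp add: eqv_ix)

lemma sum_s:
  assumes "\<And>r. f r = (if r \<approx> a then c else 0)"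
  shows "(\<Sum>r = 1..M. s i j (int r) * f (int r)) = s i j a * c"
proof -
  have "(\<Sum>r = 1..M. s i j (int r) * f (int r)) = (\<Sum>r = 1..M. if int r \<approx> a then s i j (int r) * c else 0)"
    by (intro sum.cong) (simp_all add: assms)
  also have "\<dots> = s i j a * c"
    by (rule sum_residue[OF M0]) (simp add: eqv_ix s_def)
  finally show ?thesis .
qed

text \<open>The derivative of a linear part contains only products of neighbours, and the hypothesis
  \<open>ab\<close> leaves one possible orientation for them. As \<open>M \<ge> 3\<close>, any two
  letters can be named \<open>a\<close> and \<open>b\<close> so that it holds.\<close>

lemma quadratic_values:
  assumes ab: "\<not> a \<approx> b + 1"
  obtains f where "linear_fn f" "\<And>p. p \<in> I \<Longrightarrow> f p = 0"
    "\<And>x i j. f (u x * lin i j) = left_value a b x i j" "\<And>x i j. f (lin i j * u x) = right_value a b x i j"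
    "\<And>i j. f (D (lin i j)) = derivation_value a b i j"
proof -
  obtain f where f: "linear_fn f" "\<And>p. p \<in> I \<Longrightarrow> f p = 0" "\<And>x. f (u x) = 0"
    "\<And>x y. f (u x * u y) =
       (if x \<approx> b \<and> y \<approx> a then 1 else if x \<approx> a \<and> y \<approx> b then q a b else 0)"
    using quadratic_functional[of b a] by blast
  show thesis
  proof (rule that[OF f(1,2)])
    fix i j x
    show "f (u x * lin i j) = left_value a b x i j"
    proof -
      \<comment> \<open>For fixed \<open>x\<close> at most one residue class of \<open>r\<close>
        gives a nonzero value, which is the shape that \<open>sum_s\<close> evaluates. If
        \<open>x\<close> is neither letter, the class is arbitrary and the constant is 0.\<close>
      have "f (u x * u r) = (if r \<approx> (if x \<approx> b then a else b)
          then (if x \<approx> b then 1 else if x \<approx> a then q a b else 0) else 0)" for r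
        unfolding f(4)
        by (cases "x \<approx> a"; cases "x \<approx> b"; cases "r \<approx> a"; cases "r \<approx> b"; simp add: eqv_ix)
      from sum_s[of "\<lambda>r. f (u x * u r)", OF this] show ?thesis
        by (simp add: functional_lin[OF f(1)] f(3) left_value_def)
    qed
    show "f (lin i j * u x) = right_value a b x i j"
    proof -
      have "f (u r * u x) = (if r \<approx> (if x \<approx> a then b else a)
          then (if x \<approx> a then 1 else if x \<approx> b then q a b else 0) else 0)" for r
        unfolding f(4)
        by (cases "x \<approx> a"; cases "x \<approx> b"; cases "r \<approx> a"; cases "r \<approx> b"; simp add: eqv_ix)
      from sum_s[of "\<lambda>r. f (u r * u x)", OF this] show ?thesis
        by (simp add: functional_lin[OF f(1)] f(3) right_value_def)
    qed
    show "f (D (lin i j)) = derivation_value a b i j"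
    proof -
      have Suc: "r + 1 \<approx> y + 1" if "r \<approx> y" for r y using that by simp
      have pred: "r - 1 \<approx> y \<longleftrightarrow> r \<approx> y + 1" for r y by (simp add: algebra_simps)
      have 1: "f (u (r + 1) * u r) = (if r \<approx> a then (if b \<approx> a + 1 then 1 else 0) else 0)" for r
      proof -
        have "r + 1 \<approx> b \<and> r \<approx> a \<longleftrightarrow> r \<approx> a \<and> b \<approx> a + 1"
          using Suc eqv_sym eqv_trans by blast
        moreover have "\<not> (r + 1 \<approx> a \<and> r \<approx> b)"
          using ab Suc eqv_sym eqv_trans by blast
        ultimately show ?thesis unfolding f(4) by auto
      qed
      have 2: "f (u r * u (r - 1)) = (if r \<approx> b then (if b \<approx> a + 1 then 1 else 0) else 0)" for r
      proof -
        have "r \<approx> b \<and> r - 1 \<approx> a \<longleftrightarrow> r \<approx> b \<and> b \<approx> a + 1"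
          unfolding pred using eqv_sym eqv_trans by blast
        moreover have "\<not> (r \<approx> a \<and> r - 1 \<approx> b)"
          unfolding pred using ab eqv_sym eqv_trans by blast
        ultimately show ?thesis unfolding f(4) by auto
      qed
      show ?thesis
        using sum_s[of "\<lambda>r. f (u (r + 1) * u r)", OF 1, of i j]
          sum_s[of "\<lambda>r. f (u r * u (r - 1))", OF 2, of i j]
        by (simp add: functional_lin[OF f(1)] right_diff_distrib sum_subtractf derivation_value_def)
    qed
  qed
qed

lemma rest_in_I:
  assumes "D (F i j) = p + r" "p \<in> I" "\<not> i \<approx> j"
  shows "r \<in> I"
  using I_diff[OF D_F_in_I[OF assms(3)] assms(2)] assms(1) by simp

text \<open>Since the derivative lies in the ideal, removing the multiples of relations turns
  invariance into a condition on the inhomogeneous parts alone. The following lemmas do the same for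
  the other kinds of pairs.\<close>

lemma adjacent_rest:
  assumes M4: "M \<ge> 4"
  shows "u (i + 1) * lin i (i + 1) - lin i (i + 1) * u i - u i * lin (i - 1) (i + 1)
        - lin i (i + 1) * u (i - 1) + lin i (i + 2) * u (i + 1) + u (i + 2) * lin i (i + 1)
        - D (lin i (i + 1)) \<in> I"
proof (rule rest_in_I[OF D_F_adjacent])
  show "q (i - 1) (i + 1) = 1" "q i (i + 2) = 1"
    using M4 by (intro q_nonadjacent; simp add: int_dvd_small)+
qed (use M4 in \<open>(intro I_add I_diff F_mult_in_I)?; simp add: int_dvd_small\<close>)+

lemma distance_two_rest:
  assumes M5: "M \<ge> 5"
  shows "u (i + 1) * lin i (i + 2) - lin i (i + 2) * u (i + 1) + lin (i + 1) (i + 2) * u i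
        - u (i + 2) * lin i (i + 1) - u i * lin (i - 1) (i + 2) - lin i (i + 2) * u (i - 1)
        + lin i (i + 3) * u (i + 2) + u (i + 3) * lin i (i + 2) - D (lin i (i + 2)) \<in> I"
proof (rule rest_in_I[OF D_F_distance_two])
  show "q i (i + 2) = 1" "q (i - 1) (i + 2) = 1" "q i (i + 3) = 1"
    using M5 by (intro q_nonadjacent; simp add: int_dvd_small)+
  show "q (i + 1) (i + 2) = q i (i + 1)" using q_adjacent_Suc M5 by simp
qed (use M5 in \<open>(intro I_add I_diff F_mult_in_I)?; simp add: int_dvd_small\<close>)+

lemma distant_rest:
  assumes M6: "M \<ge> 5" and ij: "\<not> i \<approx> j" "\<not> i + 1 \<approx> j" "\<not> i - 1 \<approx> j" "\<not> i + 2 \<approx> j" "\<not> i - 2 \<approx> j"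
  shows "u (i + 1) * lin i j + lin (i + 1) j * u i - u i * lin (i - 1) j - lin i j * u (i - 1)
        + lin i (j + 1) * u j + u (j + 1) * lin i j - lin i j * u (j - 1) - u j * lin i (j - 1)
        - D (lin i j) \<in> I"
proof (rule rest_in_I[OF D_F_distant])
  have c: "int M dvd x \<longleftrightarrow> int M dvd y" if "x = - y" for x y using that by simp
  have n: "\<not> int M dvd i - j" "\<not> int M dvd i - j + 1" "\<not> int M dvd i - j - 1" "\<not> int M dvd i - j + 2"
    "\<not> int M dvd i - j - 2"
    using ij by (simp_all add: algebra_simps)
  have n': "\<not> int M dvd j - i" "\<not> int M dvd j - i + 1" "\<not> int M dvd j - i - 1" "\<not> int M dvd j - i + 2"
    "\<not> int M dvd j - i - 2"
    using n c[of "j - i" "i - j"] c[of "j - i + 1" "i - j - 1"] c[of "j - i - 1" "i - j + 1"]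
      c[of "j - i + 2" "i - j - 2"] c[of "j - i - 2" "i - j + 2"] by simp_all
  show "q i j = 1" "q (i + 1) j = 1" "q (i - 1) j = 1" "q i (j + 1) = 1" "q i (j - 1) = 1"
    using M6 n n' by (intro q_nonadjacent; simp add: algebra_simps)+
  show "u (i + 1) * F i j + F (i + 1) j * u i - u i * F (i - 1) j - F i j * u (i - 1)
        + F i (j + 1) * u j + u (j + 1) * F i j - F i j * u (j - 1) - u j * F i (j - 1) \<in> I"
    using n by (intro I_add I_diff F_mult_in_I) (simp_all add: algebra_simps)
qed (rule ij(1))

lemma three_rest:
  assumes M: "M = 3"
  shows "u (i + 1) * lin i (i + 1) - lin i (i + 1) * u i + lin (i + 1) (i + 2) * u i
        - u (i + 1) * lin (i + 2) i - D (lin i (i + 1)) \<in> I"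
proof (rule rest_in_I[OF D_F_three[OF M]])
  have "q (i + 2) (i + 3) = q (i + 3) (i + 1)" using q_adjacent_three[OF M, of "i + 1"] by (simp add: add.commute[of _ i])
  moreover have "q (i + 2) (i + 3) = q (i + 2) i" "q (i + 3) (i + 1) = q i (i + 1)"
    by (rule periodic(1)[where r = 0 and r' = 0]; simp add: M)+
  ultimately show "q (i + 2) i = q i (i + 1)" by simp
  then show "q (i + 1) (i + 2) = q i (i + 1)" using q_adjacent_three[OF M, of i] by simp
  show "u (i + 1) * F i (i + 1) - F i (i + 1) * u i + F (i + 1) (i + 2) * u i - u (i + 1) * F (i + 2) i \<in> I"
    using M3 by (intro I_add I_diff F_mult_in_I) (simp_all add: int_dvd_small)
qed (use M3 in \<open>simp add: int_dvd_small\<close>)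

lemma adjacent_coefficient:
  assumes M4: "M \<ge> 4" and ab: "\<not> a \<approx> b + 1"
  shows "left_value a b (i + 1) i (i + 1) - right_value a b i i (i + 1) - left_value a b i (i - 1) (i + 1)
        - right_value a b (i - 1) i (i + 1) + right_value a b (i + 1) i (i + 2) + left_value a b (i + 2) i (i + 1)
        - derivation_value a b i (i + 1) = 0"
proof -
  obtain f where f: "linear_fn f" "\<And>p. p \<in> I \<Longrightarrow> f p = 0"
    "\<And>x i j. f (u x * lin i j) = left_value a b x i j" "\<And>x i j. f (lin i j * u x) = right_value a b x i j"
    "\<And>i j. f (D (lin i j)) = derivation_value a b i j"
    using quadratic_values[OF ab] by blast
  show ?thesis
    using f(2)[OF adjacent_rest[OF M4, of i]] by (simp only: linear_fn_simps[OF f(1)] f(3-5))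
qed

lemma distance_two_coefficient:
  assumes M5: "M \<ge> 5" and ab: "\<not> a \<approx> b + 1"
  shows "left_value a b (i + 1) i (i + 2) - right_value a b (i + 1) i (i + 2) + right_value a b i (i + 1) (i + 2)
        - left_value a b (i + 2) i (i + 1) - left_value a b i (i - 1) (i + 2) - right_value a b (i - 1) i (i + 2)
        + right_value a b (i + 2) i (i + 3) + left_value a b (i + 3) i (i + 2) - derivation_value a b i (i + 2) = 0"
proof -
  obtain f where f: "linear_fn f" "\<And>p. p \<in> I \<Longrightarrow> f p = 0"
    "\<And>x i j. f (u x * lin i j) = left_value a b x i j" "\<And>x i j. f (lin i j * u x) = right_value a b x i j"
    "\<And>i j. f (D (lin i j)) = derivation_value a b i j"
    using quadratic_values[OF ab] by blast
  show ?thesis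
    using f(2)[OF distance_two_rest[OF M5, of i]] by (simp only: linear_fn_simps[OF f(1)] f(3-5))
qed

lemma distant_coefficient:
  assumes M5: "M \<ge> 5" and ij: "\<not> i \<approx> j" "\<not> i + 1 \<approx> j" "\<not> i - 1 \<approx> j" "\<not> i + 2 \<approx> j" "\<not> i - 2 \<approx> j"
    and ab: "\<not> a \<approx> b + 1"
  shows "left_value a b (i + 1) i j + right_value a b i (i + 1) j - left_value a b i (i - 1) j - right_value a b (i - 1) i j
        + right_value a b j i (j + 1) + left_value a b (j + 1) i j - right_value a b (j - 1) i j - left_value a b j i (j - 1)
        - derivation_value a b i j = 0"
proof -
  obtain f where f: "linear_fn f" "\<And>p. p \<in> I \<Longrightarrow> f p = 0"
    "\<And>x i j. f (u x * lin i j) = left_value a b x i j" "\<And>x i j. f (lin i j * u x) = right_value a b x i j"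
    "\<And>i j. f (D (lin i j)) = derivation_value a b i j"
    using quadratic_values[OF ab] by blast
  show ?thesis
    using f(2)[OF distant_rest[OF M5 ij]] by (simp only: linear_fn_simps[OF f(1)] f(3-5))
qed

lemma three_coefficient:
  assumes M: "M = 3" and ab: "\<not> a \<approx> b + 1"
  shows "left_value a b (i + 1) i (i + 1) - right_value a b i i (i + 1) + right_value a b i (i + 1) (i + 2)
        - left_value a b (i + 1) (i + 2) i - derivation_value a b i (i + 1) = 0"
proof -
  obtain f where f: "linear_fn f" "\<And>p. p \<in> I \<Longrightarrow> f p = 0"
    "\<And>x i j. f (u x * lin i j) = left_value a b x i j" "\<And>x i j. f (lin i j * u x) = right_value a b x i j"
    "\<And>i j. f (D (lin i j)) = derivation_value a b i j"
    using quadratic_values[OF ab] by blast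
  show ?thesis
    using f(2)[OF three_rest[OF M, of i]] by (simp only: linear_fn_simps[OF f(1)] f(3-5))
qed

text \<open>Each equation is the coefficient of one quadratic monomial in
  \<open>adjacent_rest\<close>: the first four come from the squares of \<open>u (i + 2)\<close>,
  \<open>u (i - 1)\<close>, \<open>u (i + 1)\<close> and \<open>u i\<close>, the next two from the
  neighbours \<open>i + 1\<close>, \<open>i + 2\<close> and \<open>i - 1\<close>, \<open>i\<close>,
  the last two from pairs at distance two, where \<open>q\<close> is 1. Within the window from
  \<open>i - 1\<close> to \<open>i + 2\<close>, an adjacent pair thus involves only its own letters
  and determines the parts at distance two.\<close>

lemma adjacent_s:
  assumes M4: "M \<ge> 4"
  shows "s i (i + 1) (i + 2) = 0" "s i (i + 1) (i - 1) = 0"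
    "s i (i + 2) (i + 1) = - s i (i + 1) (i + 1)" "s (i - 1) (i + 1) i = - s i (i + 1) i"
    "s i (i + 2) (i + 2) = 0" "s (i - 1) (i + 1) (i - 1) = 0"
    "s i (i + 2) (i - 1) = s i (i + 1) (i + 1)" "s (i - 1) (i + 1) (i + 2) = s i (i + 1) i"
proof -
  note c = adjacent_coefficient[OF M4, where i = i]
  show 1: "s i (i + 1) (i + 2) = 0"
    using c[of "i + 2" "i + 2"] M4 by (simp add: left_value_def right_value_def derivation_value_def int_dvd_small)
  show 2: "s i (i + 1) (i - 1) = 0"
    using c[of "i - 1" "i - 1"] M4 by (simp add: left_value_def right_value_def derivation_value_def int_dvd_small)
  show "s i (i + 2) (i + 1) = - s i (i + 1) (i + 1)"
    using c[of "i + 1" "i + 1"] M4 by (simp add: left_value_def right_value_def derivation_value_def int_dvd_small add_eq_0_iff)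
  show "s (i - 1) (i + 1) i = - s i (i + 1) i"
    using c[of i i] M4 by (simp add: left_value_def right_value_def derivation_value_def int_dvd_small add_eq_0_iff)
  show "s i (i + 2) (i + 2) = 0"
    using c[of "i + 1" "i + 2"] M4 1 by (simp add: left_value_def right_value_def derivation_value_def int_dvd_small)
  show "s (i - 1) (i + 1) (i - 1) = 0"
    using c[of "i - 1" i] M4 2 by (simp add: left_value_def right_value_def derivation_value_def int_dvd_small)
  show "s i (i + 2) (i - 1) = s i (i + 1) (i + 1)"
    using c[of "i - 1" "i + 1"] q_nonadjacent[OF M4, of "i + 1" "i - 1"] M4 2 by (simp add: left_value_def right_value_def derivation_value_def int_dvd_small)
  show "s (i - 1) (i + 1) (i + 2) = s i (i + 1) i"
    using c[of i "i + 2"] q_nonadjacent[OF M4, of "i + 2" i] M4 1 by (simp add: left_value_def right_value_def derivation_value_def int_dvd_small)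
qed

text \<open>Both adjacent pairs inside \<open>i\<close>, \<open>i + 1\<close>, \<open>i + 2\<close>
  determine the middle coefficient of the pair \<open>i\<close>, \<open>i + 2\<close>.\<close>

lemma adjacent_s_Suc:
  assumes M4: "M \<ge> 4"
  shows "s (i + 1) (i + 2) (i + 1) = s i (i + 1) (i + 1)"
  using adjacent_s(3)[OF M4, of i] adjacent_s(4)[OF M4, of "i + 1"] by (simp add: add.commute[of _ i])

text \<open>From \<open>M = 5\<close> on, \<open>i + 3\<close> and \<open>i - 1\<close> are
  different, and the square of \<open>u (i + 3)\<close> forces
  \<open>s i (i + 2) (i + 3) = 0\<close>. Through \<open>adjacent_s\<close> this kills every
  coefficient inside the window; letters outside it are isolated by their product with one fixed
  neighbour.\<close>

lemma near_coefficients_vanish: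
  assumes M5: "M \<ge> 5"
  shows "s i (i + 1) r = 0" "s i (i + 2) r = 0"
proof -
  have M4: "M \<ge> 4" using M5 by simp
  note a = adjacent_s[OF M4]
  have 1: "s i (i + 2) (i + 3) = 0" for i
    using distance_two_coefficient[OF M5, of "i + 3" "i + 3" i] M5
    by (simp add: left_value_def right_value_def derivation_value_def int_dvd_small)
  have b: "s i (i + 1) i = 0" for i
    using a(8)[of i] 1[of "i - 1"] by (simp add: add.commute[of _ i])
  then have b': "s i (i + 1) (i + 1) = 0" for i
    using adjacent_s_Suc[OF M4, of i] b[of "i + 1"] by (simp add: add.commute[of _ i])
  have s: "s i (i + 1) r = 0" for i r
  proof -
    consider "r \<approx> i - 1" | "r \<approx> i" | "r \<approx> i + 1" | "r \<approx> i + 2" | "r \<approx> i + 3"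
      | "\<not> r \<approx> i - 1" "\<not> r \<approx> i" "\<not> r \<approx> i + 1" "\<not> r \<approx> i + 2" "\<not> r \<approx> i + 3" by blast
    then show ?thesis
    proof cases
      case 6
      then have "\<not> i - 1 \<approx> r" "\<not> i \<approx> r" "\<not> i + 1 \<approx> r" "\<not> i + 2 \<approx> r" "\<not> i + 3 \<approx> r"
        using eqv_sym by blast+
      then show ?thesis
        using adjacent_coefficient[OF M4, of r "i + 2" i] M5 6 a(1)[of i]
        by (simp add: left_value_def right_value_def derivation_value_def int_dvd_small algebra_simps)
    next
      \<comment> \<open>The generic monomial, formed with \<open>i + 2\<close>, would violate the
        orientation condition for \<open>r = i + 3\<close>; the monomial of \<open>i + 1\<close> and
        \<open>i + 3\<close> replaces it.\<close>
      case 5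
      have "s i (i + 1) (i + 3) = 0"
        using adjacent_coefficient[OF M4, of "i + 1" "i + 3" i] q_nonadjacent[OF M4, of "i + 3" "i + 1"] M5 1[of i]
        by (simp add: left_value_def right_value_def derivation_value_def int_dvd_small)
      then show ?thesis using periodic(2)[of i i "i + 1" "i + 1", OF _ _ 5] by simp
    next
      case 1
      then show ?thesis using periodic(2)[of i i "i + 1" "i + 1", OF _ _ 1] a(2)[of i] by simp
    next
      case 2
      then show ?thesis using periodic(2)[of i i "i + 1" "i + 1", OF _ _ 2] b by simp
    next
      case 3
      then show ?thesis using periodic(2)[of i i "i + 1" "i + 1", OF _ _ 3] b' by simp
    next
      case 4
      then show ?thesis using periodic(2)[of i i "i + 1" "i + 1", OF _ _ 4] a(1)[of i] by simp
    qed
  qed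
  show "s i (i + 1) r = 0" by (rule s)
  show "s i (i + 2) r = 0"
  proof -
    consider "r \<approx> i - 1" | "r \<approx> i" | "r \<approx> i + 1" | "r \<approx> i + 2"
      | "\<not> r \<approx> i - 1" "\<not> r \<approx> i" "\<not> r \<approx> i + 1" "\<not> r \<approx> i + 2" by blast
    then show ?thesis
    proof cases
      case 5
      then have "\<not> i - 1 \<approx> r" "\<not> i \<approx> r" "\<not> i + 1 \<approx> r" "\<not> i + 2 \<approx> r"
        using eqv_sym by blast+
      then show ?thesis
        using adjacent_coefficient[OF M4, of "i + 1" r i] M5 5 s[of i r]
        by (simp add: left_value_def right_value_def derivation_value_def int_dvd_small algebra_simps)
    next
      case 1
      then show ?thesis using periodic(2)[of i i "i + 2" "i + 2", OF _ _ 1] a(7)[of i] b' by simp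
    next
      case 2
      then show ?thesis using periodic(2)[of i i "i + 2" "i + 2", OF _ _ 2] a(6)[of "i + 1"]
        by (simp add: add.commute[of _ i])
    next
      case 3
      then show ?thesis using periodic(2)[of i i "i + 2" "i + 2", OF _ _ 3] a(3)[of i] b' by simp
    next
      case 4
      then show ?thesis using periodic(2)[of i i "i + 2" "i + 2", OF _ _ 4] a(5)[of i] by simp
    qed
  qed
qed

text \<open>Two squares and one product of neighbours give three equations. Applied at three
  consecutive indices, they identify all coefficients around the cycle.\<close>

lemma three_coefficients_equal:
  assumes M: "M = 3"
  shows "s i (i + 1) r = s 0 1 0"
proof -
  have per: "s (i + 3) j r = s i j r" "s i (j + 3) r = s i j r" "s i j (r + 3) = s i j r" for i j r
    by (rule periodic(2); simp add: M)+
  note c = three_coefficient[OF M, where i = i for i]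
  have 1: "s i (i + 1) (i + 1) = s (i + 2) i (i + 1)" for i
    using c[of "i + 1" "i + 1" i] M3 by (simp add: left_value_def right_value_def derivation_value_def int_dvd_small)
  have 2: "s (i + 1) (i + 2) i = s i (i + 1) i" for i
    using c[of i i i] M3 by (simp add: left_value_def right_value_def derivation_value_def int_dvd_small)
  have 3: "s (i + 1) (i + 2) (i + 1) = s (i + 2) i i" for i
    using c[of i "i + 1" i] M3 by (simp add: left_value_def right_value_def derivation_value_def int_dvd_small)
  have x: "s (i + 1) (i + 2) (i + 1) = s i (i + 1) i" and y: "s i (i + 1) (i + 1) = s i (i + 1) i"
    and z: "s i (i + 1) (i + 2) = s i (i + 1) i" for i
    using 1[of i] 2[of i] 3[of i] 1[of "i + 1"] 2[of "i + 1"] 3[of "i + 1"] 1[of "i + 2"] 2[of "i + 2"] 3[of "i + 2"]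
     per[of i] per[of _ i] per[of _ _ i] per[of "i + 1"] per[of _ "i + 1"] per[of _ _ "i + 1"]
    by (simp_all add: add.commute[of _ i])
  have x0: "s i (i + 1) i = s 0 1 0" for i
    by (induction i rule: int_induct[where k = 0]) (use x[of "i - 1" for i] x in \<open>simp_all add: add.commute\<close>)
  have "r \<approx> i \<or> r \<approx> i + 1 \<or> r \<approx> i + 2" unfolding M by presburger
  then show ?thesis
    using periodic(2)[of i i "i + 1" "i + 1" r] x0[of i] y[of i] z[of i] by fastforce
qed

text \<open>The squares of \<open>u (i + 1)\<close> and \<open>u (i - 1)\<close> give the
  coefficients there, and the exchange of \<open>i\<close> and \<open>j\<close> gives those around
  \<open>j\<close>. The monomial of \<open>i\<close> and \<open>j + 1\<close> then yields the
  coefficient at \<open>i\<close>, and the remaining letters \<open>r\<close> are isolated by their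
  product with \<open>u (i + 1)\<close>.\<close>

lemma far_coefficients_vanish:
  assumes M5: "M \<ge> 5" and ij: "far i j"
  shows "s i j r = 0"
proof -
  have M4: "M \<ge> 4" using M5 by simp
  have coeff: "left_value a b (i + 1) i j + right_value a b i (i + 1) j - left_value a b i (i - 1) j - right_value a b (i - 1) i j
        + right_value a b j i (j + 1) + left_value a b (j + 1) i j - right_value a b (j - 1) i j - left_value a b j i (j - 1)
        - derivation_value a b i j = 0" if "far i j" "\<not> a \<approx> b + 1" for a b i j
    using that by (intro distant_coefficient[OF M5]) (simp_all add: far_def)
  have self1: "s i j (i + 1) = 0" if "far i j" for i j
    using coeff[OF that, of "i + 1" "i + 1"] M5 far_neq[OF that]
    by (simp add: left_value_def right_value_def derivation_value_def int_dvd_small)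
  have self2: "s i j (i - 1) = 0" if "far i j" for i j
    using coeff[OF that, of "i - 1" "i - 1"] M5 far_neq[OF that]
    by (simp add: left_value_def right_value_def derivation_value_def int_dvd_small)
  have self3: "s i j (j + 1) = 0" "s i j (j - 1) = 0" if "far i j" for i j
    using self1[OF far_sym[OF that]] self2[OF far_sym[OF that]] s_swap[of j i] far_neq(2)[OF that] by simp_all
  have near: "s i j r = 0" if "i + 2 \<approx> j \<or> i - 2 \<approx> j" for i j r
  proof -
    have "s i (i + 2) r = 0" "s i (i - 2) r = 0"
      using near_coefficients_vanish(2)[OF M5] s_swap[of "i - 2" i r] near_coefficients_vanish(2)[OF M5, of "i - 2" r] M5
      by (simp_all add: int_dvd_small)
    then show ?thesis
      using that periodic(2)[of i i "i + 2" j r r] periodic(2)[of i i "i - 2" j r r] by auto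
  qed
  \<comment> \<open>Moving \<open>i\<close> by one step leaves a pair that is far or at distance
    two, and both kinds are already under control.\<close>
  have next_j: "s k j (j + 1) = 0" if "k = i + 1 \<or> k = i - 1" "far i j" for i j k
  proof (cases "k + 2 \<approx> j \<or> k - 2 \<approx> j")
    case False
    then have "far k j" using that far_neq[OF that(2)] by (auto simp: far_def algebra_simps)
    then show ?thesis by (rule self3)
  qed (rule near)
  have self4: "s i j i = 0" if "far i j" for i j
    using coeff[OF that, of i "j + 1"] M5 far_neq[OF that] that next_j[of "i + 1" i j] next_j[of "i - 1" i j]
    by (simp add: left_value_def right_value_def derivation_value_def int_dvd_small far_def algebra_simps)
  have self5: "s i j j = 0" if "far i j" for i j
    using self4[OF far_sym[OF that]] s_swap[of j i] far_neq(2)[OF that] by simp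
  \<comment> \<open>The generic choice \<open>b = i + 1\<close> is forbidden for
    \<open>a = i + 2\<close> by the orientation condition, so \<open>b = i - 1\<close> is
    taken.\<close>
  have two: "s i j (i + 2) = 0" if "far i j" for i j
  proof (cases "i + 2 \<approx> j - 1")
    case True
    then show ?thesis using periodic(2)[of i i j j "i + 2" "j - 1"] self3[OF that] by simp
  next
    case F: False
    show ?thesis
    proof (cases "i + 2 \<approx> j + 1")
      case True
      then show ?thesis using periodic(2)[of i i j j "i + 2" "j + 1"] self3[OF that] by simp
    next
      case False
      have n: "\<not> i + 2 \<approx> j" using that by (simp add: far_def)
      then have "\<not> j \<approx> i + 2" "\<not> j - 1 \<approx> i + 2" "\<not> j + 1 \<approx> i + 2" using F False eqv_sym by blast+
      then show ?thesis
        using coeff[OF that, of "i + 2" "i - 1"] q_nonadjacent[OF M4, of "i - 1" "i + 2"] M5 far_neq[OF that] n F False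
        by (simp add: left_value_def right_value_def derivation_value_def int_dvd_small)
    qed
  qed
  consider "r \<approx> i - 1" | "r \<approx> i" | "r \<approx> i + 1" | "r \<approx> i + 2" | "r \<approx> j" | "r \<approx> j + 1" | "r \<approx> j - 1"
    | "\<not> r \<approx> i - 1" "\<not> r \<approx> i" "\<not> r \<approx> i + 1" "\<not> r \<approx> i + 2" "\<not> r \<approx> j" "\<not> r \<approx> j + 1" "\<not> r \<approx> j - 1" by blast
  then show ?thesis
  proof cases
    case 8
    then have "\<not> i - 1 \<approx> r" "\<not> i \<approx> r" "\<not> i + 1 \<approx> r" "\<not> i + 2 \<approx> r" "\<not> j \<approx> r" "\<not> j + 1 \<approx> r" "\<not> j - 1 \<approx> r"
      using eqv_sym by blast+
    then show ?thesis
      using coeff[OF ij, of r "i + 1"] M5 far_neq[OF ij] 8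
      by (simp add: left_value_def right_value_def derivation_value_def int_dvd_small algebra_simps)
  qed (use periodic(2)[of i i j j r] self1[OF ij] self2[OF ij] self3[OF ij] self4[OF ij] self5[OF ij] two[OF ij]
      in \<open>simp_all\<close>)
qed

lemma coefficients_vanish:
  assumes M5: "M \<ge> 5" and ij: "\<not> i \<approx> j"
  shows "s i j r = 0"
proof -
  have "s i (i + 1) r = 0" "s i (i + 2) r = 0" using near_coefficients_vanish[OF M5] by simp_all
  moreover have "s i (i - 1) r = 0" "s i (i - 2) r = 0"
    using near_coefficients_vanish(1)[OF M5, of "i - 1" r] near_coefficients_vanish(2)[OF M5, of "i - 2" r]
      s_swap[of "i - 1" i r] s_swap[of "i - 2" i r] M5
    by (simp_all add: int_dvd_small)
  ultimately show ?thesis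
    using far_coefficients_vanish[OF M5, of i j r] ij periodic(2)[of i i "i + 1" j r r] periodic(2)[of i i "i + 2" j r r]
      periodic(2)[of i i "i - 1" j r r] periodic(2)[of i i "i - 2" j r r]
    by (auto simp: far_def)
qed

end

section \<open>Recognising the relations of the theorem\<close>

context comm_relations
begin

lemma genideal_relations3:
  assumes M: "M = 3" and q: "\<And>i. q i (i + 1) = \<alpha>"
    and s: "\<And>i r. s i (i + 1) r = \<beta>" and e: "\<And>i. e i (i + 1) = \<gamma>"
  shows "genideal (free_alg M) (relations3 \<alpha> \<beta> \<gamma>) = I"
proof -
  have sum3: "(\<Sum>r = 1..M. g (int r)) = g 1 + g 2 + g 3" for g :: "int \<Rightarrow> ncpoly"
    by (simp add: M numeral_eq_Suc)
  have lin: "lin i (i + 1) = cnst \<beta> * (gen 3 1 + gen 3 2 + gen 3 3) + cnst \<gamma>" for i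
    using sum3[of "\<lambda>r. cnst \<beta> * u r"] unfolding lin_def s e by (simp add: M distrib_left)
  have eq: "relations3 \<alpha> \<beta> \<gamma> = range (\<lambda>i. F i (i + 1))"
    unfolding relations3_def Let_def F_def lin q simp_thms full_SetCompr_eq
    by (intro image_cong refl) (simp add: M algebra_simps)
  have neq: "\<not> i \<approx> i + 1" for i using M3 by (simp add: int_dvd_small)
  show ?thesis
    unfolding eq
  proof (rule genideal_eq_I)
    show "\<exists>i j. \<not> i \<approx> j \<and> g = F i j" if "g \<in> range (\<lambda>i. F i (i + 1))" for g
      using that neq by blast
    fix i j assume ij: "1 \<le> i" "i < j" "j \<le> M"
    then consider "i = 1" "j = 2" | "i = 2" "j = 3" | "i = 1" "j = 3" using M by linarith
    then show "F (int i) (int j) \<in> range (\<lambda>i. F i (i + 1)) \<or> F (int j) (int i) \<in> range (\<lambda>i. F i (i + 1))"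
    proof cases
      case 1
      then show ?thesis by (intro disjI1 range_eqI[of _ _ 1]) simp
    next
      case 2
      then show ?thesis by (intro disjI1 range_eqI[of _ _ 2]) simp
    next
      case 3
      have "F 3 1 = F 3 4" by (rule periodic(5)[where r = 0 and r' = 0]; simp add: M)
      then show ?thesis using 3 by (intro disjI2 range_eqI[of _ _ 3]) simp
    qed
  qed
qed

text \<open>In the relations of adjacent pairs the coefficient of \<open>u n\<close> depends only on
  the parity of \<open>n\<close>: it is \<open>\<beta> = b 0\<close> for even and
  \<open>\<gamma> = b 1\<close> for odd \<open>n\<close>. This single function \<open>b\<close>
  makes the six relations two cyclic families.\<close>

lemma genideal_relations4:
  assumes M: "M = 4" and q: "\<And>i. q i (i + 1) = \<alpha>" and q1: "\<And>i. q i (i + 2) = 1"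
    and lin: "\<And>i. lin i (i + 1) = cnst (b i) * u i + cnst (b (i + 1)) * u (i + 1) - cnst (b i * b (i + 1))"
    and lin2: "\<And>i. lin i (i + 2) = cnst (b (i + 1)) * (u (i + 3) - u (i + 1))"
    and b: "\<And>i. b (i + 2) = b i"
  shows "genideal (free_alg M) (relations4 \<alpha> (b 0) (b 1)) = I"
proof -
  have b': "b 2 = b 0" "b 3 = b 1" "b 4 = b 0" "b 5 = b 1"
    using b[of 0] b[of 1] b[of 2] b[of 3] by simp_all
  have u: "u 5 = u 1" by (rule gen_eq[OF M0]) (simp add: M)
  have l: "lin 1 2 = cnst (b 1) * u 1 + cnst (b 0) * u 2 - cnst (b 1 * b 0)"
    "lin 2 3 = cnst (b 0) * u 2 + cnst (b 1) * u 3 - cnst (b 0 * b 1)"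
    "lin 3 4 = cnst (b 1) * u 3 + cnst (b 0) * u 4 - cnst (b 1 * b 0)"
    "lin 4 5 = cnst (b 0) * u 4 + cnst (b 1) * u 1 - cnst (b 0 * b 1)"
    "lin 1 3 = cnst (b 0) * (u 4 - u 2)"
    "lin 2 4 = cnst (b 1) * (u 1 - u 3)"
    using lin[of 1] lin[of 2] lin[of 3] lin[of 4] lin2[of 1] lin2[of 2] by (simp_all add: b' u)
  have q': "q 1 2 = \<alpha>" "q 2 3 = \<alpha>" "q 3 4 = \<alpha>" "q 4 5 = \<alpha>" "q 1 3 = 1" "q 2 4 = 1"
    using q[of 1] q[of 2] q[of 3] q[of 4] q1[of 1] q1[of 2] by simp_all
  have eq: "relations4 \<alpha> (b 0) (b 1) = {F 1 2, F 1 3, F 4 5, F 2 3, F 2 4, F 3 4}"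
    unfolding relations4_def Let_def F_def l q' u M[symmetric]
    by (intro arg_cong2[where f = insert] refl) (simp_all add: cnst_1 algebra_simps)
  show ?thesis
    unfolding eq
  proof (rule genideal_eq_I)
    have "\<not> 1 \<approx> 2" "\<not> 1 \<approx> 3" "\<not> 4 \<approx> 5" "\<not> 2 \<approx> 3" "\<not> 2 \<approx> 4" "\<not> 3 \<approx> 4"
      using M by (simp_all add: int_dvd_small)
    then show "\<exists>i j. \<not> i \<approx> j \<and> g = F i j" if "g \<in> {F 1 2, F 1 3, F 4 5, F 2 3, F 2 4, F 3 4}" for g
      using that by blast
    fix i j assume ij: "1 \<le> i" "i < j" "j \<le> M"
    have "F 4 1 = F 4 5" by (rule periodic(5)[where r = 0 and r' = 0]; simp add: M)
    moreover have "i = 1 \<and> j = 2 \<or> i = 1 \<and> j = 3 \<or> i = 1 \<and> j = 4 \<or> i = 2 \<and> j = 3 \<or> i = 2 \<and> j = 4 \<or> i = 3 \<and> j = 4"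
      using ij M by linarith
    ultimately show "F (int i) (int j) \<in> {F 1 2, F 1 3, F 4 5, F 2 3, F 2 4, F 3 4}
        \<or> F (int j) (int i) \<in> {F 1 2, F 1 3, F 4 5, F 2 3, F 2 4, F 3 4}"
      by (elim disjE conjE) simp_all
  qed
qed

lemma genideal_relations5:
  assumes M: "M \<ge> 5" and q: "\<And>i. q i (i + 1) = \<alpha>"
    and q1: "\<And>i j. \<not> i \<approx> j \<Longrightarrow> \<not> i + 1 \<approx> j \<Longrightarrow> \<not> i - 1 \<approx> j \<Longrightarrow> q i j = 1"
    and lin: "\<And>i j. \<not> i \<approx> j \<Longrightarrow> lin i j = 0"
  shows "genideal (free_alg M) (relations5 M \<alpha>) = I"
proof -
  have adj: "\<not> n \<approx> n + 1" for n using M by (simp add: int_dvd_small)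
  have Fa: "F n (n + 1) = u n * u (n + 1) - cnst \<alpha> * (u (n + 1) * u n)" for n
    using lin[OF adj] by (simp add: F_def q)
  have Fn: "F n m = u n * u m - u m * u n" if "\<not> n \<approx> m" "\<not> n + 1 \<approx> m" "\<not> n - 1 \<approx> m" for n m
    using lin[OF that(1)] q1[OF that] by (simp add: F_def cnst_1)
  have shift: "n - m + 1 = n + 1 - m" "n - m - 1 = n - 1 - m" for n m :: int by simp_all
  have eq: "relations5 M \<alpha> = {F n (n + 1) | n. True} \<union>
      {F n m | n m. \<not> n \<approx> m \<and> \<not> n - 1 \<approx> m \<and> \<not> n + 1 \<approx> m}"
    unfolding relations5_def Let_def Fa shift mod_eq_0_iff_dvd
    by (intro arg_cong2[where f = "(\<union>)"] refl Collect_cong iff_exI) (use Fn in auto)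
  show ?thesis
    unfolding eq
  proof (rule genideal_eq_I)
    show "\<exists>i j. \<not> i \<approx> j \<and> g = F i j"
      if "g \<in> {F n (n + 1) | n. True} \<union> {F n m | n m. \<not> n \<approx> m \<and> \<not> n - 1 \<approx> m \<and> \<not> n + 1 \<approx> m}" for g
      using that adj by blast
    fix i j assume ij: "1 \<le> i" "i < j" "j \<le> M"
    then have ne: "\<not> int i \<approx> int j" by (simp add: eqv_ix ix_of_nat)
    have "F (int i) (int j) = F (int i) (int i + 1)" if "int i + 1 \<approx> int j"
      by (rule periodic(5)[where r = 0 and r' = 0]) (use that eqv_sym in simp_all)
    moreover have "F (int j) (int i) = F (int j) (int j + 1)" if "int i - 1 \<approx> int j"
    proof (rule periodic(5)[where r = 0 and r' = 0])
      show "int i \<approx> int j + 1" using that by (simp add: algebra_simps)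
    qed simp_all
    ultimately show "F (int i) (int j) \<in> {F n (n + 1) | n. True} \<union> {F n m | n m. \<not> n \<approx> m \<and> \<not> n - 1 \<approx> m \<and> \<not> n + 1 \<approx> m}
      \<or> F (int j) (int i) \<in> {F n (n + 1) | n. True} \<union> {F n m | n m. \<not> n \<approx> m \<and> \<not> n - 1 \<approx> m \<and> \<not> n + 1 \<approx> m}"
      using ne by blast
  qed
qed

end

section \<open>Constant terms from words of length one\<close>

context volterra_quantisation
begin

lemma q_adjacent_const:
  shows "q i (i + 1) = q 0 1"
proof -
  have Suc: "q (i + 1) (i + 2) = q i (i + 1)" for i
  proof (cases "M = 3")
    case True
    have "q (i + 2) (i + 3) = q (i + 3) (i + 1)" using q_adjacent_three[OF True, of "i + 1"] by (simp add: add.commute[of _ i])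
    moreover have "q (i + 2) (i + 3) = q (i + 2) i" "q (i + 3) (i + 1) = q i (i + 1)"
      by (rule periodic(1)[where r = 0 and r' = 0]; simp add: True)+
    ultimately show ?thesis using q_adjacent_three[OF True, of i] by simp
  next
    case False
    then show ?thesis using q_adjacent_Suc M3 by simp
  qed
  show ?thesis
    by (induction i rule: int_induct[where k = 0]) (use Suc[of "i - 1" for i] Suc in \<open>simp_all add: add.commute\<close>)
qed

lemma functional_cnst_mult:
  assumes "linear_fn f"
  shows "f (u x * cnst c) = c * f (u x)" "f (cnst c * p) = c * f p"
  using linear_fn_simps[OF assms] by (simp_all add: gen_cnst)

lemma three_constants_equal:
  assumes M: "M = 3"
  shows "e i (i + 1) = e 0 1"
proof -
  have sum3: "(\<Sum>r = 1..M. g (int r)) = g 1 + g 2 + g 3" for g :: "int \<Rightarrow> ncpoly"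
    by (simp add: M numeral_eq_Suc)
  have l: "lin i (i + 1) = cnst (s 0 1 0) * (u 1 + u 2 + u 3) + cnst (e i (i + 1))" for i
    using sum3[of "\<lambda>r. cnst (s 0 1 0) * u r"] unfolding lin_def three_coefficients_equal[OF M] by (simp add: distrib_left)
  have "e i (i + 1) = e (i + 1) (i + 2)" for i
  proof -
    obtain f where f: "linear_fn f" "\<And>p. p \<in> I \<Longrightarrow> f p = 0" "f 1 = 0"
      "\<And>x. f (u x) = (if x \<approx> i then 1 else 0)"
      using linear_functional by blast
    note lf = linear_fn_simps[OF f(1)]
    have "lin (i + 2) i = lin (i + 2) (i + 2 + 1)"
      by (rule periodic(4)[where r = 0 and r' = 0]; simp add: M)
    then have l2: "lin (i + 2) i = cnst (s 0 1 0) * (u 1 + u 2 + u 3) + cnst (e (i + 2) (i + 2 + 1))"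
      using l[of "i + 2"] by simp
    have l1: "lin (i + 1) (i + 2) = cnst (s 0 1 0) * (u 1 + u 2 + u 3) + cnst (e (i + 1) (i + 2))"
      using l[of "i + 1"] by (simp add: add.commute[of _ i])
    have u: "u 4 = u 1" "u 0 = u 3" by (rule gen_eq[OF M0]; simp add: M)+
    \<comment> \<open>The sum of all generators is a constant of the derivation, because its
      derivative telescopes around the cycle.\<close>
    have D: "D (lin i (i + 1)) = 0"
      using sum3[of "\<lambda>r. cnst (s 0 1 0) * (u (r + 1) * u r - u r * u (r - 1))"]
      unfolding D_lin three_coefficients_equal[OF M] by (simp add: u algebra_simps)
    have "cnst (e i (i + 1) - e (i + 2) (i + 2 + 1)) * u (i + 1) + cnst (e (i + 1) (i + 2) - e i (i + 1)) * u i \<in> I"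
      using three_rest[OF M, of i, unfolded D, unfolded l l1 l2] by (simp add: nc_simps cnst_hom algebra_simps)
    then show ?thesis
      using f(2) M3 by (fastforce simp: lf f(4) int_dvd_small)
  qed
  then have Suc: "e (i + 1) (i + 2) = e i (i + 1)" for i by simp
  show ?thesis
    by (induction i rule: int_induct[where k = 0]) (use Suc[of "i - 1" for i] Suc in \<open>simp_all add: add.commute\<close>)
qed

lemma four_inhomogeneous_parts:
  assumes M: "M = 4"
  defines "b \<equiv> \<lambda>n. s n (n + 1) n"
  shows "b (i + 2) = b i"
    "lin i (i + 1) = cnst (b i) * u i + cnst (b (i + 1)) * u (i + 1) - cnst (b i * b (i + 1))"
    "lin i (i + 2) = cnst (b (i + 1)) * (u (i + 3) - u (i + 1))"
proof -
  have M4: "M \<ge> 4" using M by simp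
  note a = adjacent_s[OF M4]
  have bn: "s n (n + 1) n = b n" for n by (simp add: b_def)
  have Suc: "s i (i + 1) (i + 1) = b (i + 1)" for i
    using adjacent_s_Suc[OF M4, of i] by (simp add: b_def add.commute[of _ i])
  have cases: "r \<approx> i \<or> r \<approx> i + 1 \<or> r \<approx> i + 2 \<or> r \<approx> i - 1" for r i unfolding M by presburger
  have ne: "\<not> i \<approx> i + 1" "\<not> i + 1 \<approx> i" "\<not> i \<approx> i + 2" "\<not> i + 2 \<approx> i" "\<not> i - 1 \<approx> i" "\<not> i - 1 \<approx> i + 1"
     "\<not> i + 2 \<approx> i + 1" "\<not> i \<approx> i + 3" "\<not> i + 1 \<approx> i + 3" "\<not> i + 2 \<approx> i + 3" "\<not> i + 3 \<approx> i + 1" "\<not> i + 3 \<approx> i + 2" "\<not> i + 3 \<approx> i" for i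
    using M4 by (simp_all add: int_dvd_small)
  have s1: "s i (i + 1) r = (if r \<approx> i then b i else 0) + (if r \<approx> i + 1 then b (i + 1) else 0)" for i r
  proof -
    obtain r' where r': "r' \<in> {i, i + 1, i + 2, i - 1}" "r \<approx> r'" using cases[of r i] by blast
    then have "s i (i + 1) r' = (if r' \<approx> i then b i else 0) + (if r' \<approx> i + 1 then b (i + 1) else 0)"
      using a(1,2)[of i] Suc[of i] ne[of i] bn[of i] r'(1) by auto
    then show ?thesis
      using r'(2) periodic(2)[of i i j j r r' for j] by (simp add: eqv_ix)
  qed
  have s2: "s i (i + 2) r = (if r \<approx> i + 3 then b (i + 1) else 0) + (if r \<approx> i + 1 then - b (i + 1) else 0)" for i r
  proof -
    obtain r' where r': "r' \<in> {i, i + 1, i + 2, i - 1}" "r \<approx> r'" using cases[of r i] by blast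
    have "s i (i + 2) i = 0" using a(6)[of "i + 1"] by (simp add: add.commute[of _ i])
    moreover have "i - 1 \<approx> i + 3" by (simp add: M)
    ultimately have "s i (i + 2) r' = (if r' \<approx> i + 3 then b (i + 1) else 0) + (if r' \<approx> i + 1 then - b (i + 1) else 0)"
      using r'(1) a(3,5,7)[of i] Suc[of i] ne[of i] by auto
    then show ?thesis
      using r'(2) periodic(2)[of i i j j r r' for j] by (simp add: eqv_ix)
  qed
  \<comment> \<open>The pair of \<open>i - 1\<close> and \<open>i + 1\<close> is also the pair of
    \<open>i + 1\<close> and \<open>i + 3\<close> read backwards. As \<open>q\<close> is 1, this
    only changes the sign, and comparing both descriptions gives period two.\<close>
  have b2: "b (i + 2) = b i" for i
  proof -
    have "s (i + 1) (i - 1) i = - s (i - 1) (i + 1) i"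
      using s_swap[of "i - 1" "i + 1" i] q_nonadjacent[OF M4, of "i - 1" "i + 1"] M4 by (simp add: int_dvd_small)
    moreover have "s (i + 1) (i - 1) i = s (i + 1) (i + 1 + 2) i"
      by (rule periodic(2); simp add: M)
    moreover have "s (i + 1) (i + 1 + 2) i = s (i + 1) (i + 2) (i + 2)"
      using a(7)[of "i + 1"] by (simp add: add.commute[of _ i])
    ultimately show ?thesis
      using a(4)[of i] Suc[of "i + 1"] by (simp add: b_def add.commute[of _ i])
  qed
  then show "b (i + 2) = b i" .
  have l1: "lin i (i + 1) = cnst (b i) * u i + cnst (b (i + 1)) * u (i + 1) + cnst (e i (i + 1))" for i
    by (rule lin_two_terms[OF s1])
  have l2: "lin i (i + 2) = cnst (b (i + 1)) * u (i + 3) + cnst (- b (i + 1)) * u (i + 1) + cnst (e i (i + 2))" for i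
    by (rule lin_two_terms[OF s2])
  have um: "u (i - 1) = u (i + 3)" "u (i + 4) = u i" for i by (rule gen_eq[OF M0]; simp add: M)+
  have lm: "lin (i - 1) (i + 1) = cnst (b i) * u (i + 2) + cnst (- b i) * u i + cnst (e (i - 1) (i + 1))" for i
    using l2[of "i - 1"] by (simp add: add.commute[of _ i])
  have lp: "lin (i + 1) (i + 3) = cnst (b i) * u i + cnst (- b i) * u (i + 2) + cnst (e (i + 1) (i + 3))" for i
    using l2[of "i + 1"] b2[of i] um(2)[of i] by (simp add: add.commute[of _ i])
  have D: "D (lin i (i + 1)) = cnst (b i) * (u (i + 1) * u i - u i * u (i + 3))
      + cnst (b (i + 1)) * (u (i + 2) * u (i + 1) - u (i + 1) * u i)" for i
    unfolding l1 using D_rules(5)[of i] D_rules(5)[of "i + 1"]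
    by (simp add: D_rules(2,3) D_cnst free_alg_closed gen_closed M0 um add.commute[of _ i])
  have e12: "e i (i + 1) = - (b i * b (i + 1)) \<and> e i (i + 2) = 0" for i
  proof -
    \<comment> \<open>This is the coefficient of \<open>u k\<close> in \<open>adjacent_rest\<close>.
      The quadratic words left over form commutators of opposite generators; \<open>c1\<close> and
      \<open>c2\<close> turn these into linear terms, which is where the products of the
      \<open>b\<close> come from.\<close>
    have eqn: "(if i + 1 \<approx> k then e i (i + 1) + b i * b (i + 1) + e i (i + 2) else 0)
       + (if i + 2 \<approx> k then e i (i + 1) + b i * b (i + 1) else 0) = 0" if k: "\<not> i \<approx> k" "\<not> i + 3 \<approx> k" for k
    proof -
      obtain f where f: "linear_fn f" "\<And>p. p \<in> I \<Longrightarrow> f p = 0" "f 1 = 0"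
        "\<And>x. f (u x) = (if x \<approx> k then 1 else 0)"
        using linear_functional by blast
      note lf = linear_fn_simps[OF f(1)] functional_cnst_mult[OF f(1)]
      have f0: "f (cnst c) = 0" for c using lf(2)[of c 1] f(3) by simp
      have c1: "f (u i * u (i + 2)) = f (u (i + 2) * u i) + f (lin i (i + 2))"
        using functional_swap(1)[OF f(1,2) ne(3)[of i] free_alg_closed(1)] q_nonadjacent[OF M4, of "i + 2" i] M4
        by (simp add: int_dvd_small)
      have c2: "f (u (i + 1) * u (i + 3)) = f (u (i + 3) * u (i + 1)) + f (lin (i + 1) (i + 3))"
        using functional_swap(1)[OF f(1,2) ne(9)[of i] free_alg_closed(1)] q_nonadjacent[OF M4, of "i + 3" "i + 1"] M4
        by (simp add: int_dvd_small)
      show ?thesis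
        using k f(2)[OF adjacent_rest[OF M4, of i, unfolded D, unfolded l1 l2 lm um]]
        by (simp add: nc_simps lf c1 c2 l2 lp f(4) f0 cnst_hom split: if_splits) (simp_all add: algebra_simps)
    qed
    show ?thesis using eqn[of "i + 1"] eqn[of "i + 2"] ne[of i] by (simp add: add_eq_0_iff)
  qed
  show "lin i (i + 1) = cnst (b i) * u i + cnst (b (i + 1)) * u (i + 1) - cnst (b i * b (i + 1))"
    using l1[of i] e12[of i] by (simp add: cnst_hom)
  show "lin i (i + 2) = cnst (b (i + 1)) * (u (i + 3) - u (i + 1))"
    using l2[of i] e12[of i] by (simp add: cnst_hom right_diff_distrib)
qed

text \<open>The inhomogeneous parts are already constant, so their derivatives vanish and each
  remainder is linear. The coefficient of \<open>u (i + 2)\<close> isolates the constant of an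
  adjacent pair, after which \<open>u (i + 1)\<close> isolates the one at distance two; for far
  pairs \<open>u (i + 1)\<close> does so directly.\<close>

lemma inhomogeneous_part_vanishes:
  assumes M5: "M \<ge> 5" and ij: "\<not> i \<approx> j"
  shows "lin i j = 0"
proof -
  have M4: "M \<ge> 4" using M5 by simp
  have c: "lin i j = cnst (e i j)" if "\<not> i \<approx> j" for i j
    using coefficients_vanish[OF M5 that] by (simp add: lin_def cnst_hom)
  have adj: "\<not> i \<approx> i + 1" "\<not> i - 1 \<approx> i + 1" "\<not> i \<approx> i + 2" for i
    using M5 by (simp_all add: int_dvd_small)
  have e1: "e i (i + 1) = 0" for i
  proof -
    obtain f where f: "linear_fn f" "\<And>p. p \<in> I \<Longrightarrow> f p = 0" "f 1 = 0"
      "\<And>x. f (u x) = (if x \<approx> i + 2 then 1 else 0)"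
      using linear_functional by blast
    show ?thesis
      using f(2)[OF adjacent_rest[OF M4, of i]] M5
      by (simp add: c[OF adj(1)] c[OF adj(2)] c[OF adj(3)] D_cnst linear_fn_simps[OF f(1)]
          functional_cnst_mult[OF f(1)] f(4) int_dvd_small)
  qed
  have e2: "e i (i + 2) = 0" for i
  proof -
    obtain f where f: "linear_fn f" "\<And>p. p \<in> I \<Longrightarrow> f p = 0" "f 1 = 0"
      "\<And>x. f (u x) = (if x \<approx> i + 1 then 1 else 0)"
      using linear_functional by blast
    show ?thesis
      using f(2)[OF adjacent_rest[OF M4, of i]] M5
      by (simp add: c[OF adj(1)] c[OF adj(2)] c[OF adj(3)] D_cnst linear_fn_simps[OF f(1)]
          functional_cnst_mult[OF f(1)] f(4) int_dvd_small e1)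
  qed
  have e3: "e i j = 0" if "far i j" for i j
  proof -
    obtain f where f: "linear_fn f" "\<And>p. p \<in> I \<Longrightarrow> f p = 0" "f 1 = 0"
      "\<And>x. f (u x) = (if x \<approx> i + 1 then 1 else 0)"
      using linear_functional by blast
    show ?thesis
      using f(2)[OF distant_rest[OF M5, of i j]] M5 that far_neq[OF that]
      by (simp add: c D_cnst linear_fn_simps[OF f(1)]
          functional_cnst_mult[OF f(1)] f(4) int_dvd_small far_def)
  qed
  have "e i (i + 1) = 0" "e i (i + 2) = 0" using e1 e2 by simp_all
  moreover have "e i (i - 1) = 0" "e i (i - 2) = 0"
    using e1[of "i - 1"] e2[of "i - 2"] e_swap[of "i - 1" i] e_swap[of "i - 2" i] M5
    by (simp_all add: int_dvd_small)
  ultimately have "e i j = 0"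
    using e3[of i j] ij periodic(3)[of i i "i + 1" j 0 0] periodic(3)[of i i "i + 2" j 0 0]
      periodic(3)[of i i "i - 1" j 0 0] periodic(3)[of i i "i - 2" j 0 0]
    by (auto simp: far_def)
  then show ?thesis using c[OF ij] by (simp add: cnst_hom)
qed

lemma quantisation_relations:
  "\<exists>\<alpha> \<beta> \<gamma> \<eta>'. \<alpha> \<noteq> 0 \<and> genideal (free_alg M) (volterra_relations M \<alpha> \<beta> \<gamma> \<eta>') = I"
proof -
  have nz: "q 0 1 \<noteq> 0" using M3 by (intro q_nz) (simp add: int_dvd_small)
  consider "M = 3" | "M = 4" | "M \<ge> 5" using M3 by linarith
  then show ?thesis
  proof cases
    case 1
    have "genideal (free_alg M) (relations3 (q 0 1) (s 0 1 0) (e 0 1)) = I"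
      using 1 by (intro genideal_relations3 q_adjacent_const three_coefficients_equal three_constants_equal)
    then show ?thesis using nz 1 unfolding volterra_relations_def by auto
  next
    case 2
    then have M4: "M \<ge> 4" by simp
    have "genideal (free_alg M) (relations4 (q 0 1) (s 0 (0 + 1) 0) (s 1 (1 + 1) 1)) = I"
      using four_inhomogeneous_parts[OF 2] M4
      by (intro genideal_relations4[where b = "\<lambda>n. s n (n + 1) n"] 2 q_adjacent_const q_nonadjacent)
        (simp_all add: int_dvd_small)
    then show ?thesis using nz 2 unfolding volterra_relations_def by auto
  next
    case 3
    then have M4: "M \<ge> 4" by simp
    have "genideal (free_alg M) (relations5 M (q 0 1)) = I"
    proof (rule genideal_relations5[OF 3 q_adjacent_const _ inhomogeneous_part_vanishes[OF 3]])
      fix i j assume "\<not> i \<approx> j" "\<not> i + 1 \<approx> j" "\<not> i - 1 \<approx> j"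
      then have "\<not> j \<approx> i" "\<not> j \<approx> i + 1" "\<not> j \<approx> i - 1" using eqv_sym by blast+
      then show "q i j = 1" by (rule q_nonadjacent[OF M4])
    qed
    then show ?thesis using nz 3 unfolding volterra_relations_def by auto
  qed
qed

end

section \<open>The diamond lemma\<close>

definition subspace :: "ncpoly set \<Rightarrow> bool" where
  "subspace S \<longleftrightarrow> 0 \<in> S \<and> (\<forall>p\<in>S. \<forall>r\<in>S. p + r \<in> S) \<and> (\<forall>c. \<forall>p\<in>S. cnst c * p \<in> S)"

lemma subspace_closed:
  assumes "subspace S"
  shows "0 \<in> S" "p \<in> S \<Longrightarrow> r \<in> S \<Longrightarrow> p + r \<in> S" "p \<in> S \<Longrightarrow> cnst c * p \<in> S" "p \<in> S \<Longrightarrow> - p \<in> S"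
    "p \<in> S \<Longrightarrow> r \<in> S \<Longrightarrow> p - r \<in> S" "(\<And>x. x \<in> A \<Longrightarrow> f x \<in> S) \<Longrightarrow> sum f A \<in> S"
proof -
  show z: "0 \<in> S" and a: "\<And>p r. p \<in> S \<Longrightarrow> r \<in> S \<Longrightarrow> p + r \<in> S" and c: "\<And>p c. p \<in> S \<Longrightarrow> cnst c * p \<in> S"
    using assms by (simp_all add: subspace_def)
  show n: "\<And>p. p \<in> S \<Longrightarrow> - p \<in> S" using c[of _ "-1"] by (simp add: cnst_hom cnst_1)
  show "p \<in> S \<Longrightarrow> r \<in> S \<Longrightarrow> p - r \<in> S" using a[of p "- r"] n[of r] by simp
  show "(\<And>x. x \<in> A \<Longrightarrow> f x \<in> S) \<Longrightarrow> sum f A \<in> S"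
    by (induction A rule: infinite_finite_induct) (simp_all add: z a)
qed

text \<open>As an intersection, the span is contained in any set once that set is recognised as a
  subspace containing the generators. Finite combinations appear only in
  \<open>normal_words_independent\<close>, where coefficients have to be compared.\<close>

definition lspan :: "ncpoly set \<Rightarrow> ncpoly set" where
  "lspan S = \<Inter>{T. subspace T \<and> S \<subseteq> T}"

lemma subspace_lspan: "subspace (lspan S)"
  unfolding lspan_def subspace_def by auto

lemma lspan_base: "p \<in> S \<Longrightarrow> p \<in> lspan S"
  by (auto simp: lspan_def)

lemma lspan_minimal: "subspace T \<Longrightarrow> S \<subseteq> T \<Longrightarrow> lspan S \<subseteq> T"
  by (auto simp: lspan_def)

lemma lspan_mono: "S \<subseteq> T \<Longrightarrow> lspan S \<subseteq> lspan T"
  by (auto simp: lspan_def)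

lemma subspace_preimage:
  assumes "subspace S"
  shows "subspace {p. a * p * b \<in> S}"
  using subspace_closed[OF assms]
  by (simp add: subspace_def distrib_left distrib_right mult.assoc mult_cnst)

text \<open>Exchanging an increasing pair of adjacent letters lowers the weight of a word.\<close>

primrec weight :: "nat \<Rightarrow> nat list \<Rightarrow> nat" where
  "weight k [] = 0"
| "weight k (a # w) = k * a + weight (Suc k) w"

lemma weight_append: "weight k (v @ w) = weight k v + weight (k + length v) w"
  by (induction v arbitrary: k) simp_all

text \<open>Length comes first because the inhomogeneous part of a relation shortens a word; the
  weight decides for the exchanged word, which has the same length.\<close>

definition word_order :: "(nat list \<times> nat list) set" where
  "word_order = inv_image (less_than <*lex*> less_than) (\<lambda>w. (length w, weight 0 w))"

lemma word_order_iff: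
  "(v, w) \<in> word_order \<longleftrightarrow> length v < length w \<or> length v = length w \<and> weight 0 v < weight 0 w"
  by (simp add: word_order_def)

lemma wf_word_order: "wf word_order"
  by (simp add: word_order_def wf_lex_prod)

lemma word_order_swap: "i < j \<Longrightarrow> (x @ j # i # y, x @ i # j # y) \<in> word_order"
  by (simp add: word_order_iff weight_append)

lemma word_order_trans: "(u, v) \<in> word_order \<Longrightarrow> (v, w) \<in> word_order \<Longrightarrow> (u, w) \<in> word_order"
  by (auto simp: word_order_iff)

lemma not_sorted_descent:
  fixes w :: "nat list"
  assumes "\<not> sorted_wrt (\<ge>) w"
  obtains x i j y where "w = x @ i # j # y" "i < j"
proof -
  obtain n where n: "Suc n < length w" "w ! n < w ! Suc n"
    using assms sorted_wrt_iff_nth_Suc_transp[of "(\<ge>)" w] by (auto simp: transp_on_def not_le)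
  have "w = take n w @ w ! n # w ! Suc n # drop (Suc (Suc n)) w"
    using n(1) by (metis Cons_nth_drop_Suc Suc_lessD append_take_drop_id)
  then show thesis using that n(2) by blast
qed

section \<open>Rewriting, overlaps and independence\<close>

context comm_relations
begin

abbreviation letters :: "nat list \<Rightarrow> bool" where "letters w \<equiv> set w \<subseteq> {1..M}"

definition rel :: "nat list \<Rightarrow> nat \<Rightarrow> nat \<Rightarrow> nat list \<Rightarrow> ncpoly" where
  "rel x i j y = mono_word x * F (int i) (int j) * mono_word y"

definition reducible :: "nat list \<Rightarrow> bool" where
  "reducible w \<longleftrightarrow> letters w \<and> \<not> sorted_wrt (\<ge>) w"

lemma letter_gen: "i \<in> {1..M} \<Longrightarrow> u (int i) = mono_word [i]"
  by (simp add: gen_ix ix_of_nat)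

lemma subspace_lin:
  assumes S: "subspace S" and r: "\<And>r. r \<in> {1..M} \<Longrightarrow> a * mono_word [r] * b \<in> S" and e: "a * b \<in> S"
  shows "a * lin i j * b \<in> S"
proof -
  have 1: "a * (cnst c * u (int r)) * b \<in> S" if "r \<in> {1..M}" for r c
    using subspace_closed(3)[OF S r[OF that], of c] by (simp add: letter_gen[OF that] mult_cnst mult.assoc)
  have 2: "a * cnst c * b \<in> S" for c
    using subspace_closed(3)[OF S e, of c] by (simp add: cnst_comm mult.assoc mult_cnst[of a c b, symmetric])
  show ?thesis
    unfolding lin_def distrib_left distrib_right sum_distrib_left sum_distrib_right
    by (intro subspace_closed(2,6)[OF S] 1 2)
qed

definition reduct :: "nat \<Rightarrow> nat \<Rightarrow> ncpoly" where
  "reduct i j = cnst (q (int i) (int j)) * mono_word [j, i] + lin (int i) (int j)"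

lemma F_reduct: "i \<in> {1..M} \<Longrightarrow> j \<in> {1..M} \<Longrightarrow> F (int i) (int j) = mono_word [i, j] - reduct i j"
  by (simp add: F_def reduct_def letter_gen mono_word_Cons[of _ "[_]"] diff_diff_eq)

text \<open>Only the exchanged word, the single letters and the empty word occur in a reduct. The
  lemma is applied to normal forms, to spans of smaller relations and to bounds on leading
  words.\<close>

lemma subspace_reduct:
  assumes S: "subspace S" and ji: "a * mono_word [j, i] * b \<in> S"
    and r: "\<And>r. r \<in> {1..M} \<Longrightarrow> a * mono_word [r] * b \<in> S" and e: "a * b \<in> S"
  shows "a * reduct i j * b \<in> S"
proof -
  have "a * (cnst c * mono_word [j, i]) * b \<in> S" for c
    using subspace_closed(3)[OF S ji, of c] by (simp add: mult_cnst mult.assoc)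
  then show ?thesis
    unfolding reduct_def distrib_left distrib_right
    by (intro subspace_closed(2)[OF S] subspace_lin[OF S] r e)
qed

lemma rel_in_I:
  assumes "letters (x @ y)" "i \<in> {1..M}" "j \<in> {1..M}" "i < j"
  shows "rel x i j y \<in> I"
proof -
  have "\<not> int i \<approx> int j" using assms by (simp add: eqv_ix ix_of_nat)
  then show ?thesis
    unfolding rel_def using assms by (intro I_lmult I_rmult F_in_I free_alg_closed) auto
qed

text \<open>Replacing an ascent by its reduct changes a word only by an element of the ideal and
  leads to smaller words, so well-founded induction applies.\<close>

lemma normal_words_span:
  assumes p: "p \<in> carrier (free_alg M)"
  shows "\<exists>r. Poly_Mapping.keys r \<subseteq> normal_words M \<and> p - r \<in> I"
proof -
  let ?N = "{p. \<exists>r. Poly_Mapping.keys r \<subseteq> normal_words M \<and> p - r \<in> I}"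
  have N: "subspace ?N"
    unfolding subspace_def
  proof (intro conjI ballI allI)
    show "0 \<in> ?N" by (intro CollectI exI[of _ 0]) (simp add: I_0)
  next
    fix p p' assume "p \<in> ?N" "p' \<in> ?N"
    then obtain r r' where "Poly_Mapping.keys r \<subseteq> normal_words M" "p - r \<in> I"
       "Poly_Mapping.keys r' \<subseteq> normal_words M" "p' - r' \<in> I" by blast
    then show "p + p' \<in> ?N"
      using Poly_Mapping.keys_add[of r r'] I_add[of "p - r" "p' - r'"]
      by (intro CollectI exI[of _ "r + r'"]) (auto simp: add_diff_add)
  next
    fix c p assume "p \<in> ?N"
    then obtain r where r: "Poly_Mapping.keys r \<subseteq> normal_words M" "p - r \<in> I" by blast
    have "Poly_Mapping.keys (cnst c * r) \<subseteq> Poly_Mapping.keys r"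
      by (auto simp: in_keys_iff lookup_cnst_mult)
    then show "cnst c * p \<in> ?N"
      using r I_cnst[OF r(2), of c]
      by (intro CollectI exI[of _ "cnst c * r"]) (auto simp: right_diff_distrib)
  qed
  have w: "letters w \<Longrightarrow> mono_word w \<in> ?N" for w
  proof (induction w rule: wf_induct_rule[OF wf_word_order])
    case (1 w)
    show ?case
    proof (cases "sorted_wrt (\<ge>) w")
      case True
      then show ?thesis
        using 1(2) by (intro CollectI exI[of _ "mono_word w"]) (simp add: I_0 mono_word_def normal_words_def)
    next
      case False
      then obtain x i j y where w: "w = x @ i # j # y" and ij: "i < j" by (rule not_sorted_descent)
      have l: "letters x" "letters y" "i \<in> {1..M}" "j \<in> {1..M}" using 1(2) w by auto
      have less: "mono_word x * mono_word v * mono_word y \<in> ?N"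
        if "(x @ v @ y, w) \<in> word_order" "letters v" for v
        using 1(1)[OF that(1)] that(2) l by (simp add: mono_word_append mult.assoc)
      have red: "mono_word x * reduct i j * mono_word y \<in> ?N"
      proof (rule subspace_reduct[OF N])
        show "mono_word x * mono_word [j, i] * mono_word y \<in> ?N"
          using less[of "[j, i]"] word_order_swap[OF ij] l w by simp
        show "mono_word x * mono_word [r] * mono_word y \<in> ?N" if "r \<in> {1..M}" for r
          using less[of "[r]"] that w by (simp add: word_order_iff)
        show "mono_word x * mono_word y \<in> ?N"
          using less[of "[]"] w by (simp add: word_order_iff mono_word_Nil)
      qed
      have rel: "rel x i j y \<in> ?N"
        using rel_in_I[of x y i j] l ij by (intro CollectI exI[of _ 0]) simp
      have "mono_word w = rel x i j y + mono_word x * reduct i j * mono_word y"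
        unfolding rel_def F_reduct[OF l(3,4)] w using mono_word_append[of x "[i, j] @ y"] mono_word_append[of "[i, j]" y]
        by (simp add: left_diff_distrib right_diff_distrib mult.assoc)
      then show ?thesis using subspace_closed(2)[OF N rel red] by simp
    qed
  qed
  have "(\<Sum>w\<in>Poly_Mapping.keys p. cnst (Poly_Mapping.lookup p w) * mono_word w) \<in> ?N"
    using p by (intro subspace_closed(3,6)[OF N] w) (simp add: carrier_free_alg)
  then have "p \<in> ?N" unfolding ncpoly_expand[of p, symmetric] .
  then show ?thesis by simp
qed

text \<open>The choice among the ascents of a word is arbitrary; \<open>rel_selected\<close> shows
  that another choice differs only by relations of smaller words.\<close>

definition selected :: "nat list \<Rightarrow> ncpoly" where
  "selected w = (SOME p. \<exists>x i j y. w = x @ i # j # y \<and> i < j \<and> p = rel x i j y)"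

lemma selected:
  assumes "reducible w"
  obtains x i j y where "w = x @ i # j # y" "i < j" "selected w = rel x i j y"
proof -
  have "\<not> sorted_wrt (\<ge>) w" using assms by (simp add: reducible_def)
  then obtain x i j y where "w = x @ i # j # y" "i < j" by (rule not_sorted_descent)
  then have "\<exists>p x i j y. w = x @ i # j # y \<and> i < j \<and> p = rel x i j y"
    by (intro exI[of _ "rel x i j y"] exI conjI) simp_all
  then have "\<exists>x i j y. w = x @ i # j # y \<and> i < j \<and> selected w = rel x i j y"
    unfolding selected_def by (rule someI_ex)
  then show thesis by (elim exE conjE) (rule that)
qed

definition below :: "nat list \<Rightarrow> ncpoly set" where
  "below w = lspan {selected v | v. reducible v \<and> (v, w) \<in> word_order}"

text \<open>The difference of the lower-order terms that arise when \<open>u\<^sub>i u\<^sub>j u\<^sub>k\<close> is sorted in two ways,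
  starting with its left or with its right factors.\<close>

definition obstruction :: "int \<Rightarrow> int \<Rightarrow> int \<Rightarrow> ncpoly" where
  "obstruction i j k = lin i j * u k + cnst (q i j) * (u j * lin i k) + cnst (q i j * q i k) * (lin j k * u i)
     - u i * lin j k - cnst (q j k) * (lin i k * u j) - cnst (q j k * q i k) * (u k * lin i j)"

text \<open>Both ways of sorting \<open>u i * u j * u k\<close> take three exchanges and end in
  \<open>u k * u j * u i\<close> with the same factor \<open>q i j * q i k * q j k\<close>, so the
  cubic words cancel and only the inhomogeneous parts remain.\<close>

lemma overlap_identity:
  "F i j * u k - u i * F j k
     = cnst (q j k) * (F i k * u j) + cnst (q j k * q i k) * (u k * F i j)
       - cnst (q i j) * (u j * F i k) - cnst (q i j * q i k) * (F j k * u i) - obstruction i j k"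
  unfolding obstruction_def F_def
  by (simp add: nc_simps cnst_merge mult.commute mult.left_commute)

lemma subspace_below: "subspace (below w)"
  by (simp add: below_def subspace_lspan)

lemma below_mono: "(v, w) \<in> word_order \<Longrightarrow> below v \<subseteq> below w"
  unfolding below_def by (intro lspan_mono) (use word_order_trans in blast)

text \<open>The linear span of the bare relations is enough room, since obstructions have degree at
  most two. It also gives the needed bound: a relation of length two, put into the context of an
  overlap of length three, belongs to a smaller word.\<close>

definition obstructions_resolve :: bool where
  "obstructions_resolve \<longleftrightarrow> (\<forall>i j k. 1 \<le> i \<longrightarrow> i < j \<longrightarrow> j < k \<longrightarrow> k \<le> M \<longrightarrow>
     obstruction (int i) (int j) (int k) \<in> lspan {F (int a) (int b) | a b. 1 \<le> a \<and> a < b \<and> b \<le> M})"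

text \<open>It suffices to compare two ascents of the same word. Disjoint ascents commute, and for
  overlapping ones the resolved obstruction expresses the difference by relations of smaller words,
  which the induction hypothesis replaces by selected ones.\<close>

lemma rel_selected:
  assumes res: obstructions_resolve
  shows "letters w \<Longrightarrow> w = x @ i # j # y \<Longrightarrow> i < j \<Longrightarrow> rel x i j y - selected w \<in> below w"
proof (induction w arbitrary: x i j y rule: wf_induct_rule[OF wf_word_order])
  case (1 w)
  note B = subspace_below[of w]
  have smaller: "mono_word a * (F (int k) (int l)) * mono_word b \<in> below w"
    if "(a @ k # l # b, w) \<in> word_order" "letters (a @ k # l # b)" "k < l" for a k l b
  proof -
    let ?v = "a @ k # l # b"
    have "reducible ?v" using that by (auto simp: reducible_def sorted_wrt_append)
    then have "selected ?v \<in> below w"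
      unfolding below_def using that by (intro lspan_base) blast
    moreover have "rel a k l b - selected ?v \<in> below w"
      using 1(1)[OF that(1,2) refl that(3)] below_mono[OF that(1)] by blast
    ultimately show ?thesis
      using subspace_closed(2)[OF B, of "selected ?v" "rel a k l b - selected ?v"] by (simp add: rel_def)
  qed
  \<comment> \<open>Expanding the product of the two relations in either factor shows that their
    difference consists of terms with one relation and the reduct of the other.\<close>
  have far: "rel x i j (y @ k # l # z) - rel (x @ i # j # y) k l z \<in> below w"
    if w: "w = x @ i # j # y @ k # l # z" and ij: "i < j" and kl: "k < l" for x i j y k l z
  proof -
    have l: "letters x" "letters y" "letters z" "i \<in> {1..M}" "j \<in> {1..M}" "k \<in> {1..M}" "l \<in> {1..M}"
      using 1(2) w by auto
    let ?x = "mono_word x" and ?y = "mono_word y" and ?z = "mono_word z"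
    have left: "?x * reduct i j * (?y * F (int k) (int l) * ?z) \<in> below w"
    proof -
      have *: "?x * mono_word v * (?y * F (int k) (int l) * ?z) \<in> below w"
        if "(x @ v @ y @ k # l # z, w) \<in> word_order" "letters v" for v
        using smaller[of "x @ v @ y" k l z] that l kl by (simp add: mono_word_append mult.assoc)
      show ?thesis
      proof (rule subspace_reduct[OF B])
        show "?x * mono_word [j, i] * (?y * F (int k) (int l) * ?z) \<in> below w"
          using *[of "[j, i]"] word_order_swap[OF ij] l w by simp
        show "?x * mono_word [r] * (?y * F (int k) (int l) * ?z) \<in> below w" if "r \<in> {1..M}" for r
          using *[of "[r]"] that w by (simp add: word_order_iff)
        show "?x * (?y * F (int k) (int l) * ?z) \<in> below w"
          using *[of "[]"] w by (simp add: word_order_iff mono_word_Nil)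
      qed
    qed
    have right: "(?x * F (int i) (int j) * ?y) * reduct k l * ?z \<in> below w"
    proof -
      have *: "(?x * F (int i) (int j) * ?y) * mono_word v * ?z \<in> below w"
        if "(x @ i # j # y @ v @ z, w) \<in> word_order" "letters v" for v
        using smaller[of x i j "y @ v @ z"] that l ij by (simp add: mono_word_append mult.assoc)
      show ?thesis
      proof (rule subspace_reduct[OF B])
        show "(?x * F (int i) (int j) * ?y) * mono_word [l, k] * ?z \<in> below w"
          using *[of "[l, k]"] word_order_swap[OF kl, of "x @ i # j # y"] l w by simp
        show "(?x * F (int i) (int j) * ?y) * mono_word [r] * ?z \<in> below w" if "r \<in> {1..M}" for r
          using *[of "[r]"] that w by (simp add: word_order_iff)
        show "(?x * F (int i) (int j) * ?y) * ?z \<in> below w"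
          using *[of "[]"] w by (simp add: word_order_iff mono_word_Nil)
      qed
    qed
    have m: "mono_word (y @ k # l # z) = ?y * (mono_word [k, l] * ?z)"
      "mono_word (x @ i # j # y) = ?x * (mono_word [i, j] * ?y)"
      by (simp_all flip: mono_word_append)
    have "rel x i j (y @ k # l # z) - rel (x @ i # j # y) k l z
       = (?x * F (int i) (int j) * ?y) * reduct k l * ?z - ?x * reduct i j * (?y * F (int k) (int l) * ?z)"
      unfolding rel_def m F_reduct[OF l(4,5)] F_reduct[OF l(6,7)]
      by (simp add: distrib_left distrib_right left_diff_distrib right_diff_distrib mult.assoc)
    then show ?thesis using subspace_closed(5)[OF B right left] by simp
  qed
  have overlap: "rel x i j (k # y) - rel (x @ [i]) j k y \<in> below w"
    if w: "w = x @ i # j # k # y" and ij: "i < j" and jk: "j < k" for x i j k y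
  proof -
    have l: "letters x" "letters y" "i \<in> {1..M}" "j \<in> {1..M}" "k \<in> {1..M}"
      using 1(2) w by auto
    let ?x = "mono_word x" and ?y = "mono_word y"
    have ik: "i < k" using ij jk by simp
    have o1: "(x @ j # i # k # y, w) \<in> word_order" "(x @ i # k # j # y, w) \<in> word_order"
      using word_order_swap[OF ij, of x "k # y"] word_order_swap[OF jk, of "x @ [i]" y] w by simp_all
    have o2: "(x @ j # k # i # y, w) \<in> word_order" "(x @ k # i # j # y, w) \<in> word_order"
      using word_order_trans[OF _ o1(1), of "x @ j # k # i # y"] word_order_swap[OF ik, of "x @ [j]" y]
        word_order_trans[OF _ o1(2), of "x @ k # i # j # y"] word_order_swap[OF ik, of x "j # y"] by simp_all
    have t1: "?x * (F (int i) (int k) * u (int j)) * ?y \<in> below w"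
      using smaller[of x i k "j # y"] o1 ik l by (simp add: letter_gen mono_word_Cons[of j y] mult.assoc)
    have t2: "?x * (u (int k) * F (int i) (int j)) * ?y \<in> below w"
      using smaller[of "x @ [k]" i j y] o2 ij l by (simp add: letter_gen mono_word_append mult.assoc)
    have t3: "?x * (u (int j) * F (int i) (int k)) * ?y \<in> below w"
      using smaller[of "x @ [j]" i k y] o1 ik l by (simp add: letter_gen mono_word_append mult.assoc)
    have t4: "?x * (F (int j) (int k) * u (int i)) * ?y \<in> below w"
      using smaller[of x j k "i # y"] o2 jk l by (simp add: letter_gen mono_word_Cons[of i y] mult.assoc)
    have "{F (int a) (int b) | a b. 1 \<le> a \<and> a < b \<and> b \<le> M} \<subseteq> {p. ?x * p * ?y \<in> below w}"
      using smaller l w by (auto simp: word_order_iff)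
    then have "lspan {F (int a) (int b) | a b. 1 \<le> a \<and> a < b \<and> b \<le> M} \<subseteq> {p. ?x * p * ?y \<in> below w}"
      by (rule lspan_minimal[OF subspace_preimage[OF B]])
    then have t5: "?x * obstruction (int i) (int j) (int k) * ?y \<in> below w"
      using res ij jk l unfolding obstructions_resolve_def by auto
    have c: "?x * (cnst c * p) * ?y = cnst c * (?x * p * ?y)" for c p
      by (simp add: mult_cnst mult.assoc)
    have "rel x i j (k # y) - rel (x @ [i]) j k y
       = ?x * (F (int i) (int j) * u (int k) - u (int i) * F (int j) (int k)) * ?y"
      using l by (simp add: rel_def letter_gen mono_word_append mono_word_Cons[of k y] mult.assoc
          left_diff_distrib right_diff_distrib)
    also have "\<dots> \<in> below w"
      unfolding overlap_identity distrib_left distrib_right left_diff_distrib right_diff_distrib c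
      by (intro subspace_closed(2,3,5)[OF B] t1 t2 t3 t4 t5)
    finally show ?thesis .
  qed
  \<comment> \<open>The offset \<open>t\<close> between the ascents decides: empty means the same
    ascent, one letter an overlap, more letters disjoint ascents.\<close>
  have both: "rel x i j y - rel x' i' j' y' \<in> below w"
    if e: "w = x @ i # j # y" "w = x' @ i' # j' # y'" and lt: "i < j" "i' < j'" and le: "length x \<le> length x'"
    for x i j y x' i' j' y'
  proof -
    obtain t where t: "x' = x @ t" "i # j # y = t @ i' # j' # y'"
    proof -
      have "x @ i # j # y = x' @ i' # j' # y'" using e by simp
      then obtain us where "x = x' @ us \<and> us @ i # j # y = i' # j' # y' \<or> x @ us = x' \<and> i # j # y = us @ i' # j' # y'"
        by (auto simp: append_eq_append_conv2)
      then show thesis using that[of us] le by auto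
    qed
    show ?thesis
    proof (cases t)
      case Nil
      then show ?thesis using t subspace_closed(1)[OF B] by simp
    next
      case (Cons a t')
      show ?thesis
      proof (cases t')
        case Nil
        then show ?thesis using t Cons overlap[of x i j j' y'] e lt by simp
      next
        case (Cons b t'')
        then show ?thesis using t \<open>t = a # t'\<close> far[of x i j t'' i' j' y'] e lt by simp
      qed
    qed
  qed
  have "reducible w" using 1(2-4) by (auto simp: reducible_def sorted_wrt_append)
  then obtain x' i' j' y' where s: "w = x' @ i' # j' # y'" "i' < j'" "selected w = rel x' i' j' y'"
    by (rule selected)
  show ?case
  proof (cases "length x \<le> length x'")
    case True
    then show ?thesis using both[OF 1(3) s(1) 1(4) s(2)] s(3) by simp
  next
    case False
    then have "rel x' i' j' y' - rel x i j y \<in> below w" using both[OF s(1) 1(3) s(2) 1(4)] by simp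
    then show ?thesis using subspace_closed(4)[OF B] s(3) by fastforce
  qed
qed

lemma selected_leading:
  assumes "reducible w"
  shows "Poly_Mapping.lookup (selected w) w = 1"
    "Poly_Mapping.lookup (selected w) v \<noteq> 0 \<Longrightarrow> v \<noteq> w \<Longrightarrow> (v, w) \<in> word_order"
proof -
  obtain x i j y where w: "w = x @ i # j # y" "i < j" "selected w = rel x i j y"
    using selected[OF assms] .
  have l: "i \<in> {1..M}" "j \<in> {1..M}" using assms w by (auto simp: reducible_def)
  let ?L = "{p. \<forall>v. Poly_Mapping.lookup p v \<noteq> 0 \<longrightarrow> (v, w) \<in> word_order}"
  have L: "subspace ?L"
    unfolding subspace_def by (auto simp: lookup_add lookup_cnst_mult) (metis add.right_neutral)
  have less: "mono_word x * mono_word v * mono_word y \<in> ?L" if "(x @ v @ y, w) \<in> word_order" for v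
    using that by (simp add: lookup_mono_word flip: mono_word_append)
  have "mono_word x * reduct i j * mono_word y \<in> ?L"
  proof (rule subspace_reduct[OF L])
    show "mono_word x * mono_word [j, i] * mono_word y \<in> ?L"
      using less[of "[j, i]"] word_order_swap[OF w(2)] w(1) by simp
    show "mono_word x * mono_word [r] * mono_word y \<in> ?L" for r
      using less[of "[r]"] w(1) by (simp add: word_order_iff)
    show "mono_word x * mono_word y \<in> ?L"
      using less[of "[]"] w(1) by (simp add: word_order_iff mono_word_Nil)
  qed
  moreover have "mono_word w = mono_word x * (mono_word [i, j] * mono_word y)"
    unfolding w(1) by (simp flip: mono_word_append)
  then have "selected w = mono_word w - mono_word x * reduct i j * mono_word y"
    using w(3) by (simp add: rel_def F_reduct[OF l] left_diff_distrib right_diff_distrib mult.assoc)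
  moreover have "(w, w) \<notin> word_order" by (simp add: word_order_iff)
  ultimately show "Poly_Mapping.lookup (selected w) w = 1"
    "Poly_Mapping.lookup (selected w) v \<noteq> 0 \<Longrightarrow> v \<noteq> w \<Longrightarrow> (v, w) \<in> word_order"
    by (auto simp: lookup_minus lookup_mono_word split: if_splits)
qed

text \<open>The relations placed in arbitrary word contexts span an ideal that contains the
  generators; each of them lies in the span of the selected ones by
  \<open>rel_selected\<close>.\<close>

lemma I_subset_span:
  assumes res: obstructions_resolve
  shows "I \<subseteq> lspan (selected ` Collect reducible)"
proof -
  let ?S = "lspan (selected ` Collect reducible)"
  let ?R = "{rel x i j y | x i j y. letters (x @ y) \<and> i \<in> {1..M} \<and> j \<in> {1..M} \<and> i < j}"
  have rel_S: "rel x i j y \<in> ?S" if "letters (x @ y)" "i \<in> {1..M}" "j \<in> {1..M}" "i < j" for x i j y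
  proof -
    let ?w = "x @ i # j # y"
    have "below ?w \<subseteq> ?S" unfolding below_def by (intro lspan_mono) auto
    moreover have "rel x i j y - selected ?w \<in> below ?w"
      using that by (intro rel_selected[OF res]) auto
    moreover have "reducible ?w" using that by (auto simp: reducible_def sorted_wrt_append)
    then have "selected ?w \<in> ?S" by (intro lspan_base) simp
    ultimately show ?thesis
      using subspace_closed(2)[OF subspace_lspan, of "selected ?w" _ "rel x i j y - selected ?w"] by auto
  qed
  have base: "rel x i j y \<in> lspan ?R" if "letters (x @ y)" "i \<in> {1..M}" "j \<in> {1..M}" "i < j" for x i j y
    by (intro lspan_base) (use that in blast)
  have sub: "lspan ?R \<subseteq> ?S" by (rule lspan_minimal[OF subspace_lspan]) (use rel_S in blast)
  have R_car: "lspan ?R \<subseteq> carrier (free_alg M)"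
  proof (rule lspan_minimal)
    show "subspace (carrier (free_alg M))" by (simp add: subspace_def free_alg_closed)
    show "?R \<subseteq> carrier (free_alg M)" using rel_in_I I_closed by blast
  qed
  have lmult: "a * p \<in> lspan ?R" and rmult: "p * a \<in> lspan ?R"
    if p: "p \<in> lspan ?R" and a: "a \<in> carrier (free_alg M)" for a p
  proof -
    have word: "mono_word v * p \<in> lspan ?R" "p * mono_word v \<in> lspan ?R" if v: "letters v" for v
    proof -
      have "lspan ?R \<subseteq> {p. mono_word v * p * 1 \<in> lspan ?R}"
      proof (rule lspan_minimal[OF subspace_preimage[OF subspace_lspan]], safe)
        fix x i j y assume *: "letters (x @ y)" "i \<in> {1..M}" "j \<in> {1..M}" "i < j"
        have "mono_word v * rel x i j y * 1 = rel (v @ x) i j y" by (simp add: rel_def mono_word_append mult.assoc)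
        then show "mono_word v * rel x i j y * 1 \<in> lspan ?R" using * v by (simp only:) (intro base; simp)
      qed
      then show "mono_word v * p \<in> lspan ?R" using p by auto
      have "lspan ?R \<subseteq> {p. 1 * p * mono_word v \<in> lspan ?R}"
      proof (rule lspan_minimal[OF subspace_preimage[OF subspace_lspan]], safe)
        fix x i j y assume *: "letters (x @ y)" "i \<in> {1..M}" "j \<in> {1..M}" "i < j"
        have "1 * rel x i j y * mono_word v = rel x i j (y @ v)" by (simp add: rel_def mono_word_append mult.assoc)
        then show "1 * rel x i j y * mono_word v \<in> lspan ?R" using * v by (simp only:) (intro base; simp)
      qed
      then show "p * mono_word v \<in> lspan ?R" using p by auto
    qed
    note l = subspace_closed[OF subspace_lspan]
    have av: "letters v" if "v \<in> Poly_Mapping.keys a" for v using a that by (simp add: carrier_free_alg)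
    have "(\<Sum>v\<in>Poly_Mapping.keys a. cnst (Poly_Mapping.lookup a v) * mono_word v) * p \<in> lspan ?R"
      unfolding sum_distrib_right mult.assoc by (intro l(6) l(3) word av)
    then show "a * p \<in> lspan ?R" unfolding ncpoly_expand[of a, symmetric] .
    have "p * (\<Sum>v\<in>Poly_Mapping.keys a. cnst (Poly_Mapping.lookup a v) * mono_word v) \<in> lspan ?R"
      unfolding sum_distrib_left mult_cnst by (intro l(6) l(3) word av)
    then show "p * a \<in> lspan ?R" unfolding ncpoly_expand[of a, symmetric] .
  qed
  have "ideal (lspan ?R) (free_alg M)"
  proof (rule idealI[OF ring_free_alg])
    show "subgroup (lspan ?R) (add_monoid (free_alg M))"
    proof (rule group.subgroupI)
      show "Group.group (add_monoid (free_alg M))"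
        using abelian_group.a_group[OF ring.is_abelian_group[OF ring_free_alg]] .
      show "lspan ?R \<subseteq> carrier (add_monoid (free_alg M))" using R_car by simp
      show "lspan ?R \<noteq> {}" using subspace_closed(1)[OF subspace_lspan] by blast
      fix a assume a: "a \<in> lspan ?R"
      have "inv\<^bsub>add_monoid (free_alg M)\<^esub> a = - a"
      proof -
        interpret R: ring "free_alg M" by (rule ring_free_alg)
        have "\<ominus>\<^bsub>free_alg M\<^esub> a = - a"
          by (rule R.minus_equality) (use a R_car in \<open>auto simp: free_alg_closed subset_eq\<close>)
        then show ?thesis by (simp add: a_inv_def)
      qed
      then show "inv\<^bsub>add_monoid (free_alg M)\<^esub> a \<in> lspan ?R"
        using subspace_closed(4)[OF subspace_lspan a] by simp
      fix b assume "b \<in> lspan ?R"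
      then show "a \<otimes>\<^bsub>add_monoid (free_alg M)\<^esub> b \<in> lspan ?R"
        using subspace_closed(2)[OF subspace_lspan a] by simp
    qed
  qed (unfold free_alg_simps, rule lmult rmult; assumption)+
  moreover have "comm_polys M \<omega> \<sigma> \<eta> \<subseteq> lspan ?R"
  proof
    fix p assume "p \<in> comm_polys M \<omega> \<sigma> \<eta>"
    then obtain i j where "1 \<le> i" "i < j" "j \<le> M" "p = rel [] i j []"
      by (auto simp: comm_polys_def comm_poly_eq rel_def mono_word_Nil)
    then show "p \<in> lspan ?R" using base[of "[]" "[]" i j] by simp
  qed
  ultimately have "I \<subseteq> lspan ?R" unfolding I_def by (rule ring.genideal_minimal[OF ring_free_alg])
  then show ?thesis using sub by blast
qed

text \<open>Selected relations have distinct leading words, so the leading word of a maximal term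
  cannot cancel. It would be a key of \<open>p\<close> that is both reducible and normal.\<close>

lemma normal_words_independent:
  assumes res: obstructions_resolve and p: "p \<in> I" and n: "Poly_Mapping.keys p \<subseteq> normal_words M"
  shows "p = 0"
proof -
  let ?C = "{p. \<exists>T c. finite T \<and> T \<subseteq> Collect reducible \<and> p = (\<Sum>w\<in>T. cnst (c w) * selected w)}"
  have C: "subspace ?C"
    unfolding subspace_def
  proof (intro conjI ballI allI)
    show "0 \<in> ?C" by (intro CollectI exI[of _ "{}"]) simp
  next
    fix p p' assume "p \<in> ?C" "p' \<in> ?C"
    then obtain T c T' c' where T: "finite T" "T \<subseteq> Collect reducible" "p = (\<Sum>w\<in>T. cnst (c w) * selected w)"
      "finite T'" "T' \<subseteq> Collect reducible" "p' = (\<Sum>w\<in>T'. cnst (c' w) * selected w)" by auto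
    have ext: "(\<Sum>w\<in>A. cnst (c w) * selected w) = (\<Sum>w\<in>T \<union> T'. cnst (if w \<in> A then c w else 0) * selected w)"
      if "A \<subseteq> T \<union> T'" for A c
      using that T(1,4) by (intro sum.mono_neutral_cong_left) (auto simp: cnst_hom)
    have "p + p' = (\<Sum>w\<in>T \<union> T'. cnst ((if w \<in> T then c w else 0) + (if w \<in> T' then c' w else 0)) * selected w)"
      unfolding T(3,6) ext[of T c, OF Un_upper1] ext[of T' c', OF Un_upper2] sum.distrib[symmetric]
      by (simp only: cnst_hom distrib_right)
    then show "p + p' \<in> ?C"
      using T by (intro CollectI exI[of _ "T \<union> T'"] exI) auto
  next
    fix a p assume "p \<in> ?C"
    then obtain T c where T: "finite T" "T \<subseteq> Collect reducible" "p = (\<Sum>w\<in>T. cnst (c w) * selected w)" by auto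
    have "cnst a * p = (\<Sum>w\<in>T. cnst (a * c w) * selected w)"
      unfolding T(3) sum_distrib_left cnst_merge ..
    then show "cnst a * p \<in> ?C" using T by (intro CollectI exI[of _ T] exI) auto
  qed
  have "selected ` Collect reducible \<subseteq> ?C"
  proof safe
    fix w assume "reducible w"
    then show "\<exists>T c. finite T \<and> T \<subseteq> Collect reducible \<and> selected w = (\<Sum>w\<in>T. cnst (c w) * selected w)"
      by (intro exI[of _ "{w}"] exI[of _ "\<lambda>_. 1"]) (simp add: cnst_1)
  qed
  then have "I \<subseteq> ?C" by (rule order_trans[OF I_subset_span[OF res] lspan_minimal[OF C]])
  then have "p \<in> ?C" using p by (rule subsetD)
  then obtain T c where T: "finite T" "T \<subseteq> Collect reducible" "p = (\<Sum>w\<in>T. cnst (c w) * selected w)"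
    by (elim CollectE exE conjE)
  let ?N = "{w \<in> T. c w \<noteq> 0}"
  show ?thesis
  proof (cases "?N = {}")
    case True
    then have "(\<Sum>w\<in>T. cnst (c w) * selected w) = 0"
      by (intro sum.neutral) (auto simp: cnst_hom)
    then show ?thesis using T(3) by simp
  next
    case False
    have fin: "finite ?N" using T(1) by simp
    define L where "L = Max (length ` ?N)"
    let ?N' = "{w \<in> ?N. length w = L}"
    have "L \<in> length ` ?N" unfolding L_def using False fin by (intro Max_in) auto
    then have ne: "?N' \<noteq> {}" by auto
    define W where "W = Max (weight 0 ` ?N')"
    have fin': "finite ?N'" using T(1) by simp
    have "W \<in> weight 0 ` ?N'" unfolding W_def using ne fin' by (intro Max_in) simp_all
    then obtain w where w: "w \<in> T" "c w \<noteq> 0" "length w = L" "weight 0 w = W" by auto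
    \<comment> \<open>The order is not total: distinct words may share length and weight. Such words
      are incomparable, so a maximal \<open>w\<close> still occurs in no selected relation of
      another word with nonzero coefficient.\<close>
    have max: "(w, v) \<notin> word_order" if "v \<in> ?N" for v
    proof -
      have "length v \<le> L" unfolding L_def using fin that by (intro Max_ge) auto
      moreover have "weight 0 v \<le> W" if "length v = L"
        unfolding W_def using fin' that \<open>v \<in> ?N\<close> by (intro Max_ge finite_imageI imageI) simp_all
      ultimately show ?thesis using w by (auto simp: word_order_iff)
    qed
    have "Poly_Mapping.lookup p w = (\<Sum>v\<in>T. if v = w then c w else 0)"
      unfolding T(3) lookup_sum lookup_cnst_mult
    proof (rule sum.cong)
      fix v assume v: "v \<in> T"
      then have rv: "reducible v" using T(2) by auto
      show "c v * Poly_Mapping.lookup (selected v) w = (if v = w then c w else 0)"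
        using selected_leading(1)[OF rv] selected_leading(2)[OF rv, of w] max[of v] v
        by (cases "v = w"; cases "c v = 0") auto
    qed simp
    also have "\<dots> = c w" using T(1) w(1) by simp
    finally have "w \<in> Poly_Mapping.keys p" using w(2) by (simp add: in_keys_iff)
    then have "w \<in> normal_words M" using n by blast
    moreover have "reducible w" using T(2) w(1) by auto
    ultimately show ?thesis by (simp add: normal_words_def reducible_def)
  qed
qed

lemma diamond_lemma: "obstructions_resolve \<Longrightarrow> normal_words_basis M I"
  unfolding normal_words_basis_iff using normal_words_span normal_words_independent by blast

end

section \<open>Sufficiency\<close>

context derivation_relations
begin

lemma quantisationI:
  assumes res: obstructions_resolve
    and D: "\<And>i j. 1 \<le> i \<Longrightarrow> i < j \<Longrightarrow> j \<le> M \<Longrightarrow> D (F (int i) (int j)) \<in> I \<or> D (F (int j) (int i)) \<in> I"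
  shows "quantisation_ideal M D I"
proof -
  have "D ` I \<subseteq> I"
  proof (rule genideal_self_invariant)
    fix g assume "g \<in> comm_polys M \<omega> \<sigma> \<eta>"
    then obtain i j where ij: "1 \<le> i" "i < j" "j \<le> M" and g: "g = F (int i) (int j)"
      by (auto simp: comm_polys_def comm_poly_eq)
    have "\<not> int j \<approx> int i" using ij by (simp add: eqv_ix ix_of_nat)
    then have "D (F (int i) (int j)) = - (cnst (q (int i) (int j)) * D (F (int j) (int i)))"
      using F_swap[of "int j" "int i"] by (simp add: D_uminus D_rules(3) F_closed free_alg_closed)
    then show "D g \<in> I" using D[OF ij] g by (metis I_cnst I_uminus)
  qed
  then show ?thesis using ideal diamond_lemma[OF res] by (simp add: quantisation_ideal_def)
qed

lemma quantisation_three: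
  assumes M: "M = 3" and q: "\<And>i. q i (i + 1) = \<alpha>"
    and s: "\<And>i r. s i (i + 1) r = \<beta>" and e: "\<And>i. e i (i + 1) = \<gamma>"
  shows "quantisation_ideal M D I"
proof (rule quantisationI)
  define \<Lambda> where "\<Lambda> = cnst \<beta> * (u 1 + u 2 + u 3) + cnst \<gamma>"
  have sum3: "(\<Sum>r = 1..M. g (int r)) = g 1 + g 2 + g 3" for g :: "int \<Rightarrow> ncpoly"
    by (simp add: M numeral_eq_Suc)
  have lin: "lin i (i + 1) = \<Lambda>" for i
    using sum3[of "\<lambda>r. cnst \<beta> * u r"] unfolding lin_def s e \<Lambda>_def by (simp add: distrib_left)
  have wrap: "q (i + 2) i = q (i + 2) (i + 2 + 1)" "lin (i + 2) i = lin (i + 2) (i + 2 + 1)" for i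
    by (rule periodic[where r = 0 and r' = 0]; simp add: M)+
  have wrap': "q (i + 2) i = \<alpha>" "lin (i + 2) i = \<Lambda>" for i
    unfolding wrap by (rule q, rule lin)
  have nxt: "q (i + 1) (i + 2) = \<alpha>" "lin (i + 1) (i + 2) = \<Lambda>" for i
    using q[of "i + 1"] lin[of "i + 1"] by (simp_all add: add.commute[of _ i])
  have per: "u 4 = u 1" "u 0 = u 3" by (rule gen_eq[OF M0]; simp add: M)+
  have D\<Lambda>: "D (lin i (i + 1)) = 0" for i
    using sum3[of "\<lambda>r. cnst \<beta> * (u (r + 1) * u r - u r * u (r - 1))"]
    unfolding D_lin s by (simp add: per algebra_simps)
  have D: "D (F i (i + 1)) \<in> I" for i
  proof -
    have "u (i + 1) * F i (i + 1) - F i (i + 1) * u i + F (i + 1) (i + 2) * u i - u (i + 1) * F (i + 2) i \<in> I"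
      using M3 by (intro I_add I_diff F_mult_in_I) (simp_all add: int_dvd_small)
    then show ?thesis
      using D\<Lambda>[of i] unfolding D_F_three[OF M, of i, unfolded nxt q wrap', OF refl refl] lin by simp
  qed
  fix i j assume ij: "1 \<le> i" "i < j" "j \<le> M"
  have "F 3 1 = F 3 (3 + 1)" by (rule periodic(5)[where r = 0 and r' = 0]; simp add: M)
  then have "D (F 1 2) \<in> I" "D (F 2 3) \<in> I" "D (F 3 1) \<in> I"
    using D[of 1] D[of 2] D[of 3] by simp_all
  moreover have "i = 1 \<and> j = 2 \<or> i = 2 \<and> j = 3 \<or> i = 1 \<and> j = 3" using ij M by linarith
  ultimately show "D (F (int i) (int j)) \<in> I \<or> D (F (int j) (int i)) \<in> I" by auto
next
  define \<Lambda> where "\<Lambda> = cnst \<beta> * (u 1 + u 2 + u 3) + cnst \<gamma>"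
  have sum3: "(\<Sum>r = 1..M. g (int r)) = g 1 + g 2 + g 3" for g :: "int \<Rightarrow> ncpoly"
    by (simp add: M numeral_eq_Suc)
  have lin: "lin i (i + 1) = \<Lambda>" for i
    using sum3[of "\<lambda>r. cnst \<beta> * u r"] unfolding lin_def s e \<Lambda>_def by (simp add: distrib_left)
  have "q 3 1 = q 3 (3 + 1)" "lin 3 1 = lin 3 (3 + 1)"
    by (rule periodic[where r = 0 and r' = 0]; simp add: M)+
  then have 31: "q 3 1 = \<alpha>" "lin 3 1 = \<Lambda>" using q lin by metis+
  have ne: "\<not> 3 \<approx> 1" using M3 by (simp add: int_dvd_small)
  have 13: "q 1 3 = inverse \<alpha>" "lin 1 3 = - (cnst (inverse \<alpha>) * \<Lambda>)"
    using q_swap[OF ne] lin_swap[OF ne] 31 by simp_all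
  have \<alpha>: "\<alpha> \<noteq> 0" using q_nz[OF ne] 31 by simp
  have 123: "q 1 2 = \<alpha>" "q 2 3 = \<alpha>" "lin 1 2 = \<Lambda>" "lin 2 3 = \<Lambda>"
    using q[of 1] q[of 2] lin[of 1] lin[of 2] by simp_all
  \<comment> \<open>The factor \<open>- inverse \<alpha>\<close> in \<open>lin 1 3\<close> turns the
    six terms into the commutator of \<open>\<Lambda>\<close> with the sum of the generators. It
    vanishes because \<open>\<Lambda>\<close> is affine in that sum.\<close>
  have "obstruction 1 2 3 = \<Lambda> * (u 1 + u 2 + u 3) - (u 1 + u 2 + u 3) * \<Lambda>"
    unfolding obstruction_def 123 13 using \<alpha> by (simp add: nc_simps cnst_merge cnst_1 algebra_simps)
  also have "\<dots> = 0"
    unfolding \<Lambda>_def by (simp add: nc_simps algebra_simps)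
  finally have "obstruction 1 2 3 = 0" .
  moreover have "i = 1 \<and> j = 2 \<and> k = 3" if "1 \<le> i" "i < j" "j < k" "k \<le> M" for i j k :: nat
    using that M by linarith
  ultimately show obstructions_resolve
    unfolding obstructions_resolve_def using subspace_closed(1)[OF subspace_lspan] by fastforce
qed

lemma quantisation_four:
  assumes M: "M = 4" and q: "\<And>i. q i (i + 1) = \<alpha>" and q1: "\<And>i. q i (i + 2) = 1"
    and lin: "\<And>i. lin i (i + 1) = cnst (b i) * u i + cnst (b (i + 1)) * u (i + 1) - cnst (b i * b (i + 1))"
    and lin2: "\<And>i. lin i (i + 2) = cnst (b (i + 1)) * (u (i + 3) - u (i + 1))"
    and b: "\<And>i. b (i + 2) = b i"
  shows "quantisation_ideal M D I"
proof (rule quantisationI)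
  have M4: "M \<ge> 4" using M by simp
  have per: "u (i - 1) = u (i + 3)" "u (i + 4) = u i" "u (i + 5) = u (i + 1)" for i
    by (rule gen_eq[OF M0]; simp add: M)+
  have b3: "b (i + 3) = b (i + 1)" for i using b[of "i + 1"] by (simp add: add.commute[of _ i])
  have ne: "\<not> i \<approx> i + 1" "\<not> i \<approx> i + 2" "\<not> i - 1 \<approx> i + 1" "\<not> i + 1 \<approx> i + 2" "\<not> i + 3 \<approx> i" "\<not> i + 2 \<approx> i + 3"
      "\<not> i + 1 \<approx> i + 3" for i
    using M4 by (simp_all add: int_dvd_small)
  have lm: "lin (i - 1) (i + 1) = cnst (b i) * (u (i + 2) - u i)" for i
    using lin2[of "i - 1"] by (simp add: add.commute[of _ i])
  have lp: "lin (i + 1) (i + 2) = cnst (b (i + 1)) * u (i + 1) + cnst (b i) * u (i + 2) - cnst (b i * b (i + 1))"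
     "lin (i + 2) (i + 3) = cnst (b i) * u (i + 2) + cnst (b (i + 1)) * u (i + 3) - cnst (b i * b (i + 1))" for i
    using lin[of "i + 1"] lin[of "i + 2"] b[of i] b3[of i] by (simp_all add: add.commute[of _ i] mult.commute)
  have "lin (i + 3) i = lin (i + 3) (i + 3 + 1)" "q (i + 3) i = q (i + 3) (i + 3 + 1)" for i
    by (rule periodic[where r = 0 and r' = 0]; simp add: M)+
  then have l3: "lin (i + 3) i = cnst (b (i + 1)) * u (i + 3) + cnst (b i) * u i - cnst (b i * b (i + 1))"
    and q3: "q (i + 3) i = \<alpha>" for i
    using lin[of "i + 3"] q[of "i + 3"] b[of "i + 2"] b[of i] b3[of i] per(2)[of i]
    by (simp_all add: add.commute[of _ i] mult.commute)
  have l13: "lin (i + 1) (i + 3) = cnst (b i) * (u i - u (i + 2))" for i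
    using lin2[of "i + 1"] per(2)[of i] b[of i] by (simp add: add.commute[of _ i])
  have q': "q (i + 1) (i + 2) = \<alpha>" "q (i + 2) (i + 3) = \<alpha>" "q (i - 1) (i + 1) = 1" "q (i + 1) (i + 3) = 1" for i
    using q[of "i + 1"] q[of "i + 2"] q1[of "i - 1"] q1[of "i + 1"] by (simp_all add: add.commute[of _ i])
  have D1: "D (lin i (i + 1)) = cnst (b i) * (u (i + 1) * u i - u i * u (i + 3))
      + cnst (b (i + 1)) * (u (i + 2) * u (i + 1) - u (i + 1) * u i)" for i
    unfolding lin using D_rules(5)[of i] D_rules(5)[of "i + 1"]
    by (simp add: D_rules(2,3) D_diff D_cnst free_alg_closed gen_closed M0 per add.commute[of _ i])
  have D2: "D (lin i (i + 2)) = cnst (b (i + 1)) * ((u i * u (i + 3) - u (i + 3) * u (i + 2))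
       - (u (i + 2) * u (i + 1) - u (i + 1) * u i))" for i
    unfolding lin2 using D_rules(5)[of "i + 3"] D_rules(5)[of "i + 1"]
    by (simp add: D_rules(3) D_diff free_alg_closed gen_closed M0 per add.commute[of _ i])
  have adj: "D (F i (i + 1)) \<in> I" for i
  proof -
    \<comment> \<open>The quadratic words of the remainder are commutators of opposite generators,
      so the relations at distance two absorb it; the constant \<open>- (b i * b (i + 1))\<close> is
      what makes the linear terms match.\<close>
    have "u (i + 1) * lin i (i + 1) - lin i (i + 1) * u i - u i * lin (i - 1) (i + 1)
        - lin i (i + 1) * u (i - 1) + lin i (i + 2) * u (i + 1) + u (i + 2) * lin i (i + 1)
        - D (lin i (i + 1)) = - (cnst (b i) * F i (i + 2)) - cnst (b (i + 1)) * F (i + 1) (i + 3)"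
      unfolding D1 F_def q' q1 l13 unfolding lin lin2 lm per
      by (simp add: nc_simps cnst_merge cnst_1 mult.commute algebra_simps)
    also have "\<dots> \<in> I" using ne[of i] by (intro I_diff I_uminus I_cnst F_in_I)
    finally have "u (i + 1) * lin i (i + 1) - lin i (i + 1) * u i - u i * lin (i - 1) (i + 1)
        - lin i (i + 1) * u (i - 1) + lin i (i + 2) * u (i + 1) + u (i + 2) * lin i (i + 1)
        - D (lin i (i + 1)) \<in> I" .
    then show ?thesis
      unfolding D_F_adjacent[of i, OF q'(3) q1] using ne[of i] by (simp add: I_add I_diff F_mult_in_I)
  qed
  have two: "D (F i (i + 2)) \<in> I" for i
  proof -
    have "u (i + 1) * lin i (i + 2) - lin i (i + 2) * u (i + 1) + lin (i + 1) (i + 2) * u i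
        - u (i + 2) * lin i (i + 1) + u (i + 3) * lin i (i + 2) - lin (i + 3) i * u (i + 2)
        + u i * lin (i + 2) (i + 3) - lin i (i + 2) * u (i + 3) - D (lin i (i + 2))
       = cnst (b (i + 1)) * F (i + 1) (i + 3) + cnst (b (i + 1)) * F (i + 1) (i + 3)"
      unfolding D2 F_def q' l13 unfolding lin lin2 lp l3
      by (simp add: nc_simps cnst_merge cnst_1 mult.commute algebra_simps)
    also have "\<dots> \<in> I" using ne[of i] by (intro I_add I_cnst F_in_I)
    finally have "u (i + 1) * lin i (i + 2) - lin i (i + 2) * u (i + 1) + lin (i + 1) (i + 2) * u i
        - u (i + 2) * lin i (i + 1) + u (i + 3) * lin i (i + 2) - lin (i + 3) i * u (i + 2)
        + u i * lin (i + 2) (i + 3) - lin i (i + 2) * u (i + 3) - D (lin i (i + 2)) \<in> I" .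
    moreover have "q (i + 1) (i + 2) = q i (i + 1)" "q (i + 2) (i + 3) = q (i + 3) i" by (simp_all add: q q' q3)
    ultimately show ?thesis
      using ne[of i] by (simp add: D_F_distance_two_four[OF M q1] I_add I_diff F_mult_in_I)
  qed
  {
    fix i j assume ij: "1 \<le> i" "i < j" "j \<le> M"
    have "F 4 1 = F 4 (4 + 1)" by (rule periodic(5)[where r = 0 and r' = 0]; simp add: M)
    then have "D (F 1 2) \<in> I" "D (F 2 3) \<in> I" "D (F 3 4) \<in> I" "D (F 4 1) \<in> I" "D (F 1 3) \<in> I" "D (F 2 4) \<in> I"
      using adj[of 1] adj[of 2] adj[of 3] adj[of 4] two[of 1] two[of 2] by simp_all
    moreover have "i = 1 \<and> j = 2 \<or> i = 1 \<and> j = 3 \<or> i = 1 \<and> j = 4 \<or> i = 2 \<and> j = 3 \<or> i = 2 \<and> j = 4 \<or> i = 3 \<and> j = 4"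
      using ij M by linarith
    ultimately show "D (F (int i) (int j)) \<in> I \<or> D (F (int j) (int i)) \<in> I" by (elim disjE conjE) simp_all
  }
  let ?S = "lspan {F (int a) (int b) | a b. 1 \<le> a \<and> a < b \<and> b \<le> M}"
  have base: "F (int a) (int b) \<in> ?S" if "1 \<le> a" "a < b" "b \<le> M" for a b
    by (intro lspan_base) (use that in blast)
  have FS: "F 1 2 \<in> ?S" "F 1 3 \<in> ?S" "F 1 4 \<in> ?S" "F 2 3 \<in> ?S" "F 2 4 \<in> ?S" "F 3 4 \<in> ?S"
    using base[of 1 2] base[of 1 3] base[of 1 4] base[of 2 3] base[of 2 4] base[of 3 4] M by simp_all
  have ne41: "\<not> 4 \<approx> 1" using M4 by (simp add: int_dvd_small)
  have b': "b 2 = b 0" "b 3 = b 1" "b 4 = b 0" using b[of 0] b[of 1] b[of 2] by simp_all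
  have u5: "u 5 = u 1" using per(2)[of 1] by simp
  have l: "lin 1 2 = cnst (b 1) * u 1 + cnst (b 0) * u 2 - cnst (b 0 * b 1)"
    "lin 2 3 = cnst (b 0) * u 2 + cnst (b 1) * u 3 - cnst (b 0 * b 1)"
    "lin 3 4 = cnst (b 1) * u 3 + cnst (b 0) * u 4 - cnst (b 0 * b 1)"
    "lin 1 3 = cnst (b 0) * (u 4 - u 2)"
    "lin 2 4 = cnst (b 1) * (u 1 - u 3)"
    "lin 4 1 = cnst (b 0) * u 4 + cnst (b 1) * u 1 - cnst (b 0 * b 1)"
    using lin[of 1] lin[of 2] lin[of 3] lin2[of 1] lin2[of 2] l3[of 1] by (simp_all add: b' u5 mult.commute)
  have q41: "q 4 1 = \<alpha>" using q3[of 1] by simp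
  have q'': "q 1 2 = \<alpha>" "q 2 3 = \<alpha>" "q 3 4 = \<alpha>" "q 1 3 = 1" "q 2 4 = 1" "q 1 4 = inverse \<alpha>"
    using q[of 1] q[of 2] q[of 3] q1[of 1] q1[of 2] q_swap[OF ne41] q41 by simp_all
  have l14: "lin 1 4 = - (cnst (inverse \<alpha>) * (cnst (b 0) * u 4 + cnst (b 1) * u 1 - cnst (b 0 * b 1)))"
    using lin_swap[OF ne41] l(6) q''(6) by simp
  have \<alpha>: "\<alpha> \<noteq> 0" using q_nz[OF ne41] q41 by simp
  have cancel: "\<alpha> * (inverse \<alpha> * x) = x" for x using \<alpha> by simp
  note simps = obstruction_def F_def q'' l14 l(1-5)
  note rules = nc_simps cnst_merge cnst_1 cnst_hom mult.commute mult.left_commute cnst_mult[symmetric] algebra_simps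
  \<comment> \<open>An ascending word \<open>u a * u b\<close> occurs in no basic relation but
    \<open>F a b\<close>, so its coefficient in the obstruction is the coefficient of
    \<open>F a b\<close> on the right.\<close>
  have "obstruction 1 2 3 = cnst (b 0) * F 2 3 - cnst (b 0) * F 1 2 + cnst (\<alpha> * b 0) * F 2 4"
    unfolding simps using \<alpha> by (simp add: rules cancel)
  moreover have "obstruction 2 3 4 = cnst (b 1) * F 3 4 - cnst (b 1) * F 2 3 - cnst (\<alpha> * b 1) * F 1 3"
    unfolding simps using \<alpha> by (simp add: rules cancel)
  moreover have "obstruction 1 2 4 = cnst (b 1) * F 1 4 + cnst (inverse \<alpha> * b 1) * F 1 2 + cnst (b 1) * F 1 3"
    unfolding simps using \<alpha> by (simp add: rules cancel)
  moreover have "obstruction 1 3 4 = - (cnst (b 0) * F 2 4) - cnst (inverse \<alpha> * b 0) * F 3 4 - cnst (b 0) * F 1 4"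
    unfolding simps using \<alpha> by (simp add: rules cancel)
  ultimately have S: "obstruction 1 2 3 \<in> ?S" "obstruction 2 3 4 \<in> ?S" "obstruction 1 2 4 \<in> ?S" "obstruction 1 3 4 \<in> ?S"
    by (simp_all only:) (intro subspace_closed(2-5)[OF subspace_lspan] FS)+
  show obstructions_resolve
    unfolding obstructions_resolve_def
  proof (intro allI impI)
    fix i j k assume "1 \<le> i" "i < j" "j < k" "k \<le> M"
    then have "i = 1 \<and> j = 2 \<and> k = 3 \<or> i = 2 \<and> j = 3 \<and> k = 4 \<or> i = 1 \<and> j = 2 \<and> k = 4 \<or> i = 1 \<and> j = 3 \<and> k = 4"
      using M by linarith
    then show "obstruction (int i) (int j) (int k) \<in> ?S" using S by (elim disjE conjE) simp_all
  qed
qed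

text \<open>Without inhomogeneous parts the obstructions are zero, and the identities for the
  derivative leave only multiples of relations. Distances \<open>-1\<close> and \<open>-2\<close>
  are reduced to \<open>1\<close> and \<open>2\<close> by reading the pair in the other
  order.\<close>

lemma quantisation_five:
  assumes M: "M \<ge> 5" and q: "\<And>i. q i (i + 1) = \<alpha>"
    and q1: "\<And>i j. \<not> i \<approx> j \<Longrightarrow> \<not> i + 1 \<approx> j \<Longrightarrow> \<not> i - 1 \<approx> j \<Longrightarrow> q i j = 1"
    and lin: "\<And>i j. \<not> i \<approx> j \<Longrightarrow> lin i j = 0"
  shows "quantisation_ideal M D I"
proof (rule quantisationI)
  have "obstruction (int i) (int j) (int k) = 0" if "1 \<le> i" "i < j" "j < k" "k \<le> M" for i j k
  proof -
    have "\<not> int i \<approx> int j" "\<not> int i \<approx> int k" "\<not> int j \<approx> int k" using that by (simp_all add: eqv_ix ix_of_nat)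
    then show ?thesis by (simp add: obstruction_def lin)
  qed
  then show obstructions_resolve
    using subspace_closed(1)[OF subspace_lspan] by (simp add: obstructions_resolve_def)
  fix i j assume ij: "1 \<le> i" "i < j" "j \<le> M"
  then have ne: "\<not> int i \<approx> int j" by (simp add: eqv_ix ix_of_nat)
  have adj: "D (F n (n + 1)) \<in> I" for n
  proof -
    have ne: "\<not> n \<approx> n + 1" "\<not> n - 1 \<approx> n + 1" "\<not> n \<approx> n + 2" using M by (simp_all add: int_dvd_small)
    have "q (n - 1) (n + 1) = 1" "q n (n + 2) = 1" using M by (intro q1; simp add: int_dvd_small)+
    then show ?thesis
      using ne by (simp add: D_F_adjacent lin D_0 I_add I_diff F_mult_in_I)
  qed
  have two: "D (F n (n + 2)) \<in> I" for n
  proof -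
    have ne: "\<not> n \<approx> n + 1" "\<not> n \<approx> n + 2" "\<not> n + 1 \<approx> n + 2" "\<not> n - 1 \<approx> n + 2" "\<not> n \<approx> n + 3"
      using M by (simp_all add: int_dvd_small)
    have "q n (n + 2) = 1" "q (n - 1) (n + 2) = 1" "q n (n + 3) = 1" using M by (intro q1; simp add: int_dvd_small)+
    moreover have "q (n + 1) (n + 2) = q n (n + 1)" using q[of n] q[of "n + 1"] by (simp add: add.commute[of _ n])
    ultimately show ?thesis
      using ne by (simp add: D_F_distance_two lin D_0 I_add I_diff F_mult_in_I)
  qed
  have distant: "D (F n m) \<in> I" if nm: "far n m" for n m
  proof -
    have "q n m = 1" "q (n + 1) m = 1" "q (n - 1) m = 1" "q n (m + 1) = 1" "q n (m - 1) = 1"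
      using far_neq[OF nm] nm by (intro q1; simp add: far_def algebra_simps)+
    then show ?thesis
      using far_neq[OF nm] by (simp add: D_F_distant lin D_0 I_add I_diff F_mult_in_I)
  qed
  show "D (F (int i) (int j)) \<in> I \<or> D (F (int j) (int i)) \<in> I"
  proof (cases "far (int i) (int j)")
    case True
    then show ?thesis using distant by blast
  next
    case False
    then consider "int i + 1 \<approx> int j" | "int i - 1 \<approx> int j" | "int i + 2 \<approx> int j" | "int i - 2 \<approx> int j"
      using ne by (auto simp: far_def)
    then show ?thesis
    proof cases
      case 1
      have "F (int i) (int i + 1) = F (int i) (int j)"
        by (rule periodic(5)[where r = 0 and r' = 0]) (use 1 in simp_all)
      then show ?thesis using adj[of "int i"] by simp
    next
      case 2
      have "F (int j) (int j + 1) = F (int j) (int i)"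
        by (rule periodic(5)[where r = 0 and r' = 0]) (use eqv_sym[OF 2] in \<open>simp_all add: algebra_simps\<close>)
      then show ?thesis using adj[of "int j"] by simp
    next
      case 3
      have "F (int i) (int i + 2) = F (int i) (int j)"
        by (rule periodic(5)[where r = 0 and r' = 0]) (use 3 in simp_all)
      then show ?thesis using two[of "int i"] by simp
    next
      case 4
      have "F (int j) (int j + 2) = F (int j) (int i)"
        by (rule periodic(5)[where r = 0 and r' = 0]) (use eqv_sym[OF 4] in \<open>simp_all add: algebra_simps\<close>)
      then show ?thesis using two[of "int j"] by simp
    qed
  qed
qed

end

section \<open>Realising the listed relations by cyclic coefficient functions\<close>

lemma eqv_cong: "M > 0 \<Longrightarrow> int M dvd i - i' \<Longrightarrow> int M dvd j - j' \<Longrightarrow> int M dvd i - j + k \<longleftrightarrow> int M dvd i' - j' + k"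
proof -
  assume *: "int M dvd i - i'" "int M dvd j - j'"
  have "i - j + k = (i' - j' + k) + ((i - i') - (j - j'))" by simp
  then show ?thesis using dvd_diff[OF *] by (metis dvd_add_left_iff)
qed

lemma quantisation_ideal_relations3:
  assumes D: "volterra_derivation 3 D" and \<alpha>: "\<alpha> \<noteq> 0"
  shows "quantisation_ideal 3 D (genideal (free_alg 3) (relations3 \<alpha> \<beta> \<gamma>))"
proof -
  \<comment> \<open>Two distinct residues modulo 3 differ by 1 or by -1; in the second case the
    relation is read backwards, which inverts \<open>\<alpha>\<close> and rescales the other
    coefficients.\<close>
  define qc where "qc i j = (if 3 dvd j - i - 1 then \<alpha> else inverse \<alpha>)" for i j :: int
  define sc where "sc i j r = (if 3 dvd j - i - 1 then \<beta> else - (inverse \<alpha> * \<beta>))" for i j r :: int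
  define ec where "ec i j = (if 3 dvd j - i - 1 then \<gamma> else - (inverse \<alpha> * \<gamma>))" for i j :: int
  interpret derivation_relations 3 "\<lambda>i j. qc (int i) (int j)" "\<lambda>r i j. sc (int i) (int j) (int r)"
    "\<lambda>i j. ec (int i) (int j)" D
    by unfold_locales (simp_all add: D qc_def \<alpha>)
  have per: "qc i j = qc i' j' \<and> sc i j r = sc i' j' r' \<and> ec i j = ec i' j'"
    if "int 3 dvd i - i'" "int 3 dvd j - j'" "int 3 dvd r - r'" for i i' j j' r r'
  proof -
    have "3 dvd j - i - 1 \<longleftrightarrow> 3 dvd j' - i' - 1" using that by simp presburger
    then show ?thesis by (simp add: qc_def sc_def ec_def)
  qed
  have swap: "qc j i = inverse (qc i j) \<and> sc j i r = - (qc j i * sc i j r) \<and> ec j i = - (qc j i * ec i j)"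
    if "\<not> int 3 dvd i - j" for i j r
  proof -
    have "3 dvd i - j - 1 \<longleftrightarrow> \<not> 3 dvd j - i - 1" using that by simp presburger
    then show ?thesis using \<alpha> by (simp add: qc_def sc_def ec_def)
  qed
  have c: "q i j = qc i j" "s i j r = sc i j r" "e i j = ec i j" if "\<not> int 3 dvd i - j" for i j r
    by (rule cyclic_coefficients[of qc sc ec, OF refl refl refl per swap that]; assumption)+
  have c': "q i (i + 1) = \<alpha>" "s i (i + 1) r = \<beta>" "e i (i + 1) = \<gamma>" for i r
    using c(1)[of i "i + 1"] c(2)[of i "i + 1" r] c(3)[of i "i + 1"] by (simp_all add: qc_def sc_def ec_def)
  show ?thesis
    using quantisation_three[OF refl c'] genideal_relations3[OF refl c'] by simp
qed

lemma quantisation_ideal_relations4: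
  assumes D: "volterra_derivation 4 D" and \<alpha>: "\<alpha> \<noteq> 0"
  shows "quantisation_ideal 4 D (genideal (free_alg 4) (relations4 \<alpha> \<beta> \<gamma>))"
proof -
  define b where "b n = (if even n then \<beta> else \<gamma>)" for n :: int
  define qc where "qc i j = (if 4 dvd j - i - 1 then \<alpha> else if 4 dvd i - j - 1 then inverse \<alpha> else 1)" for i j :: int
  define ad where "ad i j r = (if 4 dvd r - i then b i else 0) + (if 4 dvd r - j then b j else 0)" for i j r :: int
  \<comment> \<open>This is the linear part \<open>b (i + 1) * (u (i + 3) - u (i + 1))\<close> for
    opposite indices. Adding two to \<open>i\<close> exchanges the two residues and keeps the
    parity, so reading the pair backwards changes the sign, as it must where \<open>q\<close> is
    1.\<close>
  define op where "op i r = (if 4 dvd r - (i + 3) then b (i + 1) else 0) + (if 4 dvd r - (i + 1) then - b (i + 1) else 0)" for i r :: int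
  define sc where "sc i j r = (if 4 dvd j - i - 1 then ad i j r else if 4 dvd i - j - 1 then - (inverse \<alpha> * ad i j r)
     else op i r)" for i j r :: int
  define ec where "ec i j = (if 4 dvd j - i - 1 then - (b i * b j) else if 4 dvd i - j - 1 then inverse \<alpha> * (b i * b j)
     else 0)" for i j :: int
  interpret derivation_relations 4 "\<lambda>i j. qc (int i) (int j)" "\<lambda>r i j. sc (int i) (int j) (int r)"
    "\<lambda>i j. ec (int i) (int j)" D
    by unfold_locales (simp_all add: D qc_def \<alpha>)
  have bper: "b i = b i'" "b (i + 1) = b (i' + 1)" if "int 4 dvd i - i'" for i i'
  proof -
    have "even i \<longleftrightarrow> even i'" using that by simp presburger
    then show "b i = b i'" "b (i + 1) = b (i' + 1)" by (simp_all add: b_def)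
  qed
  have per: "qc i j = qc i' j' \<and> sc i j r = sc i' j' r' \<and> ec i j = ec i' j'"
    if *: "int 4 dvd i - i'" "int 4 dvd j - j'" "int 4 dvd r - r'" for i i' j j' r r'
  proof -
    have 1: "4 dvd j - i - 1 \<longleftrightarrow> 4 dvd j' - i' - 1" using * by simp presburger
    have 2: "4 dvd i - j - 1 \<longleftrightarrow> 4 dvd i' - j' - 1" using * by simp presburger
    have 3: "4 dvd r - i \<longleftrightarrow> 4 dvd r' - i'" "4 dvd r - j \<longleftrightarrow> 4 dvd r' - j'"
      "4 dvd r - (i + 3) \<longleftrightarrow> 4 dvd r' - (i' + 3)" "4 dvd r - (i + 1) \<longleftrightarrow> 4 dvd r' - (i' + 1)"
      using * by (simp_all, presburger+)
    show ?thesis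
      unfolding qc_def sc_def ec_def ad_def op_def 1 2 3 bper[OF *(1)] bper[OF *(2)] by simp
  qed
  have swap: "qc j i = inverse (qc i j) \<and> sc j i r = - (qc j i * sc i j r) \<and> ec j i = - (qc j i * ec i j)"
    if "\<not> int 4 dvd i - j" for i j r
  proof -
    have ad: "ad j i r = ad i j r" by (simp add: ad_def)
    have "4 dvd j - i - 1 \<and> \<not> 4 dvd i - j - 1 \<or> 4 dvd i - j - 1 \<and> \<not> 4 dvd j - i - 1
      \<or> \<not> 4 dvd j - i - 1 \<and> \<not> 4 dvd i - j - 1 \<and> 4 dvd j - i - 2"
      using that by simp presburger
    then consider "4 dvd j - i - 1" "\<not> 4 dvd i - j - 1" | "4 dvd i - j - 1" "\<not> 4 dvd j - i - 1"
      | "\<not> 4 dvd j - i - 1" "\<not> 4 dvd i - j - 1" "4 dvd j - i - 2" by blast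
    then show ?thesis
    proof cases
      case 3
      have "4 dvd r - (j + 3) \<longleftrightarrow> 4 dvd r - (i + 1)" "4 dvd r - (j + 1) \<longleftrightarrow> 4 dvd r - (i + 3)" "even i \<longleftrightarrow> even j"
        using 3(3) by presburger+
      then have "op j r = - op i r" by (simp add: op_def b_def)
      then show ?thesis using 3 by (simp add: qc_def sc_def ec_def)
    qed (use \<alpha> in \<open>simp_all add: qc_def sc_def ec_def ad mult.commute\<close>)
  qed
  have c: "q i j = qc i j" "s i j r = sc i j r" "e i j = ec i j" if "\<not> int 4 dvd i - j" for i j r
    by (rule cyclic_coefficients[of qc sc ec, OF refl refl refl per swap that]; assumption)+
  have c1: "q i (i + 1) = \<alpha>" "s i (i + 1) r = ad i (i + 1) r" "e i (i + 1) = - (b i * b (i + 1))" for i r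
    using c(1)[of i "i + 1"] c(2)[of i "i + 1" r] c(3)[of i "i + 1"] by (simp_all add: qc_def sc_def ec_def)
  have c2: "q i (i + 2) = 1" "s i (i + 2) r = op i r" "e i (i + 2) = 0" for i r
    using c(1)[of i "i + 2"] c(2)[of i "i + 2" r] c(3)[of i "i + 2"] by (simp_all add: qc_def sc_def ec_def)
  have l1: "lin i (i + 1) = cnst (b i) * gen 4 i + cnst (b (i + 1)) * gen 4 (i + 1) - cnst (b i * b (i + 1))" for i
    using lin_two_terms[of i "i + 1" i "b i" "i + 1" "b (i + 1)"] by (simp add: c1 ad_def cnst_hom)
  have l2: "lin i (i + 2) = cnst (b (i + 1)) * (gen 4 (i + 3) - gen 4 (i + 1))" for i
    using lin_two_terms[of i "i + 2" "i + 3" "b (i + 1)" "i + 1" "- b (i + 1)"]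
    by (simp add: c2 op_def cnst_hom right_diff_distrib)
  have b2: "b (i + 2) = b i" for i by (simp add: b_def)
  have "b 0 = \<beta>" "b 1 = \<gamma>" by (simp_all add: b_def)
  then show ?thesis
    using quantisation_four[OF refl c1(1) c2(1) l1 l2 b2] genideal_relations4[OF refl c1(1) c2(1) l1 l2 b2] by simp
qed

lemma quantisation_ideal_relations5:
  assumes M: "M \<ge> 5" and D: "volterra_derivation M D" and \<alpha>: "\<alpha> \<noteq> 0"
  shows "quantisation_ideal M D (genideal (free_alg M) (relations5 M \<alpha>))"
proof -
  define qc where "qc i j = (if int M dvd i - j + 1 then \<alpha> else if int M dvd j - i + 1 then inverse \<alpha> else 1)" for i j :: int
  interpret derivation_relations M "\<lambda>i j. qc (int i) (int j)" "\<lambda>_ _ _. 0" "\<lambda>_ _. 0" D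
    by unfold_locales (use M in \<open>simp_all add: D qc_def \<alpha>\<close>)
  have per: "qc i j = qc i' j'" if "int M dvd i - i'" "int M dvd j - j'" for i i' j j'
    using eqv_cong[OF M0 that, of 1] eqv_cong[OF M0 that(2,1), of 1] by (simp add: qc_def)
  have swap: "qc j i = inverse (qc i j)" for i j
  proof -
    have "\<not> (int M dvd i - j + 1 \<and> int M dvd j - i + 1)"
    proof
      assume *: "int M dvd i - j + 1 \<and> int M dvd j - i + 1"
      have "int M dvd (i - j + 1) + (j - i + 1)" by (rule dvd_add[OF conjunct1[OF *] conjunct2[OF *]])
      then show False using M by (simp add: int_dvd_small)
    qed
    then show ?thesis using \<alpha> by (simp add: qc_def)
  qed
  have c: "q i j = qc i j" "s i j r = 0" "e i j = 0" if ij: "\<not> int M dvd i - j" for i j r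
  proof -
    note c = cyclic_coefficients[where qc = qc and sc = "\<lambda>_ _ _. 0" and ec = "\<lambda>_ _. 0"]
    have "q i j = qc i j \<and> s i j r = 0 \<and> e i j = 0"
      by (intro conjI c conjI per swap ij) simp_all
    then show "q i j = qc i j" "s i j r = 0" "e i j = 0" by simp_all
  qed
  have adj: "q i (i + 1) = \<alpha>" for i
    using c(1)[of i "i + 1"] M by (simp add: qc_def int_dvd_small)
  have non: "q i j = 1" if "\<not> int M dvd i - j" "\<not> int M dvd i + 1 - j" "\<not> int M dvd i - 1 - j" for i j
  proof -
    have "\<not> int M dvd j - (i - 1)" using that(3) eqv_sym by blast
    then show ?thesis using c(1)[OF that(1)] that by (simp add: qc_def algebra_simps)
  qed
  have lin: "lin i j = 0" if "\<not> int M dvd i - j" for i j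
    using c[OF that] by (simp add: lin_def cnst_hom)
  show ?thesis
    using quantisation_five[OF M adj non lin] genideal_relations5[OF M adj non lin] by simp
qed

theorem theorem5:
  fixes M :: nat
    and D :: "ncpoly \<Rightarrow> ncpoly"
    and \<omega> \<eta> :: "nat \<Rightarrow> nat \<Rightarrow> complex"
    and \<sigma> :: "nat \<Rightarrow> nat \<Rightarrow> nat \<Rightarrow> complex"
  assumes "M \<ge> 3"
    and "volterra_derivation M D"
    and "\<And>i j. 1 \<le> i \<Longrightarrow> i < j \<Longrightarrow> j \<le> M \<Longrightarrow> \<omega> i j \<noteq> 0"
  shows "quantisation_ideal M D (genideal (free_alg M) (comm_polys M \<omega> \<sigma> \<eta>)) \<longleftrightarrow>
    (\<exists>\<alpha> \<beta> \<gamma> \<eta>'. \<alpha> \<noteq> 0 \<and>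
       equivalent_relations M (comm_polys M \<omega> \<sigma> \<eta>) (volterra_relations M \<alpha> \<beta> \<gamma> \<eta>'))"
    (is "?Q \<longleftrightarrow> ?R")
proof
  interpret derivation_relations M \<omega> \<sigma> \<eta> D
    by unfold_locales (fact assms)+
  assume ?Q
  then interpret volterra_quantisation M \<omega> \<sigma> \<eta> D
    by unfold_locales (simp_all add: quantisation_ideal_def I_def)
  show ?R
    using quantisation_relations unfolding equivalent_relations_def I_def by metis
next
  assume ?R
  then obtain \<alpha> \<beta> \<gamma> \<eta>' where \<alpha>: "\<alpha> \<noteq> 0" and
    eq: "genideal (free_alg M) (comm_polys M \<omega> \<sigma> \<eta>) = genideal (free_alg M) (volterra_relations M \<alpha> \<beta> \<gamma> \<eta>')"
    unfolding equivalent_relations_def by blast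
  consider "M = 3" | "M = 4" | "M \<ge> 5" using assms(1) by linarith
  then show ?Q
  proof cases
    case 1
    then show ?thesis
      unfolding eq using assms(2) quantisation_ideal_relations3[OF _ \<alpha>] by (simp add: volterra_relations_def)
  next
    case 2
    then show ?thesis
      unfolding eq using assms(2) quantisation_ideal_relations4[OF _ \<alpha>] by (simp add: volterra_relations_def)
  next
    case 3
    then show ?thesis
      unfolding eq using quantisation_ideal_relations5[OF 3 assms(2) \<alpha>] by (simp add: volterra_relations_def)
  qed
qed

end
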